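(* Let $\boldsymbol\lambda=(\lambda^{(1)},\dots,\lambda^{(k)})$ be non-degenerate $\mathfrak{gl}_{1|1}$-weights, $\boldsymbol b\in\mathbb{C}^k$, $Q=\mathrm{diag}(q_1,q_2)$ with $q_1,q_2\in\mathbb{C}^\times$. Suppose $L(\boldsymbol\lambda,\boldsymbol b)$ is an irreducible $\mathrm{Y}(\mathfrak{gl}_{1|1})$-module, and if $q_1=q_2$ suppose in addition $\sum_{s=1}^k(\lambda^{(s)}_1+\lambda^{(s)}_2)\ne0$. If $q_1\varphi_{\boldsymbol\lambda,\boldsymbol b}-q_2\psi_{\boldsymbol\lambda,\boldsymbol b}$ has no multiple roots, then the transfer matrix $\mathcal T_Q(x)$ is diagonalizable on $L(\boldsymbol\lambda,\boldsymbol b)$ and the Bethe ansatz is complete. In particular, for any given $\boldsymbol\lambda$ (with $\sum_s(\lambda^{(s)}_1+\lambda^{(s)}_2)\ne0$ if $q_1=q_2$) and generic $\boldsymbol b$, $\mathcal T_Q(x)$ is diagonalizable and the Bethe ansatz is complete.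
   Context: $\mathbb{C}^{1|1}$ with basis $v_1$ (even), $v_2$ (odd), $|1|=\bar0,|2|=\bar1$; $\mathfrak{gl}_{1|1}$ with basis $e_{ij}$, $[e_{ij},e_{rs}]=\delta_{jr}e_{is}-(-1)^{(|i|+|j|)(|r|+|s|)}\delta_{is}e_{rj}$. $P=\sum_{i,j}(-1)^{|j|}E_{ij}\otimes E_{ji}$, $\mathcal R(x)=1+P/x$. $\mathrm{Y}(\mathfrak{gl}_{1|1})$ is generated by $T^{(r)}_{ij}$ ($r\ge1$, parity $|i|+|j|$) with $\mathcal R^{(12)}(x_1-x_2)T^{(13)}(x_1)T^{(23)}(x_2)=T^{(23)}(x_2)T^{(13)}(x_1)\mathcal R^{(12)}(x_1-x_2)$, $T_{ij}(x)=\delta_{ij}+\sum_rT^{(r)}_{ij}x^{-r}$; coproduct $\Delta(T_{ij}(x))=\sum_rT_{rj}(x)\otimes T_{ir}(x)$; $e_{ij}\mapsto(-1)^{|i|}T^{(1)}_{ji}$. Evaluation module $M(z)$: $T_{ij}(x)$ acts by $\delta_{ij}+(-1)^{|j|}e_{ji}(x-z)^{-1}$. A weight $\lambda=(\lambda_1,\lambda_2)\in\mathbb{C}^2$ is non-degenerate if $\lambda_1+\lambda_2\ne0$; $L_\lambda$ is the (two-dimensional) irreducible module generated by even $v_\lambda$ with $e_{12}v_\lambda=0$, $e_{ii}v_\lambda=\lambda_iv_\lambda$. $L(\boldsymbol\lambda,\boldsymbol b)=\bigotimes_sL_{\lambda^{(s)}}(b_s)$, vacuum $|0\rangle=\otimes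 v_{\lambda^{(s)}}$. $\varphi_{\boldsymbol\lambda,\boldsymbol b}(x)=\prod_s(x-b_s+\lambda^{(s)}_1)$, $\psi_{\boldsymbol\lambda,\boldsymbol b}(x)=\prod_s(x-b_s-\lambda^{(s)}_2)$. $\mathcal T_Q(x)=q_1T_{11}(x)-q_2T_{22}(x)$; diagonalizable means the commuting coefficients of $\mathcal T_Q(x)$ are simultaneously diagonalizable. Singular vectors: $e_{12}v=0$. Bethe vectors: for $\boldsymbol t\in\mathbb{C}^l$, $y_{\boldsymbol t}=\prod(x-t_i)$; $\boldsymbol t$ is a solution of the Bethe ansatz equation if $y_{\boldsymbol t}\mid q_1\varphi_{\boldsymbol\lambda,\boldsymbol b}-q_2\psi_{\boldsymbol\lambda,\boldsymbol b}$; $\widehat{\mathbb B}_l(\boldsymbol t)=\prod_{i,s}(t_i-b_s)\prod_{i<j}(t_j-t_i+1)^{-1}T_{12}(t_1)\cdots T_{12}(t_l)|0\rangle$ ($T_{12}(t)$: the rational operator $T_{12}(x)$ on $L(\boldsymbol\lambda,\boldsymbol b)$ at $x=t$, extended by continuity), on-shell if $\boldsymbol t$ is a solution. The Bethe ansatz is complete if (1) all on-shell Bethe vectors are non-zero and (2) every eigenvector of $\mathcal T_Q(x)$ in $L(\boldsymbol\lambda,\boldsymbol b)$ if $q_1\ne q_2$, resp. in the singular subspace if $q_1=q_2$, is a non-zero multiple of some on-shell Bethe vector. *)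

theory Defs
  imports "HOL-Analysis.Analysis" "HOL-Computational_Algebra.Polynomial"
begin

text \<open>
Conventions.  Indices of C^{1|1}: False = index 1 (even), True = index 2 (odd);
the parity of index i is i itself.
A gl(1|1)-weight is a pair (lambda_1, lambda_2).  The module L_lambda has basis
v (even, encoded False) and w = e21 v (odd, encoded True).
The tensor product L(lam,b) of k factors (factor s = 0..k-1 has weight lam s and
evaluation point b s) has basis indexed by sets S with S a subset of {..<k}:
the factor s carries w iff s is in S.  Vectors are functions nat set => complex
vanishing outside Pow {..<k}; operators are matrices nat set => nat set => complex
(entry M S' S = coefficient of basis vector S' in M applied to basis vector S).
\<close>

type_synonym wt = "complex \<times> complex"
type_synonym svec = "nat set \<Rightarrow> complex"
type_synonym smat = "nat set \<Rightarrow> nat set \<Rightarrow> complex"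

definition nondeg :: "wt \<Rightarrow> bool" where
  "nondeg lm \<longleftrightarrow> fst lm + snd lm \<noteq> 0"

text \<open>Matrix entry (out, in) of e_ab on L_lambda (basis v = False, w = True).\<close>
definition emat :: "wt \<Rightarrow> bool \<Rightarrow> bool \<Rightarrow> bool \<Rightarrow> bool \<Rightarrow> complex" where
  "emat lm a c out inp =
     (if \<not> a \<and> \<not> c then (if out = inp then (if inp then fst lm - 1 else fst lm) else 0)
      else if a \<and> c then (if out = inp then (if inp then snd lm + 1 else snd lm) else 0)
      else if a \<and> \<not> c then (if out \<and> \<not> inp then 1 else 0)
      else (if \<not> out \<and> inp then fst lm + snd lm else 0))"

definition psign :: "bool \<Rightarrow> complex" where
  "psign p = (if p then -1 else 1)"

text \<open>Evaluation module L_lambda(z): T_ij(x) acts by delta_ij + (-1)^|j| e_ji (x - z)^-1.\<close>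
definition fmat :: "wt \<Rightarrow> complex \<Rightarrow> complex \<Rightarrow> bool \<Rightarrow> bool \<Rightarrow> bool \<Rightarrow> bool \<Rightarrow> complex" where
  "fmat lm z x i j out inp =
     (if i = j \<and> out = inp then 1 else 0) + psign j * emat lm j i out inp / (x - z)"

text \<open>Coefficient T^(n)_ij on L_lambda(z) (n = 0 gives delta_ij):
  (x-z)^-1 = sum_{m>=0} z^m x^-(m+1).\<close>
fun fcoef :: "wt \<Rightarrow> complex \<Rightarrow> nat \<Rightarrow> bool \<Rightarrow> bool \<Rightarrow> bool \<Rightarrow> bool \<Rightarrow> complex" where
  "fcoef lm z 0 i j out inp = (if i = j \<and> out = inp then 1 else 0)"
| "fcoef lm z (Suc m) i j out inp = psign j * z ^ m * emat lm j i out inp"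

text \<open>Super tensor product sign (-1)^{|B||u|} for (A (x) B)(u (x) v), where u is the
 basis vector of the first k factors given by S and B has parity (i <> r).\<close>
definition tsign :: "nat \<Rightarrow> bool \<Rightarrow> bool \<Rightarrow> nat set \<Rightarrow> complex" where
  "tsign k i r S = psign (i \<noteq> r \<and> odd (card (S \<inter> {..<k})))"

text \<open>T_ij(x) on L(lam,b) with k factors, via Delta(T_ij(x)) = sum_r T_rj(x) (x) T_ir(x).\<close>
primrec Tmat :: "(nat \<Rightarrow> wt) \<Rightarrow> (nat \<Rightarrow> complex) \<Rightarrow> nat \<Rightarrow> complex \<Rightarrow> bool \<Rightarrow> bool \<Rightarrow> smat" where
  "Tmat lam b 0 x i j S' S = (if i = j \<and> S' = {} \<and> S = {} then 1 else 0)"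
| "Tmat lam b (Suc k) x i j S' S =
     (\<Sum>r\<in>UNIV. tsign k i r S * Tmat lam b k x r j (S' \<inter> {..<k}) (S \<inter> {..<k})
                 * fmat (lam k) (b k) x i r (k \<in> S') (k \<in> S))"

primrec Tcoef :: "(nat \<Rightarrow> wt) \<Rightarrow> (nat \<Rightarrow> complex) \<Rightarrow> nat \<Rightarrow> nat \<Rightarrow> bool \<Rightarrow> bool \<Rightarrow> smat" where
  "Tcoef lam b 0 n i j S' S = (if n = 0 \<and> i = j \<and> S' = {} \<and> S = {} then 1 else 0)"
| "Tcoef lam b (Suc k) n i j S' S =
     (\<Sum>r\<in>UNIV. \<Sum>p\<le>n. tsign k i r S * Tcoef lam b k p r j (S' \<inter> {..<k}) (S \<inter> {..<k})
                 * fcoef (lam k) (b k) (n - p) i r (k \<in> S') (k \<in> S))"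

definition Vsp :: "nat \<Rightarrow> svec set" where
  "Vsp k = {v. \<forall>S. \<not> S \<subseteq> {..<k} \<longrightarrow> v S = 0}"

definition appM :: "nat \<Rightarrow> smat \<Rightarrow> svec \<Rightarrow> svec" where
  "appM k M v = (\<lambda>S'. if S' \<subseteq> {..<k} then \<Sum>S\<in>Pow {..<k}. M S' S * v S else 0)"

definition vac :: svec where
  "vac = (\<lambda>S. if S = {} then 1 else 0)"

definition TQcoef :: "(nat \<Rightarrow> wt) \<Rightarrow> (nat \<Rightarrow> complex) \<Rightarrow> nat \<Rightarrow> complex \<Rightarrow> complex \<Rightarrow> nat \<Rightarrow> smat" where
  "TQcoef lam b k q1 q2 n = (\<lambda>S' S. q1 * Tcoef lam b k n False False S' S - q2 * Tcoef lam b k n True True S' S)"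

definition TQeigvec :: "(nat \<Rightarrow> wt) \<Rightarrow> (nat \<Rightarrow> complex) \<Rightarrow> nat \<Rightarrow> complex \<Rightarrow> complex \<Rightarrow> svec \<Rightarrow> bool" where
  "TQeigvec lam b k q1 q2 v \<longleftrightarrow> v \<in> Vsp k \<and> v \<noteq> (\<lambda>S. 0) \<and>
     (\<forall>n\<ge>1. \<exists>c. appM k (TQcoef lam b k q1 q2 n) v = (\<lambda>S. c * v S))"

definition TQdiag :: "(nat \<Rightarrow> wt) \<Rightarrow> (nat \<Rightarrow> complex) \<Rightarrow> nat \<Rightarrow> complex \<Rightarrow> complex \<Rightarrow> bool" where
  "TQdiag lam b k q1 q2 \<longleftrightarrow> (\<exists>B. finite B \<and> (\<forall>u\<in>B. TQeigvec lam b k q1 q2 u) \<and>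
     (\<forall>v\<in>Vsp k. \<exists>a. v = (\<lambda>S. \<Sum>u\<in>B. a u * u S)) \<and>
     (\<forall>a. (\<lambda>S. \<Sum>u\<in>B. a u * u S) = (\<lambda>S. 0) \<longrightarrow> (\<forall>u\<in>B. a u = 0)))"

text \<open>Singular vectors: e12 v = 0, where e12 acts by (-1)^|1| T^(1)_21.\<close>
definition singular :: "(nat \<Rightarrow> wt) \<Rightarrow> (nat \<Rightarrow> complex) \<Rightarrow> nat \<Rightarrow> svec \<Rightarrow> bool" where
  "singular lam b k v \<longleftrightarrow> v \<in> Vsp k \<and> appM k (Tcoef lam b k 1 True False) v = (\<lambda>S. 0)"

definition evenpart :: "svec \<Rightarrow> svec" where
  "evenpart v = (\<lambda>S. if even (card S) then v S else 0)"

definition irreducible_mod :: "(nat \<Rightarrow> wt) \<Rightarrow> (nat \<Rightarrow> complex) \<Rightarrow> nat \<Rightarrow> bool" where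
  "irreducible_mod lam b k \<longleftrightarrow>
     (\<forall>W. W \<subseteq> Vsp k \<and> (\<lambda>S. 0) \<in> W \<and> (\<forall>u\<in>W. \<forall>v\<in>W. (\<lambda>S. u S + v S) \<in> W) \<and>
          (\<forall>c. \<forall>v\<in>W. (\<lambda>S. c * v S) \<in> W) \<and> (\<forall>v\<in>W. evenpart v \<in> W) \<and>
          (\<forall>r\<ge>1. \<forall>i j. \<forall>v\<in>W. appM k (Tcoef lam b k r i j) v \<in> W)
      \<longrightarrow> W = {\<lambda>S. 0} \<or> W = Vsp k)"

definition phi_poly :: "(nat \<Rightarrow> wt) \<Rightarrow> (nat \<Rightarrow> complex) \<Rightarrow> nat \<Rightarrow> complex poly" where
  "phi_poly lam b k = (\<Prod>s<k. [: fst (lam s) - b s, 1 :])"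

definition psi_poly :: "(nat \<Rightarrow> wt) \<Rightarrow> (nat \<Rightarrow> complex) \<Rightarrow> nat \<Rightarrow> complex poly" where
  "psi_poly lam b k = (\<Prod>s<k. [: - b s - snd (lam s), 1 :])"

definition BAE_sol :: "(nat \<Rightarrow> wt) \<Rightarrow> (nat \<Rightarrow> complex) \<Rightarrow> nat \<Rightarrow> complex \<Rightarrow> complex \<Rightarrow> nat \<Rightarrow> (nat \<Rightarrow> complex) \<Rightarrow> bool" where
  "BAE_sol lam b k q1 q2 l t \<longleftrightarrow>
     (\<Prod>i<l. [: - t i, 1 :]) dvd (smult q1 (phi_poly lam b k) - smult q2 (psi_poly lam b k))"

definition Bexpr :: "(nat \<Rightarrow> wt) \<Rightarrow> (nat \<Rightarrow> complex) \<Rightarrow> nat \<Rightarrow> nat \<Rightarrow> (nat \<Rightarrow> complex) \<Rightarrow> svec" where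
  "Bexpr lam b k l t =
     (let c = (\<Prod>i<l. \<Prod>s<k. t i - b s) / (\<Prod>j<l. \<Prod>i<j. t j - t i + 1);
          w = foldr (\<lambda>i v. appM k (Tmat lam b k (t i) False True) v) [0..<l] vac
      in (\<lambda>S. c * w S))"

definition Bdom :: "(nat \<Rightarrow> complex) \<Rightarrow> nat \<Rightarrow> nat \<Rightarrow> (nat \<Rightarrow> complex) \<Rightarrow> (nat \<Rightarrow> complex) set" where
  "Bdom b k l t = {t'. (\<forall>i\<ge>l. t' i = t i) \<and> (\<forall>i<l. \<forall>s<k. t' i \<noteq> b s) \<and>
                       (\<forall>j<l. \<forall>i<j. t' j - t' i + 1 \<noteq> 0)}"

text \<open>Bethe vector, extended by continuity (limit taken componentwise, in t restricted to C^l).\<close>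
definition bethe :: "(nat \<Rightarrow> wt) \<Rightarrow> (nat \<Rightarrow> complex) \<Rightarrow> nat \<Rightarrow> nat \<Rightarrow> (nat \<Rightarrow> complex) \<Rightarrow> svec" where
  "bethe lam b k l t =
     (if l = 0 then Bexpr lam b k 0 t
      else (\<lambda>S. Lim (at t within Bdom b k l t) (\<lambda>t'. Bexpr lam b k l t' S)))"

definition BA_complete :: "(nat \<Rightarrow> wt) \<Rightarrow> (nat \<Rightarrow> complex) \<Rightarrow> nat \<Rightarrow> complex \<Rightarrow> complex \<Rightarrow> bool" where
  "BA_complete lam b k q1 q2 \<longleftrightarrow>
     (\<forall>l t. BAE_sol lam b k q1 q2 l t \<longrightarrow> bethe lam b k l t \<noteq> (\<lambda>S. 0)) \<and>
     (\<forall>v. TQeigvec lam b k q1 q2 v \<and> (q1 = q2 \<longrightarrow> singular lam b k v) \<longrightarrow>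
        (\<exists>l t c. BAE_sol lam b k q1 q2 l t \<and> c \<noteq> 0 \<and> v = (\<lambda>S. c * bethe lam b k l t S)))"

definition polyfun :: "nat \<Rightarrow> ((nat \<Rightarrow> complex) \<Rightarrow> complex) \<Rightarrow> bool" where
  "polyfun k f \<longleftrightarrow> (\<exists>M c. finite M \<and> (\<forall>b. f b = (\<Sum>m\<in>M. c m * (\<Prod>s<k. b s ^ m s))))"

end

theory Submission
  imports
    Defs
    "HOL-Library.Function_Algebras"
    "HOL-Computational_Algebra.Field_as_Ring"
    "HOL-Computational_Algebra.Fundamental_Theorem_Algebra"
    "Subresultants.Subresultant_Gcd"
begin

text \<open>
  After clearing denominators, the entries \<open>A, B, C, D\<close> of the monodromy matrix satisfy the RTT relations
  as polynomial identities, by induction on the number of factors. The exchange relation of \<open>B\<close> with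
  \<open>q1 A - q2 D\<close> makes every string \<open>B(t_1) ... B(t_l)\<close> applied to the vacuum an eigenvector when the \<open>t_i\<close>
  are distinct roots of \<open>p = q1 phi - q2 psi\<close>.

  The point is that these vectors do not vanish. Let \<open>v_I\<close> be the string over a set \<open>I\<close> of roots. As a
  polynomial in \<open>x\<close>, \<open>B(x) v_I\<close> has degree below the number \<open>k\<close> of factors and vanishes at \<open>r + 1\<close> for all \<open>r\<close> in \<open>I\<close>;
  the quotient is determined by its values at the roots outside \<open>I\<close>, which are multiples of the \<open>v_J\<close> with
  \<open>J = I + {r}\<close>, and, if \<open>q1 = q2\<close>, by its leading coefficient, a multiple of \<open>e21 v_I\<close>. Hence the
  \<open>2^k\<close> vectors \<open>v_I\<close> (resp. \<open>v_I\<close> and \<open>e21 v_I\<close>) span all strings. If the vacuum is cyclic under \<open>B\<close>, which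
  irreducibility implies and which also holds for generic \<open>b\<close>, they therefore form a basis of the
  \<open>2^k\<close>-dimensional space. Distinct sets \<open>I\<close> give distinct eigenvalues, so there are no further
  eigenvectors (resp. singular ones).
\<close>

section \<open>Transfer operators in block form\<close>

text \<open>Two roots of \<open>p\<close> may differ by 1, and this shapes the proof. For x = y + 1
  the exchange relation of two \<open>B\<close> reads 2 B(y + 1) B(y) = 0, which produces the zeros
  of B(x) v_I at r + 1. It is also why strings are taken in an order in which no root is followed by
  itself minus 1. A Bethe vector is a limit of an expression symmetric in its arguments, so it can
  be computed in such an order. No norm formula is used to see that a string is non-zero: a spanning
  family of at most 2^k vectors in dimension 2^k is independent, so it does not contain 0. For q1 =
  q2 the terms of degree k in \<open>p\<close> cancel, and its leading coefficient is q1 times the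
  sum of all lambda_1 + lambda_2, in degree k - 1. That leaves 2^(k-1) strings; e21 commutes with
  the transfer matrix and supplies the other half. The same leading coefficient makes e12 e21 v_I a
  non-zero multiple of v_I. Genericity of \<open>b\<close> is explicit: b_s - lambda_1^(s) differs
  from b_r + lambda_2^(r) for r < s, and a discriminant does not vanish. A point satisfying both is
  found by spacing the points widely and then moving the last one.\<close>

hide_const (open) Module.smult

definition scal :: "complex \<Rightarrow> svec \<Rightarrow> svec" (infixr "\<star>" 75) where
  "c \<star> v = (\<lambda>S. c * v S)"

lemma scal_apply [simp]: "(c \<star> v) S = c * v S"
  by (simp add: scal_def)

interpretation sv: vector_space scal
  by unfold_locales (auto simp: fun_eq_iff algebra_simps)

lemma sum_fun_apply [simp]: "(\<Sum>i\<in>I. f i) S = (\<Sum>i\<in>I. f i S)"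
  for f :: "'i \<Rightarrow> 'a \<Rightarrow> 'b::comm_monoid_add"
  by (induction I rule: infinite_finite_induct) auto

text \<open>\<open>lpoly\<close> is \<open>(x - z) * fmat\<close> and \<open>pmat\<close> is \<open>Tmat\<close> times the product of the \<open>x - b s\<close>: with the
  denominators cleared, all relations hold at every point, including the evaluation points.\<close>

definition lpoly :: "wt \<Rightarrow> complex \<Rightarrow> bool \<Rightarrow> bool \<Rightarrow> bool \<Rightarrow> bool \<Rightarrow> complex poly" where
  "lpoly lm z i j out inp =
     [: (if i = j \<and> out = inp then - z else 0) + psign j * emat lm j i out inp,
        if i = j \<and> out = inp then 1 else 0 :]"

primrec pmat :: "(nat \<Rightarrow> wt) \<Rightarrow> (nat \<Rightarrow> complex) \<Rightarrow> nat \<Rightarrow> bool \<Rightarrow> bool \<Rightarrow> nat set \<Rightarrow> nat set \<Rightarrow> complex poly" where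
  "pmat lam b 0 i j S' S = (if i = j \<and> S' = {} \<and> S = {} then 1 else 0)"
| "pmat lam b (Suc k) i j S' S =
     (\<Sum>r\<in>UNIV. smult (tsign k i r S) (pmat lam b k r j (S' \<inter> {..<k}) (S \<inter> {..<k})
                 * lpoly (lam k) (b k) i r (k \<in> S') (k \<in> S)))"

text \<open>The components of a vector along \<open>v\<close> and \<open>w\<close> of the last tensor factor; \<open>par\<close> produces the
  signs of the super tensor product.\<close>

definition low :: "nat \<Rightarrow> svec \<Rightarrow> svec" where
  "low k v = (\<lambda>S. if S \<subseteq> {..<k} then v S else 0)"

definition high :: "nat \<Rightarrow> svec \<Rightarrow> svec" where
  "high k v = (\<lambda>S. if S \<subseteq> {..<k} then v (insert k S) else 0)"

definition par :: "svec \<Rightarrow> svec" where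
  "par v = (\<lambda>S. psign (odd (card S)) * v S)"

lemma sum_Pow_Suc:
  "(\<Sum>S\<in>Pow {..<Suc k}. f S) = (\<Sum>S\<in>Pow {..<k}. f S + (f (insert k S) :: 'a::comm_monoid_add))"
proof -
  have "inj_on (insert k) (Pow {..<k})"
    by (rule inj_onI) (metis Pow_iff insert_ident lessThan_iff less_irrefl subsetD)
  then show ?thesis
    unfolding lessThan_Suc Pow_insert
    by (subst sum.union_disjoint) (auto simp: sum.reindex sum.distrib)
qed

lemma appM_add: "appM k M (u + v) = appM k M u + appM k M v"
  by (auto simp: appM_def fun_eq_iff sum.distrib algebra_simps)

lemma appM_scal: "appM k M (c \<star> v) = c \<star> appM k M v"
  by (auto simp: appM_def fun_eq_iff sum_distrib_left algebra_simps)

lemma appM_Vsp [simp]: "appM k M v \<in> Vsp k"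
  by (auto simp: appM_def Vsp_def)

lemma Vsp_subspace: "sv.subspace (Vsp k)"
  by (auto simp: sv.subspace_def Vsp_def)

lemma low_add [simp]: "low k (u + v) = low k u + low k v"
  and high_add [simp]: "high k (u + v) = high k u + high k v"
  and low_diff [simp]: "low k (u - v) = low k u - low k v"
  and high_diff [simp]: "high k (u - v) = high k u - high k v"
  and low_scal [simp]: "low k (c \<star> u) = c \<star> low k u"
  and high_scal [simp]: "high k (c \<star> u) = c \<star> high k u"
  by (auto simp: low_def high_def fun_eq_iff)

lemma par_add [simp]: "par (u + v) = par u + par v"
  and par_diff [simp]: "par (u - v) = par u - par v"
  and par_uminus [simp]: "par (- u) = - par u"
  and par_scal [simp]: "par (c \<star> u) = c \<star> par u"
  and par_par [simp]: "par (par u) = u"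
  by (auto simp: par_def psign_def fun_eq_iff algebra_simps)

lemma Vsp_Suc_eqI:
  assumes "u \<in> Vsp (Suc k)" "v \<in> Vsp (Suc k)" "low k u = low k v" "high k u = high k v"
  shows "u = v"
proof
  fix S
  consider "\<not> S \<subseteq> {..<Suc k}" | "S \<subseteq> {..<k}" | "S \<subseteq> {..<Suc k}" "k \<in> S"
    by (metis lessThan_Suc subset_insert)
  then show "u S = v S"
  proof cases
    case 1
    then show ?thesis using assms(1,2) by (simp add: Vsp_def)
  next
    case 2
    then show ?thesis using fun_cong[OF assms(3), of S] by (simp add: low_def)
  next
    case 3
    then have "S - {k} \<subseteq> {..<k}" "insert k (S - {k}) = S" by auto
    then show ?thesis using fun_cong[OF assms(4), of "S - {k}"] by (simp add: high_def)
  qed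
qed

locale chain =
  fixes lam :: "nat \<Rightarrow> wt" and b :: "nat \<Rightarrow> complex"
begin

definition T :: "nat \<Rightarrow> bool \<Rightarrow> bool \<Rightarrow> complex \<Rightarrow> svec \<Rightarrow> svec" where
  "T k i j x = appM k (\<lambda>S' S. poly (pmat lam b k i j S' S) x)"

abbreviation "A k \<equiv> T k False False"
abbreviation "B k \<equiv> T k False True"
abbreviation "C k \<equiv> T k True False"
abbreviation "D k \<equiv> T k True True"

lemma T_add [simp]: "T k i j x (u + v) = T k i j x u + T k i j x v"
  and T_scal [simp]: "T k i j x (c \<star> v) = c \<star> T k i j x v"
  and T_Vsp [simp]: "T k i j x v \<in> Vsp k"
  by (simp_all add: T_def appM_add appM_scal)

lemma T_zero [simp]: "T k i j x 0 = 0"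
  using T_scal[of k i j x 0 0] by (simp add: scal_def zero_fun_def)

lemma T_uminus [simp]: "T k i j x (- v) = - T k i j x v"
  using T_scal[of k i j x "-1" v] by (simp add: scal_def fun_Compl_def)

lemma T_diff [simp]: "T k i j x (u - v) = T k i j x u - T k i j x v"
  using T_add[of k i j x u "- v"] by simp

text \<open>The sign from moving the operator on the last factor, of parity
  \<open>i \<noteq> r\<close>, past a vector of the first \<open>k\<close> factors.\<close>

definition sg :: "bool \<Rightarrow> bool \<Rightarrow> svec \<Rightarrow> svec" where
  "sg i r u = (if i = r then u else par u)"

lemma pmat_low: "S' \<subseteq> {..<k} \<Longrightarrow> S \<subseteq> {..<k} \<Longrightarrow>
    pmat lam b (Suc k) i j S' S = (\<Sum>r\<in>UNIV. smult (psign (i \<noteq> r \<and> odd (card S)))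
      (pmat lam b k r j S' S * lpoly (lam k) (b k) i r False False))"
  and pmat_low_high: "S' \<subseteq> {..<k} \<Longrightarrow> S \<subseteq> {..<k} \<Longrightarrow>
    pmat lam b (Suc k) i j S' (insert k S) = (\<Sum>r\<in>UNIV. smult (psign (i \<noteq> r \<and> odd (card S)))
      (pmat lam b k r j S' S * lpoly (lam k) (b k) i r False True))"
  and pmat_high_low: "S' \<subseteq> {..<k} \<Longrightarrow> S \<subseteq> {..<k} \<Longrightarrow>
    pmat lam b (Suc k) i j (insert k S') S = (\<Sum>r\<in>UNIV. smult (psign (i \<noteq> r \<and> odd (card S)))
      (pmat lam b k r j S' S * lpoly (lam k) (b k) i r True False))"
  and pmat_high: "S' \<subseteq> {..<k} \<Longrightarrow> S \<subseteq> {..<k} \<Longrightarrow>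
    pmat lam b (Suc k) i j (insert k S') (insert k S) = (\<Sum>r\<in>UNIV. smult (psign (i \<noteq> r \<and> odd (card S)))
      (pmat lam b k r j S' S * lpoly (lam k) (b k) i r True True))"
proof -
  assume *: "S' \<subseteq> {..<k}" "S \<subseteq> {..<k}"
  then have [simp]: "S' \<inter> {..<k} = S'" "S \<inter> {..<k} = S" "k \<notin> S" "k \<notin> S'"
    "insert k S \<inter> {..<k} = S" "insert k S' \<inter> {..<k} = S'" by auto
  show "pmat lam b (Suc k) i j S' S = (\<Sum>r\<in>UNIV. smult (psign (i \<noteq> r \<and> odd (card S)))
      (pmat lam b k r j S' S * lpoly (lam k) (b k) i r False False))"
   "pmat lam b (Suc k) i j S' (insert k S) = (\<Sum>r\<in>UNIV. smult (psign (i \<noteq> r \<and> odd (card S)))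
      (pmat lam b k r j S' S * lpoly (lam k) (b k) i r False True))"
   "pmat lam b (Suc k) i j (insert k S') S = (\<Sum>r\<in>UNIV. smult (psign (i \<noteq> r \<and> odd (card S)))
      (pmat lam b k r j S' S * lpoly (lam k) (b k) i r True False))"
   "pmat lam b (Suc k) i j (insert k S') (insert k S) = (\<Sum>r\<in>UNIV. smult (psign (i \<noteq> r \<and> odd (card S)))
      (pmat lam b k r j S' S * lpoly (lam k) (b k) i r True True))"
    by (simp_all add: tsign_def)
qed

lemma low_T: "low k (T (Suc k) i j x v) = (\<Sum>r\<in>UNIV.
    poly (lpoly (lam k) (b k) i r False False) x \<star> T k r j x (sg i r (low k v)) +
    poly (lpoly (lam k) (b k) i r False True) x \<star> T k r j x (sg i r (high k v)))"
proof
  fix S'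
  show "low k (T (Suc k) i j x v) S' = (\<Sum>r\<in>UNIV.
    poly (lpoly (lam k) (b k) i r False False) x \<star> T k r j x (sg i r (low k v)) +
    poly (lpoly (lam k) (b k) i r False True) x \<star> T k r j x (sg i r (high k v))) S'"
  proof (cases "S' \<subseteq> {..<k}")
    case True
    then have "S' \<subseteq> {..<Suc k}" by auto
    then show ?thesis using True
      unfolding low_def high_def T_def appM_def sum_Pow_Suc
      by (simp add: pmat_low pmat_low_high UNIV_bool sg_def par_def psign_def sum.distrib
        sum_distrib_left algebra_simps del: pmat.simps)
  qed (simp add: low_def T_def appM_def)
qed

lemma high_T: "high k (T (Suc k) i j x v) = (\<Sum>r\<in>UNIV.
    poly (lpoly (lam k) (b k) i r True False) x \<star> T k r j x (sg i r (low k v)) +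
    poly (lpoly (lam k) (b k) i r True True) x \<star> T k r j x (sg i r (high k v)))"
proof
  fix S'
  show "high k (T (Suc k) i j x v) S' = (\<Sum>r\<in>UNIV.
    poly (lpoly (lam k) (b k) i r True False) x \<star> T k r j x (sg i r (low k v)) +
    poly (lpoly (lam k) (b k) i r True True) x \<star> T k r j x (sg i r (high k v))) S'"
  proof (cases "S' \<subseteq> {..<k}")
    case True
    then have "insert k S' \<subseteq> {..<Suc k}" by auto
    then show ?thesis using True
      unfolding low_def high_def T_def appM_def sum_Pow_Suc
      by (simp add: pmat_high_low pmat_high UNIV_bool sg_def par_def psign_def sum.distrib
        sum_distrib_left algebra_simps del: pmat.simps)
  qed (simp add: high_def T_def appM_def)
qed

abbreviation "al k x \<equiv> x - b k + fst (lam k)"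
abbreviation "de k x \<equiv> x - b k - snd (lam k)"
abbreviation "ga k \<equiv> fst (lam k) + snd (lam k)"

text \<open>The row index decides the shape. For row 1 the last factor acts by e11 and e21, so
  \<open>A\<close> and \<open>B\<close> are lower triangular in (\<open>low\<close>,
  \<open>high\<close>); for row 2 it acts by e12 and e22, so \<open>C\<close> and \<open>D\<close>
  are upper triangular. The shifts by 1 are the weights of \<open>w\<close> relative to
  \<open>v\<close>, and \<open>ga\<close> is the coefficient of e12 w.\<close>

lemma block_simps:
  "low k (A (Suc k) x v) = al k x \<star> A k x (low k v)"
  "high k (A (Suc k) x v) = (al k x - 1) \<star> A k x (high k v) - C k x (par (low k v))"
  "low k (B (Suc k) x v) = al k x \<star> B k x (low k v)"
  "high k (B (Suc k) x v) = (al k x - 1) \<star> B k x (high k v) - D k x (par (low k v))"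
  "low k (C (Suc k) x v) = de k x \<star> C k x (low k v) + ga k \<star> A k x (par (high k v))"
  "high k (C (Suc k) x v) = (de k x - 1) \<star> C k x (high k v)"
  "low k (D (Suc k) x v) = de k x \<star> D k x (low k v) + ga k \<star> B k x (par (high k v))"
  "high k (D (Suc k) x v) = (de k x - 1) \<star> D k x (high k v)"
  by (simp_all add: low_T high_T UNIV_bool sg_def lpoly_def psign_def emat_def fun_eq_iff algebra_simps)

lemma pmat_parity:
  "S' \<subseteq> {..<k} \<Longrightarrow> S \<subseteq> {..<k} \<Longrightarrow> (odd (card S') \<noteq> odd (card S)) \<noteq> (i \<noteq> j) \<Longrightarrow> pmat lam b k i j S' S = 0"
proof (induction k arbitrary: i j S S')
  case 0
  then show ?case by auto
next
  case (Suc k)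
  have cd: "card S = card (S \<inter> {..<k}) + of_bool (k \<in> S)" if "S \<subseteq> {..<Suc k}" for S
  proof -
    have "S = (S \<inter> {..<k}) \<union> (if k \<in> S then {k} else {})" using that by (auto simp: less_Suc_eq)
    then have "card S = card ((S \<inter> {..<k}) \<union> (if k \<in> S then {k} else {}))" by simp
    also have "\<dots> = card (S \<inter> {..<k}) + card (if k \<in> S then {k} else {})"
      by (rule card_Un_disjoint) auto
    finally show ?thesis by simp
  qed
  have "pmat lam b k r j (S' \<inter> {..<k}) (S \<inter> {..<k}) = 0
      \<or> lpoly (lam k) (b k) i r (k \<in> S') (k \<in> S) = 0" for r
    using Suc.IH[of "S' \<inter> {..<k}" "S \<inter> {..<k}" r j] Suc.prems cd[of S] cd[of S']
    by (auto simp: lpoly_def emat_def)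
  then show ?case by (auto intro!: sum.neutral)
qed

text \<open>Entries of \<open>T k i j\<close> are homogeneous of parity \<open>i \<noteq> j\<close>.
  Hence every \<open>par\<close> can be pushed to the innermost vector, where it only renames that
  vector.\<close>

lemma par_T: "par (T k i j x v) = (if i = j then T k i j x (par v) else - T k i j x (par v))"
proof
  fix S'
  have "psign (odd (card S')) * (poly (pmat lam b k i j S' S) x * v S) =
     (if i = j then 1 else -1) * (poly (pmat lam b k i j S' S) x * (psign (odd (card S)) * v S))"
    if "S' \<subseteq> {..<k}" "S \<subseteq> {..<k}" for S
    using pmat_parity[OF that, of i j] by (auto simp: psign_def)
  note * = this
  let ?e = "if i = j then 1 else - 1 :: complex"
  show "par (T k i j x v) S' = (if i = j then T k i j x (par v) else - T k i j x (par v)) S'"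
  proof (cases "S' \<subseteq> {..<k}")
    case True
    have "par (T k i j x v) S' = (\<Sum>S\<in>Pow {..<k}. psign (odd (card S')) * (poly (pmat lam b k i j S' S) x * v S))"
      using True by (simp add: par_def T_def appM_def sum_distrib_left)
    also have "\<dots> = (\<Sum>S\<in>Pow {..<k}. ?e * (poly (pmat lam b k i j S' S) x * (psign (odd (card S)) * v S)))"
      using * True by (intro sum.cong) auto
    also have "\<dots> = ?e * T k i j x (par v) S'"
      using True by (simp add: par_def T_def appM_def sum_distrib_left)
    finally show ?thesis by (simp add: fun_Compl_def)
  qed (simp add: par_def T_def appM_def fun_Compl_def)
qed

end

context chain begin

lemma Vsp_Suc_eqI_pointwise:
  assumes "u \<in> Vsp (Suc k)" "v \<in> Vsp (Suc k)"
   "\<And>S. low k u S = low k v S" "\<And>S. high k u S = high k v S"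
  shows "u = v"
  by (rule Vsp_Suc_eqI[OF assms(1,2) ext ext]) (rule assms)+

lemma scal_Vsp [simp]: "v \<in> Vsp k \<Longrightarrow> c \<star> v \<in> Vsp k"
  and add_Vsp [simp]: "u \<in> Vsp k \<Longrightarrow> v \<in> Vsp k \<Longrightarrow> u + v \<in> Vsp k"
  and diff_Vsp [simp]: "u \<in> Vsp k \<Longrightarrow> v \<in> Vsp k \<Longrightarrow> u - v \<in> Vsp k"
  by (auto simp: Vsp_def)

lemma T_0: "T 0 i j x v = (if i = j then low 0 v else 0)"
  by (auto simp: T_def appM_def low_def fun_eq_iff)

lemma low_zero [simp]: "low k 0 = 0"
  by (auto simp: low_def)

text \<open>Used with \<open>simp only\<close>, these expand a component of an RTT relation to a
  polynomial expression in values of operators on \<open>k\<close> factors and normalise nothing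
  else, so that a Groebner basis can compare it with the induction hypotheses.\<close>

lemmas block_linear_simps = block_simps par_T T_add T_scal T_diff T_uminus low_add high_add low_diff high_diff low_scal high_scal
  par_add par_diff par_uminus par_scal par_par if_True if_False True_implies_equals simp_thms
  plus_fun_apply scal_apply uminus_apply minus_apply

section \<open>RTT relations\<close>

text \<open>The relations on \<open>k + 1\<close> factors are explicit linear combinations of those on \<open>k\<close> factors.
  The cofactors \<open>c1, c2, c3\<close> come from elimination in the block form; a multiplier \<open>m = x - y\<close> is needed
  whenever a product has to be reordered. The method \<open>algebra\<close> is qualified because HOL-Algebra
  shadows its name.\<close>

lemma linear_combination:
  fixes l r :: complex
  assumes "m \<noteq> 0" "p1 = q1" "p2 = q2" "p3 = q3"
    and "m * (l - r) = c1 * (p1 - q1) + c2 * (p2 - q2) + c3 * (p3 - q3)"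
  shows "l = r"
  using assms by simp

text \<open>The blocks of \<open>B\<close> and \<open>D\<close> contain only \<open>B\<close> and
  \<open>D\<close>, so these three relations form a closed system for the induction.\<close>

lemma T12_T22_relations:
  shows DB: "(x - y) \<star> D k x (B k y u) = (x - y - 1) \<star> B k y (D k x u) + B k x (D k y u)"
    and DD: "D k x (D k y u) = D k y (D k x u)"
    and BB: "(x - y + 1) \<star> B k x (B k y u) = (y - x + 1) \<star> B k y (B k x u)"
proof (induction k arbitrary: x y u)
  case 0
  {
    case 1 show ?case by (rule ext) (simp add: T_0 low_def)
  next
    case 2 show ?case by (rule ext) (simp add: T_0 low_def)
  next
    case 3 show ?case by (rule ext) (simp add: T_0 low_def)
  }
next
  case (Suc k)
  note DB = Suc(1)[THEN fun_cong] and DD = Suc(2)[THEN fun_cong] and BB = Suc(3)[THEN fun_cong]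
  {
    case 1
    show ?case
    \<comment> \<open>At x = y the relation is trivial; elsewhere the multiplier x - y is
      non-zero.\<close>
    proof (cases "x = y")
      case False
      show ?thesis
      proof (rule Vsp_Suc_eqI_pointwise)
        fix S
        show "low k ((x - y) \<star> D (Suc k) x (B (Suc k) y u)) S
            = low k ((x - y - 1) \<star> B (Suc k) y (D (Suc k) x u) + B (Suc k) x (D (Suc k) y u)) S"
          by (rule linear_combination[where m = "1" and ?c1.0 = "de k x * al k y"
                and ?c2.0 = "- ga k * al k y" and ?c3.0 = "0",
              OF _ DB[of x y "low k u" S] BB[of x y "par (high k u)" S]
                refl[of "0::complex"]])
            (use one_neq_zero in simp, simp only: block_linear_simps, Groebner_Basis.algebra)
        show "high k ((x - y) \<star> D (Suc k) x (B (Suc k) y u)) S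
            = high k ((x - y - 1) \<star> B (Suc k) y (D (Suc k) x u) + B (Suc k) x (D (Suc k) y u)) S"
          by (rule linear_combination[where m = "(x - y)" and ?c1.0 = "(x - y) * (de k x - 1) * (al k y - 1) - ga k"
                and ?c2.0 = "(x - y - 1) * ga k" and ?c3.0 = "- (x - y) * (x - y - 1) * de k x",
              OF _ DB[of x y "high k u" S] DB[of y x "high k u" S]
                DD[of x y "par (low k u)" S]])
            (use False in simp, simp only: block_linear_simps, Groebner_Basis.algebra)
      qed (intro add_Vsp scal_Vsp diff_Vsp T_Vsp)+
    qed (simp add: fun_eq_iff)
  next
    case 2
    show ?case
    proof (cases "x = y")
      case False
      show ?thesis
      proof (rule Vsp_Suc_eqI_pointwise)
        fix S
        show "low k (D (Suc k) x (D (Suc k) y u)) S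
            = low k (D (Suc k) y (D (Suc k) x u)) S"
          by (rule linear_combination[where m = "(x - y)" and ?c1.0 = "(x - y) * de k x * de k y"
                and ?c2.0 = "ga k * de k x" and ?c3.0 = "ga k * de k y",
              OF _ DD[of x y "low k u" S] DB[of x y "par (high k u)" S]
                DB[of y x "par (high k u)" S]])
            (use False in simp, simp only: block_linear_simps, Groebner_Basis.algebra)
        show "high k (D (Suc k) x (D (Suc k) y u)) S
            = high k (D (Suc k) y (D (Suc k) x u)) S"
          by (rule linear_combination[where m = "1" and ?c1.0 = "(de k x - 1) * (de k y - 1)"
                and ?c2.0 = "0" and ?c3.0 = "0",
              OF _ DD[of x y "high k u" S] refl[of "0::complex"]
                refl[of "0::complex"]])
            (use one_neq_zero in simp, simp only: block_linear_simps, Groebner_Basis.algebra)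
      qed (intro add_Vsp scal_Vsp diff_Vsp T_Vsp)+
    qed (simp add: fun_eq_iff)
  next
    case 3
    show ?case
    proof (cases "x = y")
      case False
      show ?thesis
      proof (rule Vsp_Suc_eqI_pointwise)
        fix S
        show "low k ((x - y + 1) \<star> B (Suc k) x (B (Suc k) y u)) S
            = low k ((y - x + 1) \<star> B (Suc k) y (B (Suc k) x u)) S"
          by (rule linear_combination[where m = "1" and ?c1.0 = "al k x * al k y"
                and ?c2.0 = "0" and ?c3.0 = "0",
              OF _ BB[of x y "low k u" S] refl[of "0::complex"]
                refl[of "0::complex"]])
            (use one_neq_zero in simp, simp only: block_linear_simps, Groebner_Basis.algebra)
        show "high k ((x - y + 1) \<star> B (Suc k) x (B (Suc k) y u)) S
            = high k ((y - x + 1) \<star> B (Suc k) y (B (Suc k) x u)) S"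
          by (rule linear_combination[where m = "(x - y)" and ?c1.0 = "(x - y) * (al k x - 1) * (al k y - 1)"
                and ?c2.0 = "(x - y + 1) * al k y" and ?c3.0 = "(1 - (x - y)) * al k x",
              OF _ BB[of x y "high k u" S] DB[of x y "par (low k u)" S]
                DB[of y x "par (low k u)" S]])
            (use False in simp, simp only: block_linear_simps, Groebner_Basis.algebra)
      qed (intro add_Vsp scal_Vsp diff_Vsp T_Vsp)+
    qed (simp add: fun_eq_iff)
  }
qed

text \<open>These four relations close among themselves in the induction. No product has to be
  reordered, so the multiplier is 1 throughout. Two odd operators give the anticommutator in
  \<open>CB\<close>.\<close>

lemma T_relations:
  shows AB: "(x - y) \<star> A k x (B k y u) = (x - y - 1) \<star> B k y (A k x u) + B k x (A k y u)"
    and CB: "(x - y) \<star> (C k x (B k y u) + B k y (C k x u)) = D k y (A k x u) - D k x (A k y u)"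
    and AD: "(x - y) \<star> (A k x (D k y u) - D k y (A k x u)) = B k x (C k y u) - B k y (C k x u)"
    and CD: "(x - y) \<star> C k x (D k y u) = (x - y + 1) \<star> D k y (C k x u) - D k x (C k y u)"
proof (induction k arbitrary: x y u)
  case 0
  {
    case 1 show ?case by (rule ext) (simp add: T_0 low_def)
  next
    case 2 show ?case by (rule ext) (simp add: T_0 low_def)
  next
    case 3 show ?case by (rule ext) (simp add: T_0 low_def)
  next
    case 4 show ?case by (rule ext) (simp add: T_0 low_def)
  }
next
  case (Suc k)
  note AB = Suc(1)[THEN fun_cong] and CB = Suc(2)[THEN fun_cong] and AD = Suc(3)[THEN fun_cong] and CD = Suc(4)[THEN fun_cong]
  {
    case 1
    show ?case
    proof (rule Vsp_Suc_eqI_pointwise)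
      fix S
      show "low k ((x - y) \<star> A (Suc k) x (B (Suc k) y u)) S
          = low k ((x - y - 1) \<star> B (Suc k) y (A (Suc k) x u) + B (Suc k) x (A (Suc k) y u)) S"
        by (rule linear_combination[where m = "1" and ?c1.0 = "al k x * al k y"
              and ?c2.0 = "0" and ?c3.0 = "0",
            OF _ AB[of x y "low k u" S] refl[of "0::complex"]
              refl[of "0::complex"]])
          (use one_neq_zero in simp, simp only: block_linear_simps, Groebner_Basis.algebra)
      show "high k ((x - y) \<star> A (Suc k) x (B (Suc k) y u)) S
          = high k ((x - y - 1) \<star> B (Suc k) y (A (Suc k) x u) + B (Suc k) x (A (Suc k) y u)) S"
        by (rule linear_combination[where m = "1" and ?c1.0 = "(al k x - 1) * (al k y - 1)"
              and ?c2.0 = "- (al k x - 1)" and ?c3.0 = "al k y",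
            OF _ AB[of x y "high k u" S] AD[of x y "par (low k u)" S]
              CB[of x y "par (low k u)" S]])
          (use one_neq_zero in simp, simp only: block_linear_simps, Groebner_Basis.algebra)
    qed (intro add_Vsp scal_Vsp diff_Vsp T_Vsp)+
  next
    case 2
    show ?case
    proof (rule Vsp_Suc_eqI_pointwise)
      fix S
      show "low k ((x - y) \<star> (C (Suc k) x (B (Suc k) y u) + B (Suc k) y (C (Suc k) x u))) S
          = low k (D (Suc k) y (A (Suc k) x u) - D (Suc k) x (A (Suc k) y u)) S"
        by (rule linear_combination[where m = "1" and ?c1.0 = "de k x * al k y"
              and ?c2.0 = "- ga k" and ?c3.0 = "- ga k * (al k y - 1)",
            OF _ CB[of x y "low k u" S] AD[of x y "low k u" S]
              AB[of x y "par (high k u)" S]])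
          (use one_neq_zero in simp, simp only: block_linear_simps, Groebner_Basis.algebra)
      show "high k ((x - y) \<star> (C (Suc k) x (B (Suc k) y u) + B (Suc k) y (C (Suc k) x u))) S
          = high k (D (Suc k) y (A (Suc k) x u) - D (Suc k) x (A (Suc k) y u)) S"
        by (rule linear_combination[where m = "1" and ?c1.0 = "- (de k x - 1)"
              and ?c2.0 = "(de k x - 1) * (al k y - 1)" and ?c3.0 = "0",
            OF _ CD[of x y "par (low k u)" S] CB[of x y "high k u" S]
              refl[of "0::complex"]])
          (use one_neq_zero in simp, simp only: block_linear_simps, Groebner_Basis.algebra)
    qed (intro add_Vsp scal_Vsp diff_Vsp T_Vsp)+
  next
    case 3
    show ?case
    proof (rule Vsp_Suc_eqI_pointwise)
      fix S
      show "low k ((x - y) \<star> (A (Suc k) x (D (Suc k) y u) - D (Suc k) y (A (Suc k) x u))) S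
          = low k (B (Suc k) x (C (Suc k) y u) - B (Suc k) y (C (Suc k) x u)) S"
        by (rule linear_combination[where m = "1" and ?c1.0 = "al k x * de k y"
              and ?c2.0 = "al k x * ga k" and ?c3.0 = "0",
            OF _ AD[of x y "low k u" S] AB[of x y "par (high k u)" S]
              refl[of "0::complex"]])
          (use one_neq_zero in simp, simp only: block_linear_simps, Groebner_Basis.algebra)
      show "high k ((x - y) \<star> (A (Suc k) x (D (Suc k) y u) - D (Suc k) y (A (Suc k) x u))) S
          = high k (B (Suc k) x (C (Suc k) y u) - B (Suc k) y (C (Suc k) x u)) S"
        by (rule linear_combination[where m = "1" and ?c1.0 = "- de k y"
              and ?c2.0 = "(al k x - 1) * (de k y - 1)" and ?c3.0 = "ga k",
            OF _ CD[of x y "par (low k u)" S] AD[of x y "high k u" S]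
              CB[of x y "high k u" S]])
          (use one_neq_zero in simp, simp only: block_linear_simps, Groebner_Basis.algebra)
    qed (intro add_Vsp scal_Vsp diff_Vsp T_Vsp)+
  next
    case 4
    show ?case
    proof (rule Vsp_Suc_eqI_pointwise)
      fix S
      show "low k ((x - y) \<star> C (Suc k) x (D (Suc k) y u)) S
          = low k ((x - y + 1) \<star> D (Suc k) y (C (Suc k) x u) - D (Suc k) x (C (Suc k) y u)) S"
        by (rule linear_combination[where m = "1" and ?c1.0 = "de k x * de k y"
              and ?c2.0 = "de k x * ga k" and ?c3.0 = "ga k * (de k y - 1)",
            OF _ CD[of x y "low k u" S] CB[of x y "par (high k u)" S]
              AD[of x y "par (high k u)" S]])
          (use one_neq_zero in simp, simp only: block_linear_simps, Groebner_Basis.algebra)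
      show "high k ((x - y) \<star> C (Suc k) x (D (Suc k) y u)) S
          = high k ((x - y + 1) \<star> D (Suc k) y (C (Suc k) x u) - D (Suc k) x (C (Suc k) y u)) S"
        by (rule linear_combination[where m = "1" and ?c1.0 = "(de k x - 1) * (de k y - 1)"
              and ?c2.0 = "0" and ?c3.0 = "0",
            OF _ CD[of x y "high k u" S] refl[of "0::complex"]
              refl[of "0::complex"]])
          (use one_neq_zero in simp, simp only: block_linear_simps, Groebner_Basis.algebra)
    qed (intro add_Vsp scal_Vsp diff_Vsp T_Vsp)+
  }
qed

end

section \<open>Polynomial families of vectors\<close>

definition lagrange_basis :: "complex set \<Rightarrow> complex \<Rightarrow> complex poly" where
  "lagrange_basis X a = smult (1 / (\<Prod>c\<in>X - {a}. a - c)) (\<Prod>c\<in>X - {a}. [:- c, 1:])"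

lemma poly_lagrange_basis:
  assumes "finite X" "a \<in> X" "x \<in> X"
  shows "poly (lagrange_basis X a) x = (if x = a then 1 else 0)"
  using assms by (auto simp: lagrange_basis_def poly_prod)

lemma degree_lagrange_basis:
  assumes "finite X" "a \<in> X"
  shows "degree (lagrange_basis X a) < card X"
proof -
  have "degree (\<Prod>c\<in>X - {a}. [:- c, 1:]) = card (X - {a})"
    by (subst degree_prod_eq_sum_degree) auto
  moreover have "card (X - {a}) < card X" using assms by (rule card_Diff1_less)
  ultimately show ?thesis
    unfolding lagrange_basis_def by (metis degree_smult_le le_less_trans)
qed

lemma lagrange_interpolation:
  assumes "finite X" "degree p < card X"
  shows "p = (\<Sum>a\<in>X. smult (poly p a) (lagrange_basis X a))"
proof (rule poly_eqI_degree)
  show "poly p x = poly (\<Sum>a\<in>X. smult (poly p a) (lagrange_basis X a)) x" if "x \<in> X" for x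
  proof -
    have "poly (\<Sum>a\<in>X. smult (poly p a) (lagrange_basis X a)) x = (\<Sum>a\<in>X. if x = a then poly p a else 0)"
      unfolding poly_sum using assms that by (intro sum.cong) (auto simp: poly_lagrange_basis)
    then show ?thesis using assms that by simp
  qed
  show "degree p < card X" by fact
  show "degree (\<Sum>a\<in>X. smult (poly p a) (lagrange_basis X a)) < card X"
    using degree_lagrange_basis[OF assms(1)] assms(2)
    by (intro degree_sum_less) (auto intro: le_less_trans[OF degree_smult_le])
qed

text \<open>The degree bound is uniform in \<open>S\<close>, so that one set of interpolation nodes
  serves all components.\<close>

definition polyfam :: "(complex \<Rightarrow> svec) \<Rightarrow> bool" where
  "polyfam f \<longleftrightarrow> (\<exists>P n. \<forall>S. degree (P S) \<le> n \<and> (\<forall>x. f x S = poly (P S) x))"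

lemma polyfamI:
  assumes "\<And>S. degree (P S) \<le> n" "\<And>x S. f x S = poly (P S) x"
  shows "polyfam f"
  using assms unfolding polyfam_def by blast

lemma polyfam_const [intro]: "polyfam (\<lambda>x. v)"
  by (rule polyfamI[of "\<lambda>S. [:v S:]" 0]) auto

lemma polyfam_scal [intro]: "polyfam f \<Longrightarrow> polyfam (\<lambda>x. poly e x \<star> f x)"
proof -
  assume "polyfam f"
  then obtain P n where P: "\<And>S. degree (P S) \<le> n" "\<And>x S. f x S = poly (P S) x"
    unfolding polyfam_def by blast
  show ?thesis
    by (rule polyfamI[of "\<lambda>S. e * P S" "degree e + n"])
       (use P in \<open>auto intro: order_trans[OF degree_mult_le]\<close>)
qed

lemma polyfam_add [intro]: "polyfam f \<Longrightarrow> polyfam g \<Longrightarrow> polyfam (\<lambda>x. f x + g x)"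
proof -
  assume "polyfam f" "polyfam g"
  then obtain P n Q m where P: "\<And>S. degree (P S) \<le> n" "\<And>x S. f x S = poly (P S) x"
    and Q: "\<And>S. degree (Q S) \<le> m" "\<And>x S. g x S = poly (Q S) x"
    unfolding polyfam_def by blast
  have "degree (P S + Q S) \<le> max n m" for S
    using degree_add_le_max[of "P S" "Q S"] P(1)[of S] Q(1)[of S] by linarith
  then show ?thesis
    by (rule polyfamI[of "\<lambda>S. P S + Q S"]) (simp add: P Q)
qed

lemma polyfam_scal_const [intro]: "polyfam f \<Longrightarrow> polyfam (\<lambda>x. c \<star> f x)"
  using polyfam_scal[of f "[:c:]"] by simp

lemma polyfam_diff [intro]: "polyfam f \<Longrightarrow> polyfam g \<Longrightarrow> polyfam (\<lambda>x. f x - g x)"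
  using polyfam_add[of f "\<lambda>x. (-1) \<star> g x"] polyfam_scal_const[of g "-1"]
  by (simp add: polyfam_def)

text \<open>Exchange relations give their information only after division by x - y; this restores
  the values at the excluded points.\<close>

lemma polyfam_eq:
  assumes "polyfam f" "polyfam g" "finite E" "\<And>x. x \<notin> E \<Longrightarrow> f x = g x"
  shows "f = g"
proof (intro ext)
  fix x S
  obtain P Q where P: "\<And>x. f x S = poly (P S) x" and Q: "\<And>x. g x S = poly (Q S) x"
    using assms(1,2) unfolding polyfam_def by metis
  have "- E \<subseteq> {x. poly (P S - Q S) x = 0}" using assms(4) by (auto simp flip: P Q)
  then have "\<not> finite {x. poly (P S - Q S) x = 0}"
    using assms(3) by (metis finite_compl finite_subset infinite_UNIV_char_0)
  then have "P S - Q S = 0" using poly_roots_finite by blast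
  then show "f x S = g x S" using P Q by simp
qed

text \<open>Lagrange interpolation at n + 1 nodes outside \<open>E\<close> writes each coefficient
  vector as a linear combination of values that lie in \<open>U\<close>.\<close>

lemma polyfam_coeff_in_subspace:
  assumes "polyfam f" "sv.subspace U" "finite E" "\<And>x. x \<notin> E \<Longrightarrow> f x \<in> U"
    and "\<And>x S. f x S = poly (P S) x"
  shows "(\<lambda>S. coeff (P S) m) \<in> U"
proof -
  obtain Q n where "\<And>S. degree (Q S) \<le> n" and Q: "\<And>x S. f x S = poly (Q S) x"
    using assms(1) unfolding polyfam_def by metis
  moreover have "Q = P"
    using Q assms(5) by (intro ext) (simp add: poly_eq_poly_eq_iff[symmetric] fun_eq_iff)
  ultimately have dP: "degree (P S) \<le> n" for S by simp
  obtain X where X: "finite X" "card X = Suc n" "X \<subseteq> - E"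
    using infinite_arbitrarily_large[of "- E" "Suc n"] assms(3)
    by (metis finite_compl infinite_UNIV_char_0)
  have "coeff (P S) m = (\<Sum>a\<in>X. coeff (lagrange_basis X a) m * f a S)" for S
    by (subst lagrange_interpolation[OF X(1), of "P S"])
       (use dP[of S] X assms(5) in \<open>auto simp: coeff_sum mult.commute le_imp_less_Suc\<close>)
  then have "(\<lambda>S. coeff (P S) m) = (\<Sum>a\<in>X. coeff (lagrange_basis X a) m \<star> f a)"
    by (simp add: fun_eq_iff)
  also have "\<dots> \<in> U"
    using X assms(4) by (intro sv.subspace_sum[OF assms(2)] sv.subspace_scale[OF assms(2)]) auto
  finally show ?thesis .
qed

lemma polyfam_in_subspace:
  assumes "polyfam f" "sv.subspace U" "finite E" "\<And>x. x \<notin> E \<Longrightarrow> f x \<in> U"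
  shows "f x \<in> U"
proof -
  obtain P n where P: "\<And>S. degree (P S) \<le> n" "\<And>x S. f x S = poly (P S) x"
    using assms(1) unfolding polyfam_def by metis
  have *: "(\<lambda>S. coeff (P S) m) \<in> U" for m
    by (rule polyfam_coeff_in_subspace[OF assms P(2)])
  have "f x = (\<Sum>m\<le>n. x ^ m \<star> (\<lambda>S. coeff (P S) m))"
  proof
    fix S
    have "f x S = (\<Sum>m\<le>degree (P S). coeff (P S) m * x ^ m)" by (simp add: P poly_altdef)
    also have "\<dots> = (\<Sum>m\<le>n. coeff (P S) m * x ^ m)"
      by (rule sum.mono_neutral_left) (use P in \<open>auto simp: coeff_eq_0 not_le\<close>)
    finally show "f x S = (\<Sum>m\<le>n. x ^ m \<star> (\<lambda>S. coeff (P S) m)) S" by (simp add: mult.commute)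
  qed
  also have "\<dots> \<in> U"
    using * by (intro sv.subspace_sum[OF assms(2)] sv.subspace_scale[OF assms(2)]) auto
  finally show ?thesis .
qed

lemma coeff_mult_linear: "coeff (p * [:a, c:]) n = a * coeff p n + (if n = 0 then 0 else c * coeff p (n - 1))"
  for p :: "complex poly"
  by (cases n) (auto simp: coeff_pCons algebra_simps)

text \<open>The expansion T_ij(x) = delta_ij + O(1/x), after multiplication by a monic polynomial of
  degree \<open>k\<close>.\<close>

lemma coeff_pmat:
  "S' \<subseteq> {..<k} \<Longrightarrow> S \<subseteq> {..<k} \<Longrightarrow> k \<le> n \<Longrightarrow>
    coeff (pmat lam b k i j S' S) n = (if n = k \<and> i = j \<and> S' = S then 1 else 0)"
proof (induction k arbitrary: i j S S' n)
  case 0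
  then show ?case by auto
next
  case (Suc k)
  have IH: "coeff (pmat lam b k r j (S' \<inter> {..<k}) (S \<inter> {..<k})) n' =
      (if n' = k \<and> r = j \<and> S' \<inter> {..<k} = S \<inter> {..<k} then 1 else 0)" if "n' \<ge> k" for r n'
    by (rule Suc.IH) (use that in auto)
  have eq: "S' = S \<longleftrightarrow> S' \<inter> {..<k} = S \<inter> {..<k} \<and> (k \<in> S') = (k \<in> S)"
    using Suc.prems by (auto simp: lessThan_Suc)
  have n: "n \<noteq> 0" "n \<ge> k" "n - 1 \<ge> k" "n \<noteq> k" "n - 1 = k \<longleftrightarrow> n = Suc k" using Suc.prems by auto
  have "coeff (smult (tsign k i r S) (pmat lam b k r j (S' \<inter> {..<k}) (S \<inter> {..<k})
      * lpoly (lam k) (b k) i r (k \<in> S') (k \<in> S))) n =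
    (if r = i then (if n = Suc k \<and> i = j \<and> S' = S then 1 else 0) else 0)" for r
    unfolding coeff_smult lpoly_def coeff_mult_linear IH[OF n(2)] IH[OF n(3)] eq
    using n by (simp add: tsign_def psign_def)
  then show ?case by (simp add: coeff_sum del: coeff_smult)
qed

lemma degree_pmat: "S' \<subseteq> {..<k} \<Longrightarrow> S \<subseteq> {..<k} \<Longrightarrow> degree (pmat lam b k i j S' S) \<le> k"
  by (rule degree_le) (simp add: coeff_pmat)

context chain begin

definition Tp :: "nat \<Rightarrow> bool \<Rightarrow> bool \<Rightarrow> svec \<Rightarrow> nat set \<Rightarrow> complex poly" where
  "Tp k i j v S' = (if S' \<subseteq> {..<k} then \<Sum>S\<in>Pow {..<k}. smult (v S) (pmat lam b k i j S' S) else 0)"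

lemma poly_Tp: "poly (Tp k i j v S) x = T k i j x v S"
  by (simp add: Tp_def T_def appM_def poly_sum mult.commute)

lemma degree_Tp: "degree (Tp k i j v S) \<le> k"
  by (auto simp: Tp_def intro!: degree_sum_le order_trans[OF degree_smult_le] degree_pmat)

lemma coeff_Tp_top:
  "v \<in> Vsp k \<Longrightarrow> coeff (Tp k i j v S) k = (if i = j then v S else 0)"
  by (auto simp: Tp_def coeff_sum coeff_pmat Vsp_def if_distrib cong: if_cong)

lemma polyfam_T [intro]: "polyfam f \<Longrightarrow> polyfam (\<lambda>x. T k i j x (f x))"
proof -
  assume "polyfam f"
  then obtain P n where P: "\<And>S. degree (P S) \<le> n" "\<And>x S. f x S = poly (P S) x"
    unfolding polyfam_def by blast
  show ?thesis
    by (rule polyfamI[of "\<lambda>S'. if S' \<subseteq> {..<k} then \<Sum>S\<in>Pow {..<k}. P S * pmat lam b k i j S' S else 0" "n + k"])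
      (use P in \<open>auto intro!: degree_sum_le order_trans[OF degree_mult_le] add_mono degree_pmat
        simp: T_def appM_def poly_sum mult.commute\<close>)
qed

lemma polyfam_T_const [intro]: "polyfam f \<Longrightarrow> polyfam (\<lambda>x. T k i j y (f x))"
proof -
  assume "polyfam f"
  then obtain P n where P: "\<And>S. degree (P S) \<le> n" "\<And>x S. f x S = poly (P S) x"
    unfolding polyfam_def by blast
  show ?thesis
    by (rule polyfamI[of "\<lambda>S'. if S' \<subseteq> {..<k} then \<Sum>S\<in>Pow {..<k}. smult (poly (pmat lam b k i j S' S) y) (P S) else 0" n])
      (use P in \<open>auto intro!: degree_sum_le order_trans[OF degree_smult_le]
        simp: T_def appM_def poly_sum mult.commute\<close>)
qed

lemma zero_Vsp [simp]: "0 \<in> Vsp k"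
  by (simp add: Vsp_def)

lemma high_zero [simp]: "high k 0 = 0" and par_zero [simp]: "par 0 = 0"
  by (simp_all add: high_def par_def fun_eq_iff)

lemma vac_Vsp [simp]: "vac \<in> Vsp k"
  by (auto simp: vac_def Vsp_def)

lemma low_vac [simp]: "low k vac = vac" and high_vac [simp]: "high k vac = 0" and par_vac [simp]: "par vac = vac"
  by (auto simp: low_def high_def par_def vac_def psign_def)

lemma T_vac:
  shows A_vac: "A k x vac = (\<Prod>s<k. al s x) \<star> vac"
    and C_vac: "C k x vac = 0"
    and D_vac: "D k x vac = (\<Prod>s<k. de s x) \<star> vac"
proof (induction k)
  case 0
  {
    case 1 show ?case by (rule ext) (simp add: T_0)
    case 2 show ?case by (rule ext) (simp add: T_0)
    case 3 show ?case by (rule ext) (simp add: T_0)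
  }
next
  case (Suc k)
  have IH: "A k x vac = (\<Prod>s<k. al s x) \<star> vac" "C k x vac = 0" "D k x vac = (\<Prod>s<k. de s x) \<star> vac"
    by (rule Suc)+
  {
    case 1
    show "A (Suc k) x vac = (\<Prod>s<Suc k. al s x) \<star> vac"
      by (rule Vsp_Suc_eqI[of _ k]) (simp_all add: block_simps IH mult.commute)
  next
    case 2
    show "C (Suc k) x vac = 0"
      by (rule Vsp_Suc_eqI[of _ k]) (simp_all add: block_simps IH)
  next
    case 3
    show "D (Suc k) x vac = (\<Prod>s<Suc k. de s x) \<star> vac"
      by (rule Vsp_Suc_eqI[of _ k]) (simp_all add: block_simps IH mult.commute)
  }
qed

end

section \<open>Strings of creation operators\<close>

lemma subspace_unscale:
  assumes "sv.subspace U" "c \<noteq> 0" "c \<star> v \<in> U"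
  shows "v \<in> U"
proof -
  have "(1 / c) \<star> (c \<star> v) \<in> U" by (rule sv.subspace_scale[OF assms(1,3)])
  then show ?thesis using assms(2) by simp
qed

text \<open>\<open>str (t # ts) / den (t # ts)\<close> is symmetric in its arguments; the lemmas \<open>str_move\<close> and \<open>str_sort\<close> state
  this without division, since \<open>den\<close> may vanish for some of the orderings.\<close>

primrec den :: "complex list \<Rightarrow> complex" where
  "den [] = 1"
| "den (x # xs) = (\<Prod>y\<leftarrow>xs. y - x + 1) * den xs"

lemma den_nonzero: "sorted_wrt (\<lambda>x y. y - x + 1 \<noteq> 0) xs \<Longrightarrow> den xs \<noteq> 0"
  by (induction xs) auto

context chain begin

definition str :: "nat \<Rightarrow> complex list \<Rightarrow> svec" where
  "str k ts = foldr (B k) ts vac"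

text \<open>The points of the strings are arbitrary here. The lemmas below show that this span is
  the Yangian submodule generated by the vacuum.\<close>

definition W :: "nat \<Rightarrow> svec set" where
  "W k = sv.span (range (str k))"

lemma str_Nil [simp]: "str k [] = vac"
  and str_Cons [simp]: "str k (t # ts) = B k t (str k ts)"
  by (simp_all add: str_def)

lemma str_Vsp [simp]: "str k ts \<in> Vsp k"
  by (cases ts) auto

lemma W_subspace: "sv.subspace (W k)"
  by (simp add: W_def)

lemma str_W: "str k ts \<in> W k"
  by (auto simp: W_def intro: sv.span_base)

lemma W_Vsp: "W k \<subseteq> Vsp k"
  unfolding W_def by (rule sv.span_minimal[OF _ Vsp_subspace]) auto

lemma T_preimage_subspace: "sv.subspace U \<Longrightarrow> sv.subspace {v. T k i j x v \<in> U}"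
  by (auto simp: sv.subspace_def)

lemma T_in_W:
  assumes "\<And>ts. T k i j x (str k ts) \<in> W k" "w \<in> W k"
  shows "T k i j x w \<in> W k"
proof -
  have "W k \<subseteq> {v. T k i j x v \<in> W k}"
    by (subst W_def, rule sv.span_minimal[OF _ T_preimage_subspace[OF W_subspace]]) (auto simp: assms(1))
  then show ?thesis using assms(2) by auto
qed

lemma B_in_W: "w \<in> W k \<Longrightarrow> B k x w \<in> W k"
  by (rule T_in_W) (metis str_Cons str_W)

text \<open>\<open>AB\<close> and \<open>DB\<close> move the operator one place to the right, up to
  the factor x - y. Off x = y it can be divided out, and at x = y the value lies in
  \<open>W k\<close> because the family is polynomial in x.\<close>

lemma AD_str_in_W: "A k x (str k ts) \<in> W k" "D k x (str k ts) \<in> W k"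
proof (induction ts arbitrary: x)
  case Nil
  {
    case 1
    show "A k x (str k []) \<in> W k" using sv.subspace_scale[OF W_subspace str_W[of k "[]"]] by (simp add: A_vac)
  next
    case 2
    show "D k x (str k []) \<in> W k" using sv.subspace_scale[OF W_subspace str_W[of k "[]"]] by (simp add: D_vac)
  }
next
  case (Cons y ts)
  have *: "T k i i z (str k (y # ts)) \<in> W k"
    if "\<And>x. (x - y) \<star> T k i i x (B k y (str k ts)) = (x - y - 1) \<star> B k y (T k i i x (str k ts)) + B k x (T k i i y (str k ts))"
      "\<And>x. T k i i x (str k ts) \<in> W k" for i z
  proof (rule polyfam_in_subspace[where E = "{y}" and f = "\<lambda>z. T k i i z (str k (y # ts))", OF _ W_subspace finite.insertI[OF finite.emptyI]])
    show "polyfam (\<lambda>z. T k i i z (str k (y # ts)))" by (intro polyfam_T polyfam_const)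
    fix x assume "x \<notin> {y}"
    then have "x - y \<noteq> 0" by simp
    moreover have "(x - y) \<star> T k i i x (str k (y # ts)) \<in> W k"
      unfolding str_Cons that(1)
      by (intro sv.subspace_add[OF W_subspace] sv.subspace_scale[OF W_subspace] B_in_W that(2))
    ultimately show "T k i i x (str k (y # ts)) \<in> W k"
      by (rule subspace_unscale[OF W_subspace])
  qed
  {
    case 1
    show ?case by (rule *[OF AB Cons(1)])
  next
    case 2
    show ?case by (rule *[OF DB Cons(2)])
  }
qed

lemmas A_in_W = T_in_W[OF AD_str_in_W(1)] and D_in_W = T_in_W[OF AD_str_in_W(2)]

lemma C_str_in_W: "C k x (str k ts) \<in> W k"
proof (induction ts arbitrary: x)
  case Nil
  show "C k x (str k []) \<in> W k" using sv.subspace_0[OF W_subspace] by (simp add: C_vac)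
next
  case (Cons y ts)
  let ?u = "str k ts"
  show "C k x (str k (y # ts)) \<in> W k"
  proof (rule polyfam_in_subspace[where E = "{y}" and f = "\<lambda>z. C k z (str k (y # ts))", OF _ W_subspace])
    fix x assume "x \<notin> {y}"
    moreover have "(x - y) \<star> C k x (B k y ?u) = D k y (A k x ?u) - D k x (A k y ?u) - (x - y) \<star> B k y (C k x ?u)"
      using CB[of x y k ?u] by (simp add: sv.scale_right_distrib eq_diff_eq)
    then have "(x - y) \<star> C k x (B k y ?u) \<in> W k"
      using Cons.IH by (auto intro!: sv.subspace_diff[OF W_subspace] sv.subspace_scale[OF W_subspace] A_in_W B_in_W D_in_W str_W)
    ultimately show "C k x (str k (y # ts)) \<in> W k"
      using subspace_unscale[OF W_subspace, of "x - y"] by auto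
  qed auto
qed

lemma W_invariant: "w \<in> W k \<Longrightarrow> T k i j x w \<in> W k"
  by (cases i; cases j) (auto intro: A_in_W B_in_W D_in_W T_in_W[OF C_str_in_W])

text \<open>Strings are homogeneous. This makes \<open>W k\<close> a graded subspace, the kind of
  subspace that \<open>irreducible_mod\<close> tests.\<close>

lemma par_str: "par (str k ts) = str k ts \<or> par (str k ts) = - str k ts"
proof (induction ts)
  case Nil
  show ?case by simp
next
  case (Cons t ts)
  have "par (str k (t # ts)) = - B k t (par (str k ts))" by (simp add: par_T)
  then show ?case using Cons by (metis T_uminus minus_minus str_Cons)
qed

lemma par_in_W: "w \<in> W k \<Longrightarrow> par w \<in> W k"
proof -
  assume w: "w \<in> W k"
  have "sv.subspace {v. par v \<in> W k}"
    using W_subspace[of k] by (auto simp: sv.subspace_def)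
  moreover have "par (str k ts) \<in> W k" for ts
    using par_str[of k ts] str_W[of k ts] sv.subspace_neg[OF W_subspace] by fastforce
  ultimately have "W k \<subseteq> {v. par v \<in> W k}"
    by (subst W_def) (rule sv.span_minimal, auto)
  then show ?thesis using w by auto
qed

lemma evenpart_in_W: "w \<in> W k \<Longrightarrow> evenpart w \<in> W k"
proof -
  assume w: "w \<in> W k"
  have "evenpart w = (1 / 2) \<star> (w + par w)"
    by (auto simp: evenpart_def par_def psign_def)
  then show ?thesis
    using w by (simp add: sv.subspace_scale[OF W_subspace] sv.subspace_add[OF W_subspace] par_in_W)
qed

section \<open>Reordering the arguments of a string\<close>

lemma str_move: "den (xs @ x # ys) \<star> str k (x # xs @ ys) = den (x # xs @ ys) \<star> str k (xs @ x # ys)"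
proof (induction xs)
  case Nil
  show ?case by simp
next
  case (Cons y xs)
  let ?P = "\<Prod>z\<leftarrow>xs @ ys. z - y + 1"
  let ?u = "str k (xs @ ys)"
  have "den ((y # xs) @ x # ys) \<star> str k (x # (y # xs) @ ys)
      = (?P * den (xs @ x # ys)) \<star> ((x - y + 1) \<star> B k x (B k y ?u))"
    by simp
  also have "\<dots> = ((y - x + 1) * ?P) \<star> B k y (den (xs @ x # ys) \<star> str k (x # xs @ ys))"
    by (simp add: BB[of x y])
  also have "\<dots> = den (x # (y # xs) @ ys) \<star> str k ((y # xs) @ x # ys)"
    unfolding Cons.IH by simp
  finally show ?case .
qed

lemma insort_key_split: "\<exists>xs ys. l = xs @ ys \<and> insort_key f x l = xs @ x # ys"
proof (induction l)
  case Nil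
  show ?case by simp
next
  case (Cons y l)
  then obtain xs ys where "l = xs @ ys" "insort_key f x l = xs @ x # ys" by blast
  then show ?case
    by (cases "f x \<le> f y") (auto intro: exI[of _ "[]"] exI[of _ "y # xs"])
qed

lemma str_sort:
  fixes f :: "'i \<Rightarrow> nat" and t :: "'i \<Rightarrow> complex"
  assumes "distinct is" "inj_on f (set is)"
    "\<And>i j. i \<in> set is \<Longrightarrow> j \<in> set is \<Longrightarrow> f i < f j \<Longrightarrow> t j - t i + 1 \<noteq> 0"
  shows "den (map t (sort_key f is)) \<noteq> 0"
    "den (map t (sort_key f is)) \<star> str k (map t is) = den (map t is) \<star> str k (map t (sort_key f is))"
proof -
  have nz: "den (map t (sort_key f js)) \<noteq> 0" if "distinct js" "set js \<subseteq> set is" for js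
  proof (rule den_nonzero)
    have "sorted_wrt (<) (map f (sort_key f js))"
      using that assms(2) by (auto simp: strict_sorted_iff distinct_map inj_on_subset)
    then show "sorted_wrt (\<lambda>x y. y - x + 1 \<noteq> 0) (map t (sort_key f js))"
      unfolding sorted_wrt_map
      by (rule sorted_wrt_mono_rel[rotated]) (use that assms(3) in auto)
  qed
  from nz assms(1) show "den (map t (sort_key f is)) \<noteq> 0" by simp
  have "den (map t (sort_key f js)) \<star> str k (map t js) = den (map t js) \<star> str k (map t (sort_key f js))"
    if "distinct js" "set js \<subseteq> set is" for js
    using that
  \<comment> \<open>The induction follows insertion sort: \<open>str_move\<close> carries the new
    head into its slot. The factor \<open>den ?s\<close> that is cancelled belongs to a sorted list,
    so it is non-zero.\<close>
  proof (induction js)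
    case Nil
    show ?case by simp
  next
    case (Cons i js)
    obtain xs ys where l: "sort_key f js = xs @ ys" "sort_key f (i # js) = xs @ i # ys"
      using insort_key_split[of "sort_key f js" f i] by auto
    let ?s = "map t (sort_key f js)" and ?s' = "map t (sort_key f (i # js))"
    have IH: "den ?s \<star> str k (map t js) = den (map t js) \<star> str k ?s"
      by (rule Cons.IH) (use Cons.prems in auto)
    have "(\<Prod>y\<leftarrow>?s. y - t i + 1) = (\<Prod>y\<leftarrow>map t js. y - t i + 1)"
      unfolding map_map prod_mset_prod_list[symmetric] by (simp only: mset_map mset_sort)
    then have d: "den (t i # ?s) * den (map t js) = den ?s * den (map t (i # js))" by simp
    have mv: "den ?s' \<star> str k (t i # ?s) = den (t i # ?s) \<star> str k ?s'"
      unfolding l using str_move[of "map t xs" "t i" "map t ys" k] by simp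
    have "den ?s \<star> den ?s' \<star> str k (map t (i # js)) = den ?s' \<star> B k (t i) (den ?s \<star> str k (map t js))"
      by (simp add: mult.commute)
    also have "\<dots> = den (map t js) \<star> den ?s' \<star> str k (t i # ?s)"
      unfolding IH by (simp add: mult.commute)
    also have "\<dots> = den (map t js) \<star> den (t i # ?s) \<star> str k ?s'"
      using mv by simp
    also have "\<dots> = den ?s \<star> den (map t (i # js)) \<star> str k ?s'"
      using d by (simp only: sv.scale_scale mult.commute)
    finally have "den ?s \<star> (den ?s' \<star> str k (map t (i # js))) = den ?s \<star> (den (map t (i # js)) \<star> str k ?s')" .
    moreover have "den ?s \<noteq> 0" using nz[of js] Cons.prems by simp
    ultimately show "den ?s' \<star> str k (map t (i # js)) = den (map t (i # js)) \<star> str k ?s'"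
      using sv.scale_left_imp_eq by blast
  qed
  from this[of "is"] assms(1)
  show "den (map t (sort_key f is)) \<star> str k (map t is) = den (map t is) \<star> str k (map t (sort_key f is))"
    by simp
qed

end

section \<open>Coefficients of the transfer matrix and Bethe vectors\<close>

text \<open>With \<open>u = 1 / x\<close>, the series of the \<open>Tcoef\<close> in \<open>u\<close> times \<open>ufps\<close> is the reversed polynomial \<open>pmat\<close>.\<close>

definition ufps :: "(nat \<Rightarrow> complex) \<Rightarrow> nat \<Rightarrow> complex fps" where
  "ufps b k = (\<Prod>s<k. 1 - fps_const (b s) * fps_X)"

lemma ufps_nth_0 [simp]: "fps_nth (ufps b k) 0 = 1"
  by (induction k) (auto simp: ufps_def)

lemma ufps_Suc: "ufps b (Suc k) = ufps b k * (1 - fps_const (b k) * fps_X)"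
  by (simp add: ufps_def)

lemma fcoef_fps:
  "Abs_fps (\<lambda>n. fcoef lm z n i j out inp) * (1 - fps_const z * fps_X) =
   fps_const (coeff (lpoly lm z i j out inp) 1) + fps_const (coeff (lpoly lm z i j out inp) 0) * fps_X"
  (is "?F * _ = ?R")
proof (rule fps_ext)
  fix n
  have "?F * (1 - fps_const z * fps_X) = ?F - fps_const z * (?F * fps_X)"
    by (simp only: right_diff_distrib mult_1_right mult.left_commute)
  then have nth: "fps_nth (?F * (1 - fps_const z * fps_X)) n = fps_nth ?F n - z * fps_nth (?F * fps_X) n"
    by (simp only: fps_sub_nth fps_mult_left_const_nth)
  consider "n = 0" | "n = 1" | m where "n = Suc (Suc m)"
    by (metis One_nat_def not0_implies_Suc)
  then show "fps_nth (?F * (1 - fps_const z * fps_X)) n = fps_nth ?R n"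
    unfolding nth by cases (auto simp: lpoly_def)
qed

lemma Tcoef_fps:
  "S' \<subseteq> {..<k} \<Longrightarrow> S \<subseteq> {..<k} \<Longrightarrow>
    Abs_fps (\<lambda>n. Tcoef lam b k n i j S' S) * ufps b k =
    Abs_fps (\<lambda>n. if n \<le> k then coeff (pmat lam b k i j S' S) (k - n) else 0)"
proof (induction k arbitrary: i j S S')
  case 0
  then show ?case by (auto simp: fps_eq_iff ufps_def)
next
  case (Suc k)
  let ?s = "S \<inter> {..<k}" and ?s' = "S' \<inter> {..<k}"
  let ?l = "\<lambda>r. lpoly (lam k) (b k) i r (k \<in> S') (k \<in> S)"
  let ?R = "\<lambda>r. Abs_fps (\<lambda>n. if n \<le> k then coeff (pmat lam b k r j ?s' ?s) (k - n) else 0)"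
  let ?F = "\<lambda>r. Abs_fps (\<lambda>n. fcoef (lam k) (b k) n i r (k \<in> S') (k \<in> S))"
  let ?T = "\<lambda>r. Abs_fps (\<lambda>n. Tcoef lam b k n r j ?s' ?s)"
  let ?c = "\<lambda>r. fps_const (tsign k i r S)"
  have IH: "?T r * ufps b k = ?R r" for r
    by (rule Suc.IH) auto
  have "Abs_fps (\<lambda>n. Tcoef lam b (Suc k) n i j S' S) = (\<Sum>r\<in>UNIV. ?c r * (?T r * ?F r))"
    by (intro fps_ext, simp only: fps_sum_nth fps_mult_left_const_nth)
      (simp add: fps_mult_nth UNIV_bool sum_distrib_left mult.assoc atLeast0AtMost)
  then have "Abs_fps (\<lambda>n. Tcoef lam b (Suc k) n i j S' S) * ufps b (Suc k) =
      (\<Sum>r\<in>UNIV. ?c r * ((?T r * ufps b k) * (?F r * (1 - fps_const (b k) * fps_X))))"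
    by (simp only: ufps_Suc sum_distrib_left mult_ac)
  also have "\<dots> = (\<Sum>r\<in>UNIV. ?c r * (?R r * (fps_const (coeff (?l r) 1) + fps_const (coeff (?l r) 0) * fps_X)))"
    unfolding IH fcoef_fps ..
  also have "\<dots> = Abs_fps (\<lambda>n. if n \<le> Suc k then coeff (pmat lam b (Suc k) i j S' S) (Suc k - n) else 0)"
  proof (rule fps_ext)
    fix n
    have *: "fps_nth (?R r * (fps_const (coeff (?l r) 1) + fps_const (coeff (?l r) 0) * fps_X)) n =
        (if n \<le> Suc k then coeff (pmat lam b k r j ?s' ?s * ?l r) (Suc k - n) else 0)" for r
    proof -
      have l: "?l r = [: coeff (?l r) 0, coeff (?l r) 1 :]"
        by (simp add: lpoly_def)
      have dg: "coeff (pmat lam b k r j ?s' ?s) (Suc k) = 0"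
        by (subst coeff_pmat) auto
      have "?R r * (fps_const (coeff (?l r) 1) + fps_const (coeff (?l r) 0) * fps_X) =
         fps_const (coeff (?l r) 1) * ?R r + fps_const (coeff (?l r) 0) * (?R r * fps_X)"
        by (simp add: algebra_simps)
      then show ?thesis
        by (subst (3) l, unfold coeff_mult_linear, cases n) (auto simp: dg Suc_diff_le mult.commute)
    qed
    show "fps_nth (\<Sum>r\<in>UNIV. ?c r * (?R r * (fps_const (coeff (?l r) 1) + fps_const (coeff (?l r) 0) * fps_X))) n =
       fps_nth (Abs_fps (\<lambda>n. if n \<le> Suc k then coeff (pmat lam b (Suc k) i j S' S) (Suc k - n) else 0)) n"
      unfolding fps_sum_nth fps_mult_left_const_nth * by (simp add: coeff_sum)
  qed
  finally show ?case .
qed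

context chain begin

text \<open>Counted from the top degree: the coefficient of x^-m in x^-k times the polynomial
  operator, so that it matches \<open>Tcoef\<close> in index.\<close>

definition Tc :: "nat \<Rightarrow> bool \<Rightarrow> bool \<Rightarrow> nat \<Rightarrow> svec \<Rightarrow> svec" where
  "Tc k i j m v = (\<lambda>S. if m \<le> k then coeff (Tp k i j v S) (k - m) else 0)"

lemma Tc_conv: "Tc k i j n v = (\<Sum>m\<le>n. fps_nth (ufps b k) (n - m) \<star> appM k (Tcoef lam b k m i j) v)"
proof
  fix S'
  show "Tc k i j n v S' = (\<Sum>m\<le>n. fps_nth (ufps b k) (n - m) \<star> appM k (Tcoef lam b k m i j) v) S'"
  proof (cases "S' \<subseteq> {..<k}")
    case True
    have "(if n \<le> k then coeff (pmat lam b k i j S' S) (k - n) else 0) =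
        (\<Sum>m\<le>n. Tcoef lam b k m i j S' S * fps_nth (ufps b k) (n - m))" if "S \<in> Pow {..<k}" for S
      using arg_cong[OF Tcoef_fps[OF True, of S lam b i j], of "\<lambda>f. fps_nth f n"] that
      by (simp add: fps_mult_nth atLeast0AtMost)
    note * = this
    have "Tc k i j n v S' = (\<Sum>S\<in>Pow {..<k}. v S * (if n \<le> k then coeff (pmat lam b k i j S' S) (k - n) else 0))"
      using True by (auto simp: Tc_def Tp_def coeff_sum)
    also have "\<dots> = (\<Sum>S\<in>Pow {..<k}. v S * (\<Sum>m\<le>n. Tcoef lam b k m i j S' S * fps_nth (ufps b k) (n - m)))"
      by (intro sum.cong refl arg_cong2[where f = "(*)"] *)
    also have "\<dots> = (\<Sum>m\<le>n. fps_nth (ufps b k) (n - m) * (\<Sum>S\<in>Pow {..<k}. Tcoef lam b k m i j S' S * v S))"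
      unfolding sum_distrib_left by (subst sum.swap) (simp add: mult_ac)
    finally show ?thesis using True by (simp add: appM_def)
  qed (auto simp: Tc_def Tp_def appM_def)
qed

text \<open>\<open>ufps\<close> has constant term 1 and is invertible, so the passage between
  \<open>Tc\<close> and \<open>Tcoef\<close> is unitriangular in both directions. Invariant
  subspaces and eigenvectors are therefore the same for both families.\<close>

lemma Tcoef_conv: "appM k (Tcoef lam b k n i j) v = (\<Sum>m\<le>n. fps_nth (inverse (ufps b k)) (n - m) \<star> Tc k i j m v)"
proof
  fix S'
  let ?f = "Abs_fps (\<lambda>m. appM k (Tcoef lam b k m i j) v S')" and ?g = "Abs_fps (\<lambda>m. Tc k i j m v S')"
  have "?g = ?f * ufps b k"
    by (simp add: fps_eq_iff fps_mult_nth Tc_conv atLeast0AtMost mult.commute[of "fps_nth (ufps b k) _"])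
  then have "?f = ?g * inverse (ufps b k)"
    by (simp add: mult.assoc inverse_mult_eq_1')
  from arg_cong[OF this, of "\<lambda>f. fps_nth f n"]
  show "appM k (Tcoef lam b k n i j) v S' = (\<Sum>m\<le>n. fps_nth (inverse (ufps b k)) (n - m) \<star> Tc k i j m v) S'"
    by (simp add: fps_mult_nth atLeast0AtMost mult.commute[of "fps_nth (inverse (ufps b k)) _"])
qed

lemma T_conv_Tc: "T k i j x v = (\<Sum>m\<le>k. x ^ (k - m) \<star> Tc k i j m v)"
proof
  fix S
  have "T k i j x v S = (\<Sum>m\<le>degree (Tp k i j v S). coeff (Tp k i j v S) m * x ^ m)"
    by (simp add: poly_Tp[symmetric] poly_altdef)
  also have "\<dots> = (\<Sum>m\<le>k. coeff (Tp k i j v S) m * x ^ m)"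
    by (rule sum.mono_neutral_left) (use degree_Tp[of k i j v S] in \<open>auto simp: coeff_eq_0 not_le\<close>)
  also have "\<dots> = (\<Sum>m\<le>k. coeff (Tp k i j v S) (k - m) * x ^ (k - m))"
    by (rule sum.reindex_bij_witness[of _ "\<lambda>m. k - m" "\<lambda>m. k - m"]) auto
  finally show "T k i j x v S = (\<Sum>m\<le>k. x ^ (k - m) \<star> Tc k i j m v) S"
    by (simp add: Tc_def mult.commute)
qed

lemma W_Tcoef_invariant: "w \<in> W k \<Longrightarrow> appM k (Tcoef lam b k n i j) w \<in> W k"
proof -
  assume w: "w \<in> W k"
  have "Tc k i j m w \<in> W k" for m
  proof (cases "m \<le> k")
    case True
    have "(\<lambda>S. coeff (Tp k i j w S) (k - m)) \<in> W k"
      by (rule polyfam_coeff_in_subspace[where f = "\<lambda>x. T k i j x w" and E = "{}"])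
        (auto simp: poly_Tp W_subspace W_invariant w)
    then show ?thesis using True by (simp add: Tc_def)
  next
    case False
    then show ?thesis using sv.subspace_0[OF W_subspace] by (simp add: Tc_def zero_fun_def)
  qed
  then show ?thesis
    unfolding Tcoef_conv by (intro sv.subspace_sum[OF W_subspace] sv.subspace_scale[OF W_subspace])
qed

text \<open>Irreducibility enters only here; from now on the property in use is
  \<open>W k = Vsp k\<close>.\<close>

lemma irreducible_imp_cyclic:
  assumes "irreducible_mod lam b k"
  shows "W k = Vsp k"
proof -
  have "W k = {\<lambda>S. 0} \<or> W k = Vsp k"
  proof (rule assms[unfolded irreducible_mod_def, rule_format], intro conjI ballI allI impI)
    show "(\<lambda>S. 0) \<in> W k" using sv.subspace_0[OF W_subspace] by (simp add: zero_fun_def)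
    show "(\<lambda>S. u S + v S) \<in> W k" if "u \<in> W k" "v \<in> W k" for u v
      using sv.subspace_add[OF W_subspace that] by (simp add: plus_fun_def)
    show "(\<lambda>S. c * v S) \<in> W k" if "v \<in> W k" for c v
      using sv.subspace_scale[OF W_subspace that, of c] by (simp add: scal_def)
  qed (use W_Vsp evenpart_in_W W_Tcoef_invariant in auto)
  moreover have "vac \<in> W k" using str_W[of k "[]"] by simp
  moreover have "vac \<noteq> (\<lambda>S. 0)" by (auto simp: vac_def fun_eq_iff)
  ultimately show ?thesis by auto
qed

section \<open>Bethe vectors as limits of normalised strings\<close>

lemma Tmat_pmat:
  assumes "\<And>s. s < k \<Longrightarrow> x \<noteq> b s"
  shows "Tmat lam b k x i j S' S * (\<Prod>s<k. x - b s) = poly (pmat lam b k i j S' S) x"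
  using assms
proof (induction k arbitrary: i j S S')
  case 0
  show ?case by simp
next
  case (Suc k)
  have f: "fmat (lam k) (b k) x i r out inp * (x - b k) = poly (lpoly (lam k) (b k) i r out inp) x" for r out inp
    using Suc.prems[of k] by (simp add: fmat_def lpoly_def field_simps)
  have IH: "Tmat lam b k x r j S' S * (\<Prod>s<k. x - b s) = poly (pmat lam b k r j S' S) x" for r S S'
    using Suc by simp
  have "Tmat lam b (Suc k) x i j S' S * (\<Prod>s<Suc k. x - b s) = (\<Sum>r\<in>UNIV. tsign k i r S *
      (Tmat lam b k x r j (S' \<inter> {..<k}) (S \<inter> {..<k}) * (\<Prod>s<k. x - b s)) *
      (fmat (lam k) (b k) x i r (k \<in> S') (k \<in> S) * (x - b k)))"
    by (simp add: sum_distrib_left mult_ac)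
  then show ?case
    unfolding f IH by (simp add: poly_sum mult_ac)
qed

lemma appM_Tmat:
  assumes "\<And>s. s < k \<Longrightarrow> x \<noteq> b s"
  shows "(\<Prod>s<k. x - b s) \<star> appM k (Tmat lam b k x i j) v = T k i j x v"
proof
  fix S'
  have "T k i j x v S' = (if S' \<subseteq> {..<k} then \<Sum>S\<in>Pow {..<k}. (Tmat lam b k x i j S' S * (\<Prod>s<k. x - b s)) * v S else 0)"
    by (simp add: T_def appM_def Tmat_pmat[OF assms])
  then show "((\<Prod>s<k. x - b s) \<star> appM k (Tmat lam b k x i j) v) S' = T k i j x v S'"
    by (simp add: appM_def sum_distrib_left mult_ac)
qed

end

lemma den_append: "den (xs @ [x]) = den xs * (\<Prod>y\<leftarrow>xs. x - y + 1)"
  by (induction xs) (auto simp: algebra_simps)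

lemma prod_list_upt: "(\<Prod>i\<leftarrow>[0..<l]. f i) = (\<Prod>i<l. f i)"
  by (simp add: prod.distinct_set_conv_list[symmetric] atLeast0LessThan)

lemma den_upt: "den (map t [0..<l]) = (\<Prod>j<l. \<Prod>i<j. t j - t i + 1)"
  by (induction l) (auto simp: den_append o_def prod_list_upt)

text \<open>\<open>Lim\<close> along the trivial filter would be an arbitrary value. For
  \<open>l = 0\<close> the domain is the single point \<open>t\<close> and the filter is trivial,
  which is why \<open>bethe\<close> treats that case apart.\<close>

lemma Bdom_at_nontrivial:
  assumes "0 < l"
  shows "at t within Bdom b k l t \<noteq> bot"
proof -
  \<comment> \<open>A line through \<open>t\<close> with pairwise different non-zero slopes i + 1:
    each of the finitely many excluded equations then holds for at most one
    \<open>e\<close>.\<close>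
  define g where "g e = (\<lambda>i. if i < l then t i + of_nat (i + 1) * e else t i)" for e :: complex
  have "continuous_on UNIV g"
    unfolding g_def
  proof (rule continuous_on_coordinatewise_then_product)
    show "continuous_on UNIV (\<lambda>e. if i < l then t i + of_nat (i + 1) * e else t i)" for i
      by (cases "i < l") (auto intro!: continuous_intros)
  qed
  then have "(g \<longlongrightarrow> g 0) (at 0)"
    by (simp add: continuous_on_eq_continuous_at isCont_def)
  moreover have "g 0 = t" by (simp add: g_def fun_eq_iff)
  ultimately have lim: "(g \<longlongrightarrow> t) (at 0)" by simp
  have b: "\<forall>\<^sub>F e in at 0. t i + of_nat (i + 1) * e \<noteq> b s" for i s
  proof -
    have "\<forall>\<^sub>F e in at 0. e \<noteq> (b s - t i) / of_nat (i + 1)" by (rule eventually_neq_at_within)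
    then show ?thesis
    proof eventually_elim
      case (elim e)
      have "of_nat (i + 1) \<noteq> (0 :: complex)" by (simp only: of_nat_eq_0_iff)
      then show ?case using elim by (auto simp: field_simps)
    qed
  qed
  have c: "\<forall>\<^sub>F e in at 0. (t j + of_nat (j + 1) * e) - (t i + of_nat (i + 1) * e) + 1 \<noteq> 0" if "i < j" for i j
  proof -
    have "\<forall>\<^sub>F e in at 0. e \<noteq> - (t j - t i + 1) / of_nat (j - i)" by (rule eventually_neq_at_within)
    then show ?thesis
    proof eventually_elim
      case (elim e)
      have "of_nat (j - i) \<noteq> (0 :: complex)" using that by simp
      moreover have "(t j + of_nat (j + 1) * e) - (t i + of_nat (i + 1) * e) + 1 = of_nat (j - i) * e + (t j - t i + 1)"
        using that by (simp add: of_nat_diff algebra_simps)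
      ultimately show ?case using elim by (auto simp: field_simps add_eq_0_iff)
    qed
  qed
  have "\<forall>\<^sub>F e in at 0. g e \<in> Bdom b k l t \<and> g e \<noteq> t"
  proof -
    have "\<forall>\<^sub>F e in at 0. \<forall>i\<in>{..<l}. \<forall>s\<in>{..<k}. t i + of_nat (i + 1) * e \<noteq> b s"
      by (intro eventually_ball_finite ballI b) auto
    moreover have "\<forall>\<^sub>F e in at 0. \<forall>j\<in>{..<l}. \<forall>i\<in>{..<j}. (t j + of_nat (j + 1) * e) - (t i + of_nat (i + 1) * e) + 1 \<noteq> 0"
      by (intro eventually_ball_finite ballI c) auto
    moreover have "\<forall>\<^sub>F e in at 0. e \<noteq> (0::complex)" by (rule eventually_neq_at_within)
    ultimately show ?thesis
    proof eventually_elim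
      case (elim e)
      have "g e 0 \<noteq> t 0" using elim assms by (simp add: g_def)
      then have "g e \<noteq> t" by metis
      then show ?case using elim by (auto simp: Bdom_def g_def)
    qed
  qed
  with lim have "filterlim g (at t within Bdom b k l t) (at 0)"
    by (simp add: filterlim_at eventually_conj_iff)
  then have fl: "\<forall>P. eventually P (at t within Bdom b k l t) \<longrightarrow> (\<forall>\<^sub>F e in at 0. P (g e))"
    unfolding filterlim_iff .
  show ?thesis
  proof
    assume "at t within Bdom b k l t = bot"
    then have "\<forall>\<^sub>F e in at (0::complex). False"
      using spec[OF fl, of "\<lambda>_. False"] by (simp only: eventually_bot simp_thms)
    then show False by (simp only: eventually_False at_neq_bot)
  qed
qed

context chain begin

lemma foldr_Tmat:
  assumes "\<And>i s. i \<in> set is \<Longrightarrow> s < k \<Longrightarrow> t i \<noteq> b s"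
  shows "(\<Prod>i\<leftarrow>is. \<Prod>s<k. t i - b s) \<star> foldr (\<lambda>i v. appM k (Tmat lam b k (t i) False True) v) is vac
    = str k (map t is)"
  using assms
proof (induction "is")
  case Nil
  show "(\<Prod>i\<leftarrow>[]. \<Prod>s<k. t i - b s) \<star> foldr (\<lambda>i v. appM k (Tmat lam b k (t i) False True) v) [] vac
    = str k (map t [])" by simp
next
  case (Cons i "is")
  let ?f = "foldr (\<lambda>i v. appM k (Tmat lam b k (t i) False True) v)"
  have IH: "(\<Prod>i\<leftarrow>is. \<Prod>s<k. t i - b s) \<star> ?f is vac = str k (map t is)"
    by (rule Cons.IH) (use Cons.prems in auto)
  have "(\<Prod>i\<leftarrow>i # is. \<Prod>s<k. t i - b s) \<star> ?f (i # is) vac =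
     (\<Prod>s<k. t i - b s) \<star> appM k (Tmat lam b k (t i) False True) ((\<Prod>i\<leftarrow>is. \<Prod>s<k. t i - b s) \<star> ?f is vac)"
    by (simp add: appM_scal)
  also have "\<dots> = str k (map t (i # is))"
    unfolding IH by (subst appM_Tmat) (use Cons.prems in auto)
  finally show "(\<Prod>i\<leftarrow>i # is. \<Prod>s<k. t i - b s) \<star> ?f (i # is) vac = str k (map t (i # is))" .
qed

lemma Bexpr_str:
  assumes "\<And>i s. i < l \<Longrightarrow> s < k \<Longrightarrow> t i \<noteq> b s"
  shows "Bexpr lam b k l t = (1 / den (map t [0..<l])) \<star> str k (map t [0..<l])"
proof -
  have p: "(\<Prod>i\<leftarrow>[0..<l]. \<Prod>s<k. t i - b s) = (\<Prod>i<l. \<Prod>s<k. t i - b s)"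
    by (rule prod_list_upt)
  have "str k (map t [0..<l]) = (\<Prod>i<l. \<Prod>s<k. t i - b s) \<star> foldr (\<lambda>i v. appM k (Tmat lam b k (t i) False True) v) [0..<l] vac"
    by (subst foldr_Tmat[symmetric, where t = t]) (use assms p in auto)
  then show ?thesis
    by (simp add: Bexpr_def Let_def den_upt fun_eq_iff)
qed

lemma tendsto_str:
  assumes "\<And>i. ((\<lambda>x. g x i) \<longlongrightarrow> t i) F"
  shows "((\<lambda>x. str k (map (g x) is) S) \<longlongrightarrow> str k (map t is) S) F"
proof (induction "is" arbitrary: S)
  case Nil
  show ?case by simp
next
  case (Cons i "is")
  have "((\<lambda>x. \<Sum>S'\<in>Pow {..<k}. poly (pmat lam b k False True S S') (g x i) * str k (map (g x) is) S')
    \<longlongrightarrow> (\<Sum>S'\<in>Pow {..<k}. poly (pmat lam b k False True S S') (t i) * str k (map t is) S')) F"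
    by (intro tendsto_intros Cons isCont_tendsto_compose[OF poly_isCont] assms)
  then show ?case by (auto simp: T_def appM_def)
qed

lemma tendsto_den:
  assumes "\<And>i. ((\<lambda>x. g x i) \<longlongrightarrow> t i) F"
  shows "((\<lambda>x. den (map (g x) is)) \<longlongrightarrow> den (map t is)) F"
proof (induction "is")
  case (Cons i "is")
  have "((\<lambda>x. \<Prod>j\<leftarrow>is. g x j - g x i + 1) \<longlongrightarrow> (\<Prod>j\<leftarrow>is. t j - t i + 1)) F"
    by (induction "is") (auto intro!: tendsto_intros assms)
  then show ?case using Cons by (auto simp: o_def intro!: tendsto_mult)
qed simp

text \<open>In an ordering \<open>f\<close> for which the denominator is non-zero at \<open>t\<close>, the Bethe vector is continuous at \<open>t\<close>,
  so the limit is its value there.\<close>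

lemma bethe_str:
  fixes f :: "nat \<Rightarrow> nat"
  assumes "inj_on f {..<l}"
    and "\<And>i j. i < l \<Longrightarrow> j < l \<Longrightarrow> f i < f j \<Longrightarrow> t j - t i + 1 \<noteq> 0"
  defines "L \<equiv> map t (sort_key f [0..<l])"
  shows "bethe lam b k l t = (1 / den L) \<star> str k L"
proof (cases "l = 0")
  case True
  then show ?thesis using Bexpr_str[of 0 k t] by (simp add: bethe_def L_def)
next
  case False
  let ?F = "at t within Bdom b k l t" and ?s = "sort_key f [0..<l]"
  have co: "((\<lambda>t'. t' i) \<longlongrightarrow> t i) ?F" for i
  proof -
    have "continuous_on UNIV (\<lambda>t' :: nat \<Rightarrow> complex. t' i)" by (rule continuous_on_product_coordinates)
    then show ?thesis
      by (metis UNIV_I continuous_on_def tendsto_within_subset subset_UNIV)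
  qed
  have denL: "den L \<noteq> 0"
    unfolding L_def by (rule str_sort) (use assms(1,2) in \<open>auto simp: atLeast0LessThan\<close>)
  have ev: "\<forall>\<^sub>F t' in ?F. \<forall>i\<in>{..<l}. \<forall>j\<in>{j \<in> {..<l}. f i < f j}. t' j - t' i + 1 \<noteq> 0"
  proof (intro eventually_ball_finite ballI)
    fix i j assume "i \<in> {..<l}" "j \<in> {j \<in> {..<l}. f i < f j}"
    moreover have "((\<lambda>t'. t' j - t' i + 1) \<longlongrightarrow> t j - t i + 1) ?F"
      by (intro tendsto_intros co)
    ultimately show "\<forall>\<^sub>F t' in ?F. t' j - t' i + 1 \<noteq> 0"
      using assms(2) by (intro tendsto_imp_eventually_ne) auto
  qed auto
  have "\<forall>\<^sub>F t' in ?F. t' \<in> Bdom b k l t" by (simp add: eventually_at_filter)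
  \<comment> \<open>Near \<open>t\<close> both denominators are non-zero, that of the natural order
    by \<open>Bdom\<close> and that of the order \<open>f\<close> by \<open>ev\<close>, so the
    quotient may be computed in either order.\<close>
  with ev have eq: "\<forall>\<^sub>F t' in ?F. Bexpr lam b k l t' = (1 / den (map t' ?s)) \<star> str k (map t' ?s)"
  proof eventually_elim
    case (elim t')
    have "den (map t' ?s) \<noteq> 0" and
      s: "den (map t' ?s) \<star> str k (map t' [0..<l]) = den (map t' [0..<l]) \<star> str k (map t' ?s)"
      using str_sort(1)[of "[0..<l]" f t'] str_sort(2)[of "[0..<l]" f t' k] assms(1) elim(1) by (auto simp: atLeast0LessThan)
    moreover have "den (map t' [0..<l]) \<noteq> 0"
      unfolding den_upt using elim(2) by (auto simp: Bdom_def)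
    ultimately have "(1 / den (map t' [0..<l])) \<star> str k (map t' [0..<l]) = (1 / den (map t' ?s)) \<star> str k (map t' ?s)"
      using fun_cong[OF s] by (auto simp: fun_eq_iff field_simps)
    moreover have "Bexpr lam b k l t' = (1 / den (map t' [0..<l])) \<star> str k (map t' [0..<l])"
      by (rule Bexpr_str) (use elim(2) in \<open>auto simp: Bdom_def\<close>)
    ultimately show ?case by simp
  qed
  have "Lim ?F (\<lambda>t'. Bexpr lam b k l t' S) = ((1 / den L) \<star> str k L) S" for S
  proof (rule tendsto_Lim)
    show "\<not> trivial_limit ?F" using Bdom_at_nontrivial[of l t b k] False by simp
    have "((\<lambda>t'. ((1 / den (map t' ?s)) \<star> str k (map t' ?s)) S) \<longlongrightarrow> ((1 / den L) \<star> str k L) S) ?F"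
      unfolding scal_apply L_def
      by (intro tendsto_intros tendsto_str tendsto_den co) (use denL in \<open>simp add: L_def\<close>)
    then show "((\<lambda>t'. Bexpr lam b k l t' S) \<longlongrightarrow> ((1 / den L) \<star> str k L) S) ?F"
      by (rule Lim_transform_eventually) (use eq in \<open>auto elim: eventually_mono\<close>)
  qed
  then show ?thesis using False by (simp add: bethe_def fun_eq_iff)
qed

end

section \<open>On-shell strings are eigenvectors\<close>

lemma prod_linear_dvd:
  fixes p :: "complex poly"
  assumes "finite I" "inj_on a I" "\<And>i. i \<in> I \<Longrightarrow> poly p (a i) = 0"
  shows "(\<Prod>i\<in>I. [:- a i, 1:]) dvd p"
  using assms
proof (induction I)
  case (insert i I)
  then obtain q where q: "p = (\<Prod>i\<in>I. [:- a i, 1:]) * q"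
    by (auto elim!: dvdE)
  have "poly (\<Prod>j\<in>I. [:- a j, 1:]) (a i) \<noteq> 0"
    using insert by (auto simp: poly_prod inj_on_def)
  moreover have "poly p (a i) = 0" using insert by simp
  ultimately have "poly q (a i) = 0" unfolding q by simp
  then have "[:- a i, 1:] dvd q" by (simp add: poly_eq_0_iff_dvd)
  then have "[:- a i, 1:] * (\<Prod>i\<in>I. [:- a i, 1:]) dvd p"
    unfolding q by (simp only: mult.commute[of "[:- a i, 1:]"] mult_dvd_mono dvd_refl)
  then show ?case using insert by simp
qed simp

lemma degree_prod_linear: "degree (\<Prod>i\<in>I. [:- a i, 1:] :: complex poly) = card I"
  by (cases "finite I") (auto simp: degree_prod_eq_sum_degree)

lemma coeff_prod_linear: "finite I \<Longrightarrow> coeff (\<Prod>i\<in>I. [:- a i, 1:] :: complex poly) (card I) = 1"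
  using monic_prod[of I "\<lambda>i. [:- a i, 1:]"] unfolding degree_prod_linear by simp

text \<open>One degree more than the nodes determine: the missing datum is the leading coefficient.
  For q1 = q2 it will carry e21 v_I.\<close>

lemma lagrange_interpolation_le:
  assumes "finite X" "degree p \<le> card X"
  shows "p = (\<Sum>a\<in>X. smult (poly p a) (lagrange_basis X a)) + smult (coeff p (card X)) (\<Prod>a\<in>X. [:- a, 1:])"
proof -
  let ?Z = "\<Prod>a\<in>X. [:- a, 1:] :: complex poly"
  let ?q = "p - smult (coeff p (card X)) ?Z"
  have r: "poly ?q a = poly p a" if "a \<in> X" for a
    using that assms(1) by (auto simp: poly_prod)
  have "degree ?q \<le> card X"
    by (intro degree_diff_le assms(2) order_trans[OF degree_smult_le] eq_refl[OF degree_prod_linear])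
  moreover have "coeff ?q (card X) = 0" using coeff_prod_linear[OF assms(1), of "\<lambda>a. a"] by simp
  ultimately have "?q = 0 \<or> degree ?q < card X"
    by (metis le_neq_implies_less leading_coeff_0_iff)
  then have "?q = (\<Sum>a\<in>X. smult (poly ?q a) (lagrange_basis X a))"
    using lagrange_interpolation[OF assms(1)] by fastforce
  also have "\<dots> = (\<Sum>a\<in>X. smult (poly p a) (lagrange_basis X a))"
    using r by (intro sum.cong) auto
  finally show ?thesis by (simp add: algebra_simps)
qed

lemma coeff_mult_le:
  assumes "degree p \<le> m" "degree q \<le> n"
  shows "coeff (p * q) (m + n) = coeff p m * coeff (q :: complex poly) n"
proof (cases "degree p = m \<and> degree q = n")
  case True
  then show ?thesis using coeff_mult_degree_sum[of p q] by simp
next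
  case False
  then have "degree p + degree q < m + n" using assms by linarith
  then have "coeff (p * q) (m + n) = 0" by (meson coeff_eq_0 degree_mult_le le_less_trans)
  moreover have "coeff p m * coeff q n = 0"
    using False assms by (metis coeff_eq_0 le_neq_implies_less mult_eq_0_iff)
  ultimately show ?thesis by simp
qed

text \<open>The roots are sorted by real part, so that \<open>r j - r i + 1\<close> is non-zero for \<open>i < j\<close> and strings in
  increasing order have a non-zero denominator.\<close>

locale bethe_roots = chain lam b for lam :: "nat \<Rightarrow> wt" and b :: "nat \<Rightarrow> complex" +
  fixes k d :: nat and q1 q2 lc :: complex and r :: "nat \<Rightarrow> complex"
  assumes factorization: "smult q1 (phi_poly lam b k) - smult q2 (psi_poly lam b k) = smult lc (\<Prod>i<d. [:- r i, 1:])"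
    and lc: "lc \<noteq> 0"
    and inj_r: "inj_on r {..<d}"
    and mono_r: "\<And>i j. i \<le> j \<Longrightarrow> j < d \<Longrightarrow> Re (r i) \<le> Re (r j)"
    and d: "d = (if q1 = q2 then k - 1 else k)"
    and k_pos: "q1 = q2 \<Longrightarrow> 0 < k"
    and q1: "q1 \<noteq> 0" and q2: "q2 \<noteq> 0"
begin

definition PQ :: "complex \<Rightarrow> svec \<Rightarrow> svec" where
  "PQ x v = q1 \<star> A k x v - q2 \<star> D k x v"

text \<open>The eigenvalue on v_I: \<open>p\<close> times the product over \<open>I\<close> of (x -
  r_i - 1) / (x - r_i), the factors coming from the exchange relation. Each pole cancels a root of
  \<open>p\<close>.\<close>

definition E :: "nat set \<Rightarrow> complex poly" where
  "E I = smult lc (\<Prod>i<d. [:- r i - of_bool (i \<in> I), 1:])"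

definition G :: "nat set \<Rightarrow> svec" where
  "G I = str k (map r (sorted_list_of_set I))"

lemma PQ_add [simp]: "PQ x (u + v) = PQ x u + PQ x v"
  and PQ_scal [simp]: "PQ x (c \<star> v) = c \<star> PQ x v"
  and PQ_Vsp [simp]: "PQ x v \<in> Vsp k"
  by (auto simp: PQ_def fun_eq_iff algebra_simps)

lemma PQ_zero [simp]: "PQ x 0 = 0"
  by (simp add: PQ_def)

lemma polyfam_PQ [intro]: "polyfam f \<Longrightarrow> polyfam (\<lambda>x. PQ x (f x))"
  unfolding PQ_def by (intro polyfam_diff polyfam_scal_const polyfam_T)

lemma PQ_B: "(x - y) \<star> PQ x (B k y u) = (x - y - 1) \<star> B k y (PQ x u) + B k x (PQ y u)"
proof
  fix S
  show "((x - y) \<star> PQ x (B k y u)) S = ((x - y - 1) \<star> B k y (PQ x u) + B k x (PQ y u)) S"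
    using fun_cong[OF AB[of x y k u], of S] fun_cong[OF DB[of x y k u], of S]
    unfolding PQ_def T_add T_diff T_scal plus_fun_apply minus_apply scal_apply
    by Groebner_Basis.algebra
qed

lemma poly_E: "poly (E I) x = lc * (\<Prod>i<d. x - r i - of_bool (i \<in> I))"
  by (simp add: E_def poly_prod algebra_simps)

lemma PQ_vac: "PQ x vac = poly (E {}) x \<star> vac"
proof -
  have "poly (E {}) x = poly (smult q1 (phi_poly lam b k) - smult q2 (psi_poly lam b k)) x"
    unfolding factorization by (simp add: E_def)
  also have "\<dots> = q1 * (\<Prod>s<k. al s x) - q2 * (\<Prod>s<k. de s x)"
    by (simp add: phi_poly_def psi_poly_def poly_prod algebra_simps)
  finally have *: "poly (E {}) x = q1 * (\<Prod>s<k. al s x) - q2 * (\<Prod>s<k. de s x)" .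
  show ?thesis unfolding * by (simp add: PQ_def A_vac D_vac sv.scale_left_diff_distrib)
qed

lemma E_insert:
  assumes "i < d" "i \<notin> I"
  shows "(x - r i) * poly (E (insert i I)) x = (x - r i - 1) * poly (E I) x"
proof -
  have eq: "(\<Prod>j\<in>{..<d} - {i}. x - r j - of_bool (j \<in> insert i I)) = (\<Prod>j\<in>{..<d} - {i}. x - r j - of_bool (j \<in> I))"
    by (intro prod.cong) auto
  have "(\<Prod>j<d. x - r j - of_bool (j \<in> J)) =
      (x - r i - of_bool (i \<in> J)) * (\<Prod>j\<in>{..<d} - {i}. x - r j - of_bool (j \<in> J))" for J
    using assms(1) by (intro prod.remove) auto
  note split = this
  show ?thesis
    unfolding poly_E split eq using assms(2) by simp
qed

lemma E_root: "i < d \<Longrightarrow> i \<notin> I \<Longrightarrow> poly (E I) (r i) = 0"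
  unfolding poly_E by (auto intro!: prod_zero bexI[of _ i])

text \<open>The unwanted term in \<open>PQ_B\<close> is \<open>B k x (PQ (r i) ?u)\<close>. It
  vanishes because \<open>r i\<close>, not yet in the string, is still a root of
  \<open>E (set is)\<close>.\<close>

lemma PQ_str:
  assumes "distinct is" "set is \<subseteq> {..<d}"
  shows "PQ x (str k (map r is)) = poly (E (set is)) x \<star> str k (map r is)"
  using assms
proof (induction "is" arbitrary: x)
  case Nil
  show "PQ x (str k (map r [])) = poly (E (set [])) x \<star> str k (map r [])" using PQ_vac by simp
next
  case (Cons i "is")
  let ?u = "str k (map r is)"
  have IH: "PQ x ?u = poly (E (set is)) x \<star> ?u" for x
    by (rule Cons.IH) (use Cons.prems in auto)
  have i: "i < d" "i \<notin> set is" using Cons.prems by auto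
  have "(\<lambda>x. PQ x (str k (map r (i # is)))) = (\<lambda>x. poly (E (set (i # is))) x \<star> str k (map r (i # is)))"
  proof (rule polyfam_eq[where E = "{r i}"])
    fix x assume "x \<notin> {r i}"
    then have nz: "x - r i \<noteq> 0" by simp
    have "(x - r i) \<star> PQ x (B k (r i) ?u) = ((x - r i - 1) * poly (E (set is)) x) \<star> B k (r i) ?u"
      using PQ_B[of x "r i" ?u] by (simp add: IH E_root[OF i])
    also have "\<dots> = (x - r i) \<star> (poly (E (set (i # is))) x \<star> B k (r i) ?u)"
      using E_insert[OF i, of x] by simp
    finally show "PQ x (str k (map r (i # is))) = poly (E (set (i # is))) x \<star> str k (map r (i # is))"
      unfolding list.map str_Cons by (rule sv.scale_left_imp_eq[OF nz])
  qed auto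
  then show "PQ x (str k (map r (i # is))) = poly (E (set (i # is))) x \<star> str k (map r (i # is))"
    by (rule fun_cong)
qed

lemma PQ_G: "I \<subseteq> {..<d} \<Longrightarrow> PQ x (G I) = poly (E I) x \<star> G I"
  using PQ_str[of "sorted_list_of_set I" x] finite_subset[of I "{..<d}"] by (simp add: G_def)

lemma root_gap:
  assumes "i < j" "j < d" "Re c \<ge> 1"
  shows "r j - r i + c \<noteq> 0"
proof
  assume "r j - r i + c = 0"
  then have "Re (r j - r i + c) = 0" by simp
  then show False using mono_r[of i j] assms by simp
qed

lemma sorted_wrt_roots:
  assumes "I \<subseteq> {..<d}"
  shows "sorted_wrt (\<lambda>x y. y - x + 1 \<noteq> 0) (map r (sorted_list_of_set I))"
  unfolding sorted_wrt_map
proof (rule sorted_wrt_mono_rel)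
  show "sorted_wrt (<) (sorted_list_of_set I)" by simp
  fix x y assume "x \<in> set (sorted_list_of_set I)" "y \<in> set (sorted_list_of_set I)" "x < y"
  then show "r y - r x + 1 \<noteq> 0"
    using assms finite_subset[OF assms] root_gap[of x y 1] by auto
qed

lemma den_roots: "I \<subseteq> {..<d} \<Longrightarrow> den (map r (sorted_list_of_set I)) \<noteq> 0"
  by (rule den_nonzero[OF sorted_wrt_roots])

text \<open>Move the argument r_i + 1 to the place just behind r_i. By \<open>str_move\<close> this
  costs a product with the factor r_i - (r_i + 1) + 1 = 0, while the denominator of the new order is
  non-zero.\<close>

lemma B_root_shift:
  assumes "I \<subseteq> {..<d}" "i \<in> I"
  shows "B k (r i + 1) (G I) = 0"
proof -
  have fin: "finite I" using assms(1) finite_subset by auto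
  then obtain xs ys where l: "sorted_list_of_set I = xs @ i # ys"
    using split_list[of i "sorted_list_of_set I"] assms(2) by auto
  have s: "sorted_wrt (<) (xs @ i # ys)" using l by (metis strict_sorted_list_of_set)
  have sub: "set (xs @ i # ys) \<subseteq> {..<d}" using l fin assms(1) by (metis set_sorted_list_of_set)
  let ?x = "r i + 1"
  have w: "sorted_wrt (\<lambda>x y. y - x + 1 \<noteq> 0) (map r xs @ r i # map r ys)"
    using sorted_wrt_roots[OF assms(1)] l by simp
  have "den ((map r xs @ [r i]) @ ?x # map r ys) \<noteq> 0"
  proof (rule den_nonzero)
    \<comment> \<open>The pairs with the new entry r_i + 1 contribute r_i - r_x + 2 for earlier
      roots, 2 for r_i itself and r_y - r_i for later roots.\<close>
    have "r i + 1 - r x + 1 \<noteq> 0" if "x \<in> set xs" for x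
      using that s sub root_gap[of x i 2] by (auto simp: sorted_wrt_append algebra_simps)
    moreover have "r y \<noteq> r i" if "y \<in> set ys" for y
      using that s sub inj_r by (auto simp: sorted_wrt_append inj_on_def)
    ultimately show "sorted_wrt (\<lambda>x y. y - x + 1 \<noteq> 0) ((map r xs @ [r i]) @ ?x # map r ys)"
      using w by (auto simp: sorted_wrt_append)
  qed
  moreover have "den ((map r xs @ [r i]) @ ?x # map r ys) \<star> str k (?x # (map r xs @ [r i]) @ map r ys) = 0"
    unfolding str_move by simp
  ultimately show ?thesis by (simp add: G_def l)
qed

end

section \<open>The operators at infinity in the case of equal twists\<close>

text \<open>\<open>v\<close> is the limit of y^-m f(y) at infinity. Comparing such limits on both
  sides of an RTT relation yields the relations with e21 and e12.\<close>

definition topc :: "nat \<Rightarrow> (complex \<Rightarrow> svec) \<Rightarrow> svec \<Rightarrow> bool" where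
  "topc m f v \<longleftrightarrow> (\<exists>P. \<forall>S. (\<forall>y. f y S = poly (P S) y) \<and> degree (P S) \<le> m \<and> coeff (P S) m = v S)"

lemma topcI:
  assumes "\<And>y S. f y S = poly (P S) y" "\<And>S. degree (P S) \<le> m" "\<And>S. coeff (P S) m = v S"
  shows "topc m f v"
  using assms unfolding topc_def by blast

lemma topcE:
  assumes "topc m f v"
  obtains P where "\<And>y S. f y S = poly (P S) y" "\<And>S. degree (P S) \<le> m" "\<And>S. coeff (P S) m = v S"
  using assms unfolding topc_def by metis

lemma topc_unique: "topc m f v \<Longrightarrow> topc m f w \<Longrightarrow> v = w"
proof
  fix S
  assume "topc m f v" "topc m f w"
  then obtain P Q where "\<And>y S. f y S = poly (P S) y" "\<And>S. coeff (P S) m = v S"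
    "\<And>y S. f y S = poly (Q S) y" "\<And>S. coeff (Q S) m = w S"
    by (metis topcE)
  moreover from this have "P S = Q S"
    by (simp add: poly_eq_poly_eq_iff[symmetric] fun_eq_iff)
  ultimately show "v S = w S" by metis
qed

lemma topc_eqI: "topc m f v \<Longrightarrow> topc m g w \<Longrightarrow> f = g \<Longrightarrow> v = w"
  using topc_unique by simp

lemma topc_add: "topc m f v \<Longrightarrow> topc m g w \<Longrightarrow> topc m (\<lambda>y. f y + g y) (v + w)"
proof -
  assume "topc m f v" "topc m g w"
  from \<open>topc m f v\<close> obtain P where P: "\<And>y S. f y S = poly (P S) y" "\<And>S. degree (P S) \<le> m" "\<And>S. coeff (P S) m = v S"
    by (rule topcE) blast
  from \<open>topc m g w\<close> obtain Q where Q: "\<And>y S. g y S = poly (Q S) y" "\<And>S. degree (Q S) \<le> m" "\<And>S. coeff (Q S) m = w S"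
    by (rule topcE) blast
  have "degree (P S + Q S) \<le> m" for S
    using degree_add_le_max[of "P S" "Q S"] P(2)[of S] Q(2)[of S] by linarith
  then show ?thesis by (intro topcI[of _ "\<lambda>S. P S + Q S"]) (simp_all add: P Q)
qed

lemma topc_poly_mult:
  assumes "topc m f v" "degree e \<le> n"
  shows "topc (n + m) (\<lambda>y. poly e y \<star> f y) (coeff e n \<star> v)"
proof -
  obtain P where P: "\<And>y S. f y S = poly (P S) y" "\<And>S. degree (P S) \<le> m" "\<And>S. coeff (P S) m = v S"
    by (rule topcE[OF assms(1)]) blast
  show ?thesis
  proof (rule topcI[of _ "\<lambda>S. e * P S"])
    show "degree (e * P S) \<le> n + m" for S
      using assms(2) P(2) by (meson add_mono degree_mult_le order_trans)
    show "coeff (e * P S) (n + m) = (coeff e n \<star> v) S" for S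
      by (simp add: coeff_mult_le[OF assms(2) P(2)] P(3))
  qed (simp add: P)
qed

lemma topc_scal: "topc m f v \<Longrightarrow> topc m (\<lambda>y. c \<star> f y) (c \<star> v)"
  using topc_poly_mult[of m f v "[:c:]" 0] by simp

lemma topc_linear: "topc m f v \<Longrightarrow> topc (Suc m) (\<lambda>y. (a + c * y) \<star> f y) (c \<star> v)"
  using topc_poly_mult[of m f v "[:a, c:]" 1] by (simp add: mult.commute)

lemma topc_diff: "topc m f v \<Longrightarrow> topc m g w \<Longrightarrow> topc m (\<lambda>y. f y - g y) (v - w)"
  using topc_add[of m f v "\<lambda>y. (-1) \<star> g y" "(-1) \<star> w"] topc_scal[of m g w "-1"] by simp

lemma topc_const_poly: "degree e \<le> m \<Longrightarrow> topc m (\<lambda>y. poly e y \<star> v) (coeff e m \<star> v)"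
  by (rule topcI[of _ "\<lambda>S. smult (v S) e"]) (auto intro: order_trans[OF degree_smult_le])

context chain begin

lemma topc_appM: "topc m f v \<Longrightarrow> topc m (\<lambda>y. appM k M (f y)) (appM k M v)"
proof -
  assume "topc m f v"
  then obtain P where P: "\<And>y S. f y S = poly (P S) y" "\<And>S. degree (P S) \<le> m" "\<And>S. coeff (P S) m = v S"
    by (rule topcE) blast
  show ?thesis
    by (rule topcI[of _ "\<lambda>S'. if S' \<subseteq> {..<k} then \<Sum>S\<in>Pow {..<k}. smult (M S' S) (P S) else 0"])
      (use P in \<open>auto simp: appM_def poly_sum coeff_sum intro!: degree_sum_le order_trans[OF degree_smult_le]\<close>)
qed

lemma topc_T_fixed: "topc m f v \<Longrightarrow> topc m (\<lambda>y. T k i j x (f y)) (T k i j x v)"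
  unfolding T_def by (rule topc_appM)

lemma Tc_appM: "\<exists>M. Tc k i j m = appM k M"
proof
  show "Tc k i j m = appM k (\<lambda>S' S. if m \<le> k then coeff (pmat lam b k i j S' S) (k - m) else 0)"
    by (auto simp: Tc_def Tp_def appM_def coeff_sum fun_eq_iff mult.commute)
qed

lemma topc_Tc: "topc m f v \<Longrightarrow> topc m (\<lambda>y. Tc k i j n (f y)) (Tc k i j n v)"
  using Tc_appM[of k i j n] topc_appM by metis

lemma Tc_add [simp]: "Tc k i j m (u + v) = Tc k i j m u + Tc k i j m v"
  and Tc_scal [simp]: "Tc k i j m (c \<star> v) = c \<star> Tc k i j m v"
  and Tc_Vsp [simp]: "Tc k i j m v \<in> Vsp k"
  using Tc_appM[of k i j m] by (auto simp: appM_add appM_scal)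

lemma Tc_uminus [simp]: "Tc k i j m (- v) = - Tc k i j m v"
  using Tc_scal[of k i j m "-1" v] by simp

lemma topc_diag: "v \<in> Vsp k \<Longrightarrow> topc k (\<lambda>y. T k i i y v) v"
  by (rule topcI[of _ "Tp k i i v"]) (auto simp: poly_Tp degree_Tp coeff_Tp_top)

lemma coeff_Tp_offdiag: "i \<noteq> j \<Longrightarrow> k \<le> n \<Longrightarrow> coeff (Tp k i j v S) n = 0"
  by (auto simp: Tp_def coeff_sum coeff_pmat)

lemma degree_Tp_offdiag: "i \<noteq> j \<Longrightarrow> degree (Tp k i j v S) \<le> k - 1"
  by (rule degree_le) (auto intro!: coeff_Tp_offdiag)

text \<open>For \<open>i \<noteq> j\<close> the entries have degree below \<open>k\<close>, and \<open>Tinf\<close> is the action of \<open>e21\<close> or \<open>e12\<close> up to sign.\<close>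

definition Tinf :: "nat \<Rightarrow> bool \<Rightarrow> bool \<Rightarrow> svec \<Rightarrow> svec" where
  "Tinf k i j v = Tc k i j 1 v"

lemma Tinf_add [simp]: "Tinf k i j (u + v) = Tinf k i j u + Tinf k i j v"
  and Tinf_scal [simp]: "Tinf k i j (c \<star> v) = c \<star> Tinf k i j v"
  and Tinf_uminus [simp]: "Tinf k i j (- v) = - Tinf k i j v"
  and Tinf_Vsp [simp]: "Tinf k i j v \<in> Vsp k"
  and topc_Tinf: "topc m f v \<Longrightarrow> topc m (\<lambda>y. Tinf k i j (f y)) (Tinf k i j v)"
  by (simp_all add: Tinf_def topc_Tc)

lemma topc_offdiag:
  assumes "i \<noteq> j" "0 < k"
  shows "topc (k - 1) (\<lambda>y. T k i j y v) (Tinf k i j v)"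
  by (rule topcI[of _ "Tp k i j v"]) (use assms degree_Tp_offdiag in \<open>auto simp: poly_Tp Tc_def Tinf_def\<close>)

lemma singular_iff: "singular lam b k v \<longleftrightarrow> v \<in> Vsp k \<and> Tinf k True False v = 0"
proof -
  have "Tc k True False 0 v = 0"
    by (auto simp: Tc_def coeff_Tp_offdiag fun_eq_iff)
  then have "appM k (Tcoef lam b k 1 True False) v = Tinf k True False v"
    by (simp add: Tcoef_conv Tinf_def)
  then show ?thesis by (simp add: singular_def zero_fun_def)
qed

text \<open>The coefficient of y^k in \<open>BB\<close>.\<close>

lemma Binf_B:
  assumes "0 < k"
  shows "Tinf k False True (B k x v) = - B k x (Tinf k False True v)"
proof -
  have k: "Suc (k - 1) = k" using assms by simp
  have off: "topc (k - 1) (\<lambda>y. B k y u) (Tinf k False True u)" for u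
    using assms by (intro topc_offdiag) auto
  have "topc k (\<lambda>y. ((x + 1) + (- 1) * y) \<star> B k x (B k y v)) ((- 1) \<star> B k x (Tinf k False True v))"
    by (rule topc_linear[OF topc_T_fixed[OF off], unfolded k])
  moreover have "topc k (\<lambda>y. ((1 - x) + 1 * y) \<star> B k y (B k x v)) (1 \<star> Tinf k False True (B k x v))"
    by (rule topc_linear[OF off, unfolded k])
  moreover have "(\<lambda>y. ((x + 1) + (- 1) * y) \<star> B k x (B k y v)) = (\<lambda>y. ((1 - x) + 1 * y) \<star> B k y (B k x v))"
  proof
    fix y
    have "(x + 1) + (- 1) * y = x - y + 1" "(1 - x) + 1 * y = y - x + 1" by simp_all
    then show "((x + 1) + (- 1) * y) \<star> B k x (B k y v) = ((1 - x) + 1 * y) \<star> B k y (B k x v)"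
      using BB[of x y k v] by presburger
  qed
  ultimately have "(- 1) \<star> B k x (Tinf k False True v) = 1 \<star> Tinf k False True (B k x v)"
    by (rule topc_eqI)
  then show ?thesis by simp
qed

text \<open>The top coefficient in x of \<open>Binf_B\<close> says that this vector is its own
  negative.\<close>

lemma Binf_Binf:
  assumes "0 < k"
  shows "Tinf k False True (Tinf k False True v) = 0"
proof -
  let ?w = "Tinf k False True (Tinf k False True v)"
  have "topc (k - 1) (\<lambda>x. Tinf k False True (B k x v)) ?w"
    using assms by (intro topc_Tinf topc_offdiag) auto
  moreover have "topc (k - 1) (\<lambda>x. (- 1) \<star> B k x (Tinf k False True v)) ((- 1) \<star> ?w)"
    using assms by (intro topc_scal topc_offdiag) auto
  ultimately have "?w = (- 1) \<star> ?w"
    using topc_unique by (simp add: Binf_B[OF assms])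
  then show ?thesis by (simp add: fun_eq_iff)
qed

text \<open>The coefficient of x^k in \<open>CB\<close>; the diagonal operators contribute the
  identity there.\<close>

lemma Cinf_B:
  assumes "0 < k" "u \<in> Vsp k"
  shows "Tinf k True False (B k y u) = D k y u - A k y u - B k y (Tinf k True False u)"
proof -
  have k: "Suc (k - 1) = k" using assms by simp
  have "topc k (\<lambda>x. ((- y) + 1 * x) \<star> (C k x (B k y u) + B k y (C k x u)))
      (1 \<star> (Tinf k True False (B k y u) + B k y (Tinf k True False u)))"
    using assms(1) by (intro topc_linear[where m = "k - 1", unfolded k] topc_add topc_T_fixed topc_offdiag) auto
  moreover have "topc k (\<lambda>x. D k y (A k x u) - D k x (A k y u)) (D k y u - A k y u)"
    using assms(2) by (intro topc_diff topc_T_fixed topc_diag) auto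
  moreover have "(\<lambda>x. ((- y) + 1 * x) \<star> (C k x (B k y u) + B k y (C k x u))) = (\<lambda>x. D k y (A k x u) - D k x (A k y u))"
    using CB[of _ y k u] by simp
  ultimately have "1 \<star> (Tinf k True False (B k y u) + B k y (Tinf k True False u)) = D k y u - A k y u"
    by (rule topc_eqI)
  then show ?thesis by (simp add: eq_diff_eq)
qed

end

context bethe_roots begin

text \<open>The coefficient of y^k in \<open>PQ_B\<close>. The extra term is (q1 - q2) B(x) v, so
  the symmetry under e21 appears exactly through q1 = q2.\<close>

lemma PQ_Binf:
  assumes "q1 = q2" "v \<in> Vsp k"
  shows "PQ x (Tinf k False True v) = Tinf k False True (PQ x v)"
proof -
  note k0 = k_pos[OF assms(1)]
  have k: "Suc (k - 1) = k" using k0 by simp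
  have off: "topc (k - 1) (\<lambda>y. B k y u) (Tinf k False True u)" for u
    using k0 by (intro topc_offdiag) auto
  have "topc k (\<lambda>y. (x + (- 1) * y) \<star> PQ x (B k y v)) ((- 1) \<star> PQ x (Tinf k False True v))"
    unfolding PQ_def
    by (intro topc_linear[where m = "k - 1", unfolded k] topc_diff topc_scal topc_T_fixed off)
  moreover have "topc k (\<lambda>y. ((x - 1) + (- 1) * y) \<star> B k y (PQ x v) + B k x (PQ y v))
      ((- 1) \<star> Tinf k False True (PQ x v) + B k x (q1 \<star> v - q2 \<star> v))"
    unfolding PQ_def[of _ v] using assms(2)
    by (intro topc_add topc_linear[where m = "k - 1", unfolded k] off topc_T_fixed topc_diff topc_scal topc_diag)
  moreover have "(\<lambda>y. (x + (- 1) * y) \<star> PQ x (B k y v)) = (\<lambda>y. ((x - 1) + (- 1) * y) \<star> B k y (PQ x v) + B k x (PQ y v))"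
  proof
    fix y
    have "x + (- 1) * y = x - y" "(x - 1) + (- 1) * y = x - y - 1" by simp_all
    then show "(x + (- 1) * y) \<star> PQ x (B k y v) = ((x - 1) + (- 1) * y) \<star> B k y (PQ x v) + B k x (PQ y v)"
      using PQ_B[of x y v] by presburger
  qed
  ultimately have "(- 1) \<star> PQ x (Tinf k False True v) = (- 1) \<star> Tinf k False True (PQ x v) + B k x (q1 \<star> v - q2 \<star> v)"
    by (rule topc_eqI)
  then show ?thesis using assms(1) by simp
qed

lemma D_minus_A: "q1 = q2 \<Longrightarrow> D k y u - A k y u = (- 1 / q1) \<star> PQ y u"
  unfolding PQ_def using q1 by (auto simp: fun_eq_iff field_simps)

text \<open>By \<open>Cinf_B\<close>, adding r_i to the string produces a multiple of
  \<open>PQ (r i)\<close> on the shorter string, and its eigenvalue there is zero.\<close>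

lemma Cinf_str:
  assumes "q1 = q2" "distinct is" "set is \<subseteq> {..<d}"
  shows "Tinf k True False (str k (map r is)) = 0"
  using assms(2,3)
proof (induction "is")
  case Nil
  have "topc (k - 1) (\<lambda>x. C k x vac) (Tinf k True False vac)"
    using k_pos[OF assms(1)] by (intro topc_offdiag) auto
  moreover have "topc (k - 1) (\<lambda>x. C k x vac) 0"
    unfolding C_vac by (rule topcI[of _ "\<lambda>_. 0"]) auto
  ultimately show "Tinf k True False (str k (map r [])) = 0" using topc_unique by simp
next
  case (Cons i "is")
  have IH: "Tinf k True False (str k (map r is)) = 0"
    by (rule Cons.IH) (use Cons.prems in auto)
  have "PQ (r i) (str k (map r is)) = 0"
    by (subst PQ_str) (use Cons.prems E_root[of i "set is"] in auto)
  then show "Tinf k True False (str k (map r (i # is))) = 0"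
    using Cinf_B[OF k_pos[OF assms(1)], of "str k (map r is)" "r i"] IH D_minus_A[OF assms(1)] by simp
qed

lemma Cinf_G: "q1 = q2 \<Longrightarrow> I \<subseteq> {..<d} \<Longrightarrow> Tinf k True False (G I) = 0"
  unfolding G_def using finite_subset[of I "{..<d}"] by (intro Cinf_str) auto

lemma E_altdef: "E I = smult lc (\<Prod>i<d. [:- (r i + of_bool (i \<in> I)), 1:])"
  by (simp add: E_def)

lemma degree_E: "degree (E I) \<le> d"
  unfolding E_altdef
  using degree_smult_le[of lc] degree_prod_linear[of "\<lambda>i. r i + of_bool (i \<in> I)" "{..<d}"]
  by (metis card_lessThan)

lemma coeff_E: "coeff (E I) d = lc"
  unfolding E_altdef coeff_smult
  using coeff_prod_linear[of "{..<d}" "\<lambda>i. r i + of_bool (i \<in> I)"] by simp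

lemma G_Vsp [simp]: "G I \<in> Vsp k"
  by (simp add: G_def)

text \<open>The top coefficient of \<open>Cinf_B\<close> on v_I, where D - A is -1/q1 times the
  transfer operator and \<open>E I\<close> has leading coefficient \<open>lc\<close>. The factor is
  non-zero, so e21 v_I is not singular once v_I is non-zero.\<close>

lemma Cinf_Binf_G:
  assumes "q1 = q2" "I \<subseteq> {..<d}"
  shows "Tinf k True False (Tinf k False True (G I)) = (- lc / q1) \<star> G I"
proof -
  note k0 = k_pos[OF assms(1)]
  have "topc (k - 1) (\<lambda>y. Tinf k True False (B k y (G I))) (Tinf k True False (Tinf k False True (G I)))"
    using k0 by (intro topc_Tinf topc_offdiag) auto
  moreover have "topc (k - 1) (\<lambda>y. (- 1 / q1) \<star> poly (E I) y \<star> G I) ((- 1 / q1) \<star> coeff (E I) (k - 1) \<star> G I)"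
    using degree_E d assms(1) by (intro topc_scal topc_const_poly) simp
  moreover have "(\<lambda>y. Tinf k True False (B k y (G I))) = (\<lambda>y. (- 1 / q1) \<star> poly (E I) y \<star> G I)"
    using Cinf_B[OF k0 G_Vsp] Cinf_G[OF assms] D_minus_A[OF assms(1)] PQ_G[OF assms(2)] by simp
  ultimately have "Tinf k True False (Tinf k False True (G I)) = (- 1 / q1) \<star> coeff (E I) (k - 1) \<star> G I"
    by (rule topc_eqI)
  moreover have "coeff (E I) (k - 1) = lc" using coeff_E[of I] d assms(1) by simp
  ultimately show ?thesis by simp
qed

end

section \<open>The on-shell strings form a basis\<close>

text \<open>Lets an identity between strings with one free entry be extended by
  \<open>polyfam_eq\<close> to the entries excluded by a cancellation.\<close>

lemma den_poly: "\<exists>e. \<forall>x. den (us @ x # vs) = poly e x"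
proof (induction us)
  case Nil
  have "\<exists>e. \<forall>x. (\<Prod>y\<leftarrow>vs. y - x + 1) = poly e x"
  proof (induction vs)
    case Nil
    show ?case by (auto intro!: exI[of _ 1])
  next
    case (Cons y vs)
    then obtain e where "\<forall>x. (\<Prod>y\<leftarrow>vs. y - x + 1) = poly e x" by blast
    then show ?case by (auto intro!: exI[of _ "[:y + 1, -1:] * e"] simp: algebra_simps)
  qed
  then obtain e where "\<forall>x. (\<Prod>y\<leftarrow>vs. y - x + 1) = poly e x" by blast
  then show ?case by (auto intro!: exI[of _ "smult (den vs) e"])
next
  case (Cons u us)
  then obtain e where "\<forall>x. den (us @ x # vs) = poly e x" by blast
  then show ?case
    by (auto intro!: exI[of _ "smult (\<Prod>y\<leftarrow>us @ vs. y - u + 1) ([:1 - u, 1:] * e)"] simp: algebra_simps)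
qed

lemma (in chain) polyfam_str: "polyfam (\<lambda>x. str k (us @ x # vs))"
proof (induction us)
  case Nil
  show ?case unfolding append_Nil str_Cons by (intro polyfam_T polyfam_const)
next
  case (Cons u us)
  then show ?case unfolding append_Cons str_Cons by (intro polyfam_T_const)
qed

lemma spanning_set_is_basis:
  assumes "finite F" "card F \<le> n" "V \<subseteq> sv.span F" "sv.dim V = n"
  shows "sv.independent F" "card F = n"
proof -
  obtain F' where F': "F' \<subseteq> F" "sv.independent F'" "F \<subseteq> sv.span F'"
    using sv.maximal_independent_subset by blast
  have "V \<subseteq> sv.span F'"
    using assms(3) sv.span_minimal[OF F'(3) sv.subspace_span] by blast
  then have "n \<le> card F'"
    using sv.dim_le_card[of V F'] F'(1) assms(1,4) finite_subset by auto
  then have "F' = F"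
    using assms(1,2) F'(1) by (meson card_seteq le_trans)
  then show "sv.independent F" "card F = n" using F'(2) \<open>n \<le> card F'\<close> assms(2) by auto
qed

lemma dim_Vsp: "sv.dim (Vsp k) = 2 ^ k"
proof -
  define dl :: "nat set \<Rightarrow> svec" where "dl S = (\<lambda>T. if T = S then 1 else 0)" for S
  let ?P = "Pow {..<k}"
  have inj: "inj_on dl ?P"
    by (rule inj_onI) (metis dl_def zero_neq_one)
  have "sv.independent (dl ` ?P)"
  proof -
    have "u v = 0" if "(\<Sum>v\<in>dl ` ?P. u v \<star> v) = 0" "v \<in> dl ` ?P" for u v
    proof -
      from that(2) obtain S where S: "S \<in> ?P" "v = dl S" by blast
      have "0 = (\<Sum>v\<in>dl ` ?P. u v \<star> v) S" using that(1) by simp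
      also have "\<dots> = (\<Sum>T\<in>?P. u (dl T) * dl T S)" by (simp add: sum.reindex[OF inj])
      also have "\<dots> = (\<Sum>T\<in>?P. if T = S then u (dl T) else 0)"
        by (intro sum.cong) (auto simp: dl_def)
      also have "\<dots> = u v" using S by simp
      finally show ?thesis by simp
    qed
    then show ?thesis by (subst sv.dependent_finite) auto
  qed
  moreover have "Vsp k \<subseteq> sv.span (dl ` ?P)"
  proof
    fix v assume v: "v \<in> Vsp k"
    have "v = (\<Sum>S\<in>?P. v S \<star> dl S)"
    proof
      fix T
      have "(\<Sum>S\<in>?P. v S \<star> dl S) T = (\<Sum>S\<in>?P. if S = T then v S else 0)"
        unfolding sum_fun_apply by (intro sum.cong) (auto simp: dl_def)
      then show "v T = (\<Sum>S\<in>?P. v S \<star> dl S) T" using v by (auto simp: Vsp_def)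
    qed
    also have "\<dots> \<in> sv.span (dl ` ?P)" by (intro sv.span_sum sv.span_scale sv.span_base) auto
    finally show "v \<in> sv.span (dl ` ?P)" .
  qed
  moreover have "dl ` ?P \<subseteq> Vsp k" by (auto simp: dl_def Vsp_def split: if_splits)
  ultimately have "card (dl ` ?P) = sv.dim (Vsp k)" by (intro sv.basis_card_eq_dim)
  then show ?thesis using card_image[OF inj] by (simp add: card_Pow)
qed

context bethe_roots begin

text \<open>Division by \<open>N\<close> has to come before the interpolation: if \<open>r m = r i + 1\<close>, then \<open>B\<close> at \<open>r m\<close> kills \<open>G I\<close>
  and only the quotient \<open>q\<close> sees \<open>G (insert m I)\<close>.\<close>

lemma B_G_span:
  assumes I: "I \<subseteq> {..<d}"
  shows "B k x (G I) \<in> sv.span (G ` Pow {..<d} \<union> (if q1 = q2 then {Tinf k False True (G I)} else {}))"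
    (is "_ \<in> sv.span ?U")
proof -
  define N where "N = (\<Prod>i\<in>I. [:- (r i + 1), 1:])"
  define Q where "Q = Tp k False True (G I)"
  define R where "R = r ` ({..<d} - I)"
  have fin: "finite I" using I finite_subset by auto
  have cR: "card R = d - card I"
    unfolding R_def by (subst card_image) (use I fin inj_r in \<open>auto intro: inj_on_subset simp: card_Diff_subset\<close>)
  have cI: "card I \<le> d" using card_mono[OF _ I] by simp
  have degN: "degree N = card I" and lcN: "coeff N (card I) = 1"
    unfolding N_def by (rule degree_prod_linear, rule coeff_prod_linear[OF fin])
  have N0: "N \<noteq> 0" using lcN by auto
  have Q: "poly (Q S) y = B k y (G I) S" for S y
    by (simp add: Q_def poly_Tp)
  have "N dvd Q S" for S
    unfolding N_def
  proof (rule prod_linear_dvd[OF fin])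
    show "inj_on (\<lambda>i. r i + 1) I" using inj_r I by (auto simp: inj_on_def)
    show "poly (Q S) (r i + 1) = 0" if "i \<in> I" for i
      using B_root_shift[OF I that] by (simp add: Q)
  qed
  then have "\<forall>S. \<exists>q. Q S = N * q" by (auto simp: dvd_def)
  then obtain q where q: "\<And>S. Q S = N * q S" by metis
  have Qlt: "degree (q S) + card I < k" if "q S \<noteq> 0" for S
  proof -
    have "Q S \<noteq> 0" using q[of S] that N0 by simp
    then have "degree (Q S) < k"
      using coeff_Tp_offdiag[of False True k "degree (Q S)" "G I" S] unfolding Q_def
      by (metis leading_coeff_0_iff not_le)
    then show ?thesis using that N0 degN by (simp add: q degree_mult_eq)
  qed
  \<comment> \<open>Here deg q < k - |I|. For d = k this is below |R|; for d = k - 1 equality is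
    possible, which leaves one coefficient beyond the values on \<open>R\<close>.\<close>
  have degq: "degree (q S) \<le> card R" for S
    using Qlt[of S] cR d by (cases "q S = 0") (auto split: if_splits)
  have top: "(\<lambda>S. coeff (q S) (card R)) \<in> sv.span ?U"
  proof (cases "q1 = q2")
    case True
    have "coeff (q S) (card R) = Tinf k False True (G I) S" for S
    proof -
      have "card I + card R = k - 1" using cR cI d True by simp
      then have "coeff (q S) (card R) = coeff (Q S) (k - 1)"
        using coeff_mult_le[OF eq_refl[OF degN] degq[of S]] lcN by (simp add: q)
      then show ?thesis using k_pos[OF True] by (simp add: Tinf_def Tc_def Q_def)
    qed
    then show ?thesis using True by (auto intro: sv.span_base)
  next
    case False
    have "coeff (q S) (card R) = 0" for S
      using Qlt[of S] cR cI d False by (cases "q S = 0") (auto intro!: coeff_eq_0)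
    then show ?thesis using sv.span_zero[of ?U] by (simp add: zero_fun_def)
  qed
  have val: "(\<lambda>S. poly (q S) (r m)) \<in> sv.span ?U" if m: "m < d" "m \<notin> I" for m
  proof -
    obtain xs ys where l: "sorted_list_of_set I = xs @ ys" "sorted_list_of_set (insert m I) = xs @ m # ys"
      using insort_key_split[of "sorted_list_of_set I" "\<lambda>x. x" m] m fin by auto
    let ?l = "\<lambda>x. map r xs @ x # map r ys"
    let ?f = "\<lambda>x. den (?l x) \<star> (\<lambda>S. poly (q S) x)"
    \<comment> \<open>Moving x into the slot of \<open>m\<close> yields the product of r_i - x + 1
      over \<open>I\<close>, which is (-1)^|I| N(x), times the denominator of the remaining entries.
      Cancelling N(x) leaves this constant.\<close>
    let ?c = "(- 1) ^ card I * den (map r (xs @ ys))"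
    let ?g = "\<lambda>x. ?c \<star> str k (?l x)"
    have "?f = ?g"
    proof (rule polyfam_eq)
      obtain e where "\<forall>x. den (?l x) = poly e x" using den_poly by blast
      moreover have "polyfam (\<lambda>x. poly e x \<star> (\<lambda>S. poly (q S) x))"
        by (intro polyfam_scal polyfamI[of q "card R"] degq) auto
      ultimately show "polyfam ?f" by simp
      show "polyfam ?g" by (intro polyfam_scal_const polyfam_str)
      show "finite ((\<lambda>i. r i + 1) ` I)" using fin by simp
      fix x assume x: "x \<notin> (\<lambda>i. r i + 1) ` I"
      have pN: "poly N x = (\<Prod>i\<in>I. x - (r i + 1))" by (simp add: N_def poly_prod algebra_simps)
      then have Nx: "poly N x \<noteq> 0" using x fin by auto
      have "(\<Prod>y\<leftarrow>map r xs @ map r ys. y - x + 1) = (\<Prod>i\<leftarrow>sorted_list_of_set I. r i - x + 1)"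
        by (simp add: l o_def)
      also have "\<dots> = (\<Prod>i\<in>I. r i - x + 1)"
        using prod.distinct_set_conv_list[of "sorted_list_of_set I" "\<lambda>i. r i - x + 1"] fin by simp
      also have "\<dots> = (\<Prod>i\<in>I. (- 1) * (x - (r i + 1)))"
        by (intro prod.cong) auto
      also have "\<dots> = (- 1) ^ card I * poly N x"
        by (simp only: prod.distrib pN prod_constant)
      finally have pr: "(\<Prod>y\<leftarrow>map r xs @ map r ys. y - x + 1) = (- 1) ^ card I * poly N x" .
      have "poly N x \<star> ?f x = den (?l x) \<star> B k x (G I)"
        using Q[of _ x] by (simp add: fun_eq_iff q algebra_simps)
      also have "\<dots> = den (?l x) \<star> str k (x # map r xs @ map r ys)"
        by (simp add: G_def l)
      also have "\<dots> = den (x # map r xs @ map r ys) \<star> str k (?l x)"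
        by (rule str_move)
      also have "\<dots> = poly N x \<star> ?g x"
        unfolding den.simps pr by simp
      finally show "?f x = ?g x" using sv.scale_left_imp_eq[OF Nx] by blast
    qed
    then have eq: "?f (r m) = ?g (r m)" by (rule fun_cong)
    have "insert m I \<subseteq> {..<d}" using m I by auto
    from den_roots[OF this] have nz: "den (?l (r m)) \<noteq> 0" by (simp add: l)
    have "?g (r m) = ?c \<star> G (insert m I)" by (simp add: G_def l)
    also have "\<dots> \<in> sv.span ?U"
      by (intro sv.span_scale sv.span_base) (use m I in auto)
    finally show ?thesis
      using subspace_unscale[OF sv.subspace_span nz] eq by metis
  qed
  have "B k x (G I) = (\<Sum>a\<in>R. (poly N x * poly (lagrange_basis R a) x) \<star> (\<lambda>S. poly (q S) a))
      + (poly N x * poly (\<Prod>a\<in>R. [:- a, 1:]) x) \<star> (\<lambda>S. coeff (q S) (card R))" (is "_ = ?rhs")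
  proof
    fix S
    have "finite R" by (simp add: R_def)
    then have "poly (q S) x = (\<Sum>a\<in>R. poly (q S) a * poly (lagrange_basis R a) x)
        + coeff (q S) (card R) * poly (\<Prod>a\<in>R. [:- a, 1:]) x"
      by (subst lagrange_interpolation_le[OF _ degq, of S]) (simp_all add: poly_sum)
    then show "B k x (G I) S = ?rhs S"
      by (simp add: Q[symmetric] q sum_distrib_left algebra_simps)
  qed
  also have "\<dots> \<in> sv.span ?U"
    by (intro sv.span_add sv.span_sum sv.span_scale top) (use val in \<open>auto simp: R_def\<close>)
  finally show ?thesis .
qed

text \<open>At most 2^k vectors in both cases, since d = k - 1 when q1 = q2.\<close>

definition Fs :: "svec set" where
  "Fs = G ` Pow {..<d} \<union> (if q1 = q2 then Tinf k False True ` G ` Pow {..<d} else {})"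

lemma FsE:
  assumes "u \<in> Fs"
  obtains I where "I \<subseteq> {..<d}" "u = G I"
  | I where "q1 = q2" "I \<subseteq> {..<d}" "u = Tinf k False True (G I)"
  using assms unfolding Fs_def by (auto split: if_splits)

text \<open>On e21 v_I the operator \<open>B\<close> can be moved inside by \<open>Binf_B\<close>.
  Applying e21 to the expansion in \<open>B_G_span\<close> stays in the span, because the square of
  e21 is zero.\<close>

lemma B_Fs_span:
  assumes "v \<in> sv.span Fs"
  shows "B k x v \<in> sv.span Fs"
proof -
  have "B k x u \<in> sv.span Fs" if u: "u \<in> Fs" for u
  proof -
    from u show ?thesis
    proof (cases rule: FsE)
      case (1 I)
      have "sv.span (G ` Pow {..<d} \<union> (if q1 = q2 then {Tinf k False True (G I)} else {})) \<subseteq> sv.span Fs"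
        by (rule sv.span_mono) (use 1 in \<open>auto simp: Fs_def\<close>)
      then show ?thesis using B_G_span[OF 1(1)] 1(2) by blast
    next
      case (2 I)
      note k0 = k_pos[OF 2(1)]
      let ?X = "{v. Tinf k False True v \<in> sv.span Fs}"
      have "sv.subspace ?X"
        using sv.subspace_span[of Fs] unfolding sv.subspace_def Tinf_add Tinf_scal mem_Collect_eq
        using Tinf_scal[of k False True 0 0] by auto
      moreover have "G J \<in> ?X" if "J \<subseteq> {..<d}" for J
        unfolding mem_Collect_eq Fs_def using that 2(1) by (auto intro!: sv.span_base)
      moreover have "Tinf k False True (G I) \<in> ?X"
        using Binf_Binf[OF k0] sv.span_zero by simp
      ultimately have "sv.span (G ` Pow {..<d} \<union> (if q1 = q2 then {Tinf k False True (G I)} else {})) \<subseteq> ?X"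
        by (intro sv.span_minimal) (use 2(1) in auto)
      then have "Tinf k False True (B k x (G I)) \<in> sv.span Fs" using B_G_span[OF 2(2)] by blast
      then have "- B k x (Tinf k False True (G I)) \<in> sv.span Fs" using Binf_B[OF k0] by simp
      then show ?thesis unfolding 2(3) using sv.span_neg by fastforce
    qed
  qed
  then have "sv.span Fs \<subseteq> {v. B k x v \<in> sv.span Fs}"
    by (intro sv.span_minimal T_preimage_subspace sv.subspace_span) auto
  then show ?thesis using assms by auto
qed

lemma W_Fs: "W k \<subseteq> sv.span Fs"
proof -
  have "str k ts \<in> sv.span Fs" for ts
  proof (induction ts)
    case Nil
    have "G {} \<in> Fs" by (auto simp: Fs_def)
    then show "str k [] \<in> sv.span Fs" using sv.span_base by (simp add: G_def)
  next
    case (Cons t ts)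
    then show "str k (t # ts) \<in> sv.span Fs" unfolding str_Cons by (rule B_Fs_span)
  qed
  then show ?thesis unfolding W_def by (intro sv.span_minimal sv.subspace_span) auto
qed

lemma Fs_basis:
  assumes "W k = Vsp k"
  shows "finite Fs" "sv.independent Fs" "Vsp k \<subseteq> sv.span Fs"
proof -
  show "finite Fs" by (auto simp: Fs_def)
  show sp: "Vsp k \<subseteq> sv.span Fs" using W_Fs assms by simp
  have c: "card (G ` Pow {..<d}) \<le> 2 ^ d"
    using card_image_le[of "Pow {..<d}" G] by (simp add: card_Pow)
  have "card Fs \<le> 2 ^ k"
  proof (cases "q1 = q2")
    case True
    have "card (Tinf k False True ` G ` Pow {..<d}) \<le> 2 ^ d"
      using c card_image_le[of "G ` Pow {..<d}" "Tinf k False True"] by (meson finite_Pow_iff finite_imageI finite_lessThan le_trans)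
    then have "card Fs \<le> 2 ^ d + 2 ^ d"
      unfolding Fs_def using True c card_Un_le[of "G ` Pow {..<d}" "Tinf k False True ` G ` Pow {..<d}"] by simp
    also have "\<dots> = 2 ^ k" using d True k_pos[OF True] by (cases k) auto
    finally show ?thesis .
  next
    case False
    then show ?thesis unfolding Fs_def using c d by simp
  qed
  then show "sv.independent Fs"
    using spanning_set_is_basis(1)[OF \<open>finite Fs\<close> _ sp dim_Vsp] by simp
qed

text \<open>At the largest index \<open>m\<close> where \<open>I\<close> and \<open>J\<close> differ, exactly one side vanishes at \<open>r m + 1\<close> once the
  common factors are cancelled.\<close>

lemma E_inj:
  assumes "I \<subseteq> {..<d}" "J \<subseteq> {..<d}" "E I = E J"
  shows "I = J"
proof -
  have *: False if IJ: "I \<subseteq> {..<d}" "J \<subseteq> {..<d}" "E I = E J" "m \<in> I" "m \<notin> J"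
    "\<And>i. i \<in> (I - J) \<union> (J - I) \<Longrightarrow> i \<le> m" for I J m
  proof -
    let ?D = "(I - J) \<union> (J - I)"
    let ?f = "\<lambda>I. \<lambda>i. [:- r i - of_bool (i \<in> I), 1:] :: complex poly"
    have fin: "finite ?D" using IJ finite_subset by blast
    have "(\<Prod>i<d. ?f I i) = (\<Prod>i<d. ?f J i)"
      using arg_cong[OF IJ(3)[unfolded E_def], of "smult (1 / lc)"] lc by simp
    moreover have "(\<Prod>i<d. ?f K i) = (\<Prod>i\<in>{..<d} - ?D. ?f K i) * (\<Prod>i\<in>?D. ?f K i)" for K
      by (rule prod.subset_diff) (use IJ in auto)
    moreover have "(\<Prod>i\<in>{..<d} - ?D. ?f I i) = (\<Prod>i\<in>{..<d} - ?D. ?f J i)"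
      by (intro prod.cong) auto
    moreover have "(\<Prod>i\<in>{..<d} - ?D. ?f J i) \<noteq> 0"
      by (simp add: prod_zero_iff)
    ultimately have "(\<Prod>i\<in>?D. ?f I i) = (\<Prod>i\<in>?D. ?f J i)" by simp
    from arg_cong[OF this, of "\<lambda>p. poly p (r m + 1)"]
    have "(\<Prod>i\<in>?D. r m + 1 - r i - of_bool (i \<in> I)) = (\<Prod>i\<in>?D. r m + 1 - r i - of_bool (i \<in> J))"
      by (simp add: poly_prod algebra_simps)
    moreover have "(\<Prod>i\<in>?D. r m + 1 - r i - of_bool (i \<in> I)) = 0"
      by (rule prod_zero[OF fin]) (use IJ in \<open>auto intro!: bexI[of _ m]\<close>)
    \<comment> \<open>For \<open>i\<close> in \<open>J\<close> the factor is r_m - r_i with i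
      \<noteq> m. Otherwise i \<le> m, and the factor has real part at least 1.\<close>
    moreover have "r m + 1 - r i - of_bool (i \<in> J) \<noteq> 0" if "i \<in> ?D" for i
    proof (cases "i \<in> J")
      case True
      then show ?thesis using inj_r IJ by (auto simp: inj_on_def)
    next
      case False
      have "m < d" using IJ by auto
      then show ?thesis
        using that False IJ(6)[OF that] root_gap[of i m 1] by (cases "i = m") (auto simp: algebra_simps)
    qed
    ultimately show False using fin by (metis (no_types, lifting) prod_zero_iff)
  qed
  show ?thesis
  proof (rule ccontr)
    assume "I \<noteq> J"
    let ?D = "(I - J) \<union> (J - I)"
    have fin: "finite ?D" and "?D \<noteq> {}"
      using assms finite_subset[of _ "{..<d}"] \<open>I \<noteq> J\<close> by auto
    then have "Max ?D \<in> ?D" by (rule Max_in)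
    moreover have le: "i \<le> Max ?D" if "i \<in> ?D" for i using fin that by (rule Max_ge)
    moreover have "i \<le> Max ?D" if "i \<in> (J - I) \<union> (I - J)" for i using le that by blast
    ultimately show False
      using *[OF assms, of "Max ?D"] *[OF assms(2,1) assms(3)[symmetric], of "Max ?D"] by blast
  qed
qed

lemma PQ_Fs:
  assumes "u \<in> Fs"
  shows "\<exists>I\<subseteq>{..<d}. (u = G I \<or> q1 = q2 \<and> u = Tinf k False True (G I)) \<and> (\<forall>x. PQ x u = poly (E I) x \<star> u)"
  using assms
proof (cases rule: FsE)
  case (1 I)
  then show ?thesis using PQ_G by (intro exI[of _ I]) auto
next
  case (2 I)
  have "PQ x u = poly (E I) x \<star> u" for x
    unfolding 2(3) by (simp only: PQ_Binf[OF 2(1) G_Vsp] PQ_G[OF 2(2)] Tinf_scal)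
  then show ?thesis using 2 by blast
qed

lemma PQ_sum [simp]: "PQ x (\<Sum>u\<in>X. f u) = (\<Sum>u\<in>X. PQ x (f u))"
  by (induction X rule: infinite_finite_induct) (simp_all del: sum_fun_apply plus_fun_apply zero_fun_apply)

text \<open>By independence, every basis vector that occurs in \<open>v\<close> has the eigenvalue
  of \<open>v\<close>, and \<open>E_inj\<close> then leaves a single index set.\<close>

lemma eigenvector_form:
  assumes "W k = Vsp k" "v \<in> Vsp k" "v \<noteq> 0" "\<And>x. PQ x v = e x \<star> v"
  shows "\<exists>I\<subseteq>{..<d}. v \<in> sv.span ({G I} \<union> (if q1 = q2 then {Tinf k False True (G I)} else {}))"
proof -
  note F = Fs_basis[OF assms(1)]
  obtain c where c: "v = (\<Sum>u\<in>Fs. c u \<star> u)"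
    using assms(2) F(3) sv.span_finite[OF F(1)] by auto
  obtain J where J: "\<And>u. u \<in> Fs \<Longrightarrow> J u \<subseteq> {..<d}"
      "\<And>u. u \<in> Fs \<Longrightarrow> u = G (J u) \<or> q1 = q2 \<and> u = Tinf k False True (G (J u))"
      "\<And>u x. u \<in> Fs \<Longrightarrow> PQ x u = poly (E (J u)) x \<star> u"
    using PQ_Fs by metis
  have e: "c u * (poly (E (J u)) x - e x) = 0" if u: "u \<in> Fs" for u x
  proof -
    have "(\<Sum>u\<in>Fs. (c u * (poly (E (J u)) x - e x)) \<star> u) = PQ x v - e x \<star> v"
      unfolding c by (simp add: J(3) fun_eq_iff sum_distrib_left sum_subtractf algebra_simps)
    then have "(\<Sum>u\<in>Fs. (c u * (poly (E (J u)) x - e x)) \<star> u) = 0" using assms(4) by simp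
    from sv.independentD[OF F(2) F(1) order_refl this u] show ?thesis .
  qed
  obtain u0 where u0: "u0 \<in> Fs" "c u0 \<noteq> 0"
    using assms(3) c by (metis (no_types, lifting) sum.neutral sv.scale_zero_left)
  let ?U = "{G (J u0)} \<union> (if q1 = q2 then {Tinf k False True (G (J u0))} else {})"
  have "c u \<star> u \<in> sv.span ?U" if u: "u \<in> Fs" for u
  proof (cases "c u = 0")
    case False
    have "poly (E (J u)) x = poly (E (J u0)) x" for x
      using e[OF u, of x] e[OF u0(1), of x] False u0(2) by simp
    then have "E (J u) = E (J u0)" by (simp add: poly_eq_poly_eq_iff[symmetric] fun_eq_iff)
    then have "J u = J u0" using E_inj J(1) u u0(1) by blast
    then have "u \<in> ?U" using J(2)[OF u] by auto
    then show ?thesis by (intro sv.span_scale sv.span_base)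
  qed (simp add: sv.span_zero)
  then have "v \<in> sv.span ?U" unfolding c by (rule sv.span_sum)
  then show ?thesis using J(1)[OF u0(1)] by blast
qed

end

context bethe_roots begin

section \<open>Completeness for a cyclic vacuum\<close>

lemma appM_TQcoef: "appM k (TQcoef lam b k q1 q2 n) v =
    q1 \<star> appM k (Tcoef lam b k n False False) v - q2 \<star> appM k (Tcoef lam b k n True True) v"
  by (auto simp: appM_def TQcoef_def fun_eq_iff sum_distrib_left sum_subtractf algebra_simps)

lemma TQ_conv: "appM k (TQcoef lam b k q1 q2 n) v =
    (\<Sum>m\<le>n. fps_nth (inverse (ufps b k)) (n - m) \<star> (q1 \<star> Tc k False False m v - q2 \<star> Tc k True True m v))"
  unfolding appM_TQcoef Tcoef_conv
  by (auto simp: fun_eq_iff sum_distrib_left sum_subtractf algebra_simps)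

lemma TQ_conv': "q1 \<star> Tc k False False n v - q2 \<star> Tc k True True n v =
    (\<Sum>m\<le>n. fps_nth (ufps b k) (n - m) \<star> appM k (TQcoef lam b k q1 q2 m) v)"
  unfolding appM_TQcoef Tc_conv
  by (auto simp: fun_eq_iff sum_distrib_left sum_subtractf algebra_simps)

lemma TQeigvecD:
  assumes "TQeigvec lam b k q1 q2 v"
  shows "\<exists>e. \<forall>x. PQ x v = e x \<star> v"
proof -
  have v: "v \<in> Vsp k" using assms by (simp add: TQeigvec_def)
  have "\<exists>c. appM k (TQcoef lam b k q1 q2 n) v = c \<star> v" for n
  \<comment> \<open>\<open>TQeigvec\<close> starts at n = 1; the coefficient for n = 0 is the scalar
    q1 - q2.\<close>
  proof (cases "n = 0")
    case True
    have "Tc k i i 0 v = v" for i using v by (simp add: Tc_def coeff_Tp_top)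
    then have "appM k (TQcoef lam b k q1 q2 0) v = (q1 - q2) \<star> v"
      by (simp add: TQ_conv sv.scale_left_diff_distrib)
    then show ?thesis using True by blast
  next
    case False
    then show ?thesis using assms by (auto simp: TQeigvec_def scal_def)
  qed
  then obtain c where c: "\<And>n. appM k (TQcoef lam b k q1 q2 n) v = c n \<star> v" by metis
  have *: "q1 \<star> Tc k False False n v - q2 \<star> Tc k True True n v = (\<Sum>m\<le>n. fps_nth (ufps b k) (n - m) * c m) \<star> v" for n
    unfolding TQ_conv' c by (simp add: sv.scale_sum_left)
  have "PQ x v = (\<Sum>m\<le>k. x ^ (k - m) \<star> (q1 \<star> Tc k False False m v - q2 \<star> Tc k True True m v))" for x
    unfolding PQ_def T_conv_Tc by (auto simp: fun_eq_iff sum_distrib_left sum_subtractf algebra_simps)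
  then have "PQ x v = (\<Sum>m\<le>k. x ^ (k - m) * (\<Sum>i\<le>m. fps_nth (ufps b k) (m - i) * c i)) \<star> v" for x
    unfolding * by (simp only: sv.scale_scale sv.scale_sum_left[symmetric])
  then show ?thesis
    by (intro exI[of _ "\<lambda>x. \<Sum>m\<le>k. x ^ (k - m) * (\<Sum>i\<le>m. fps_nth (ufps b k) (m - i) * c i)"] allI)
qed

lemma TQeigvecI:
  assumes "v \<in> Vsp k" "v \<noteq> 0" "\<And>x. PQ x v = poly e x \<star> v"
  shows "TQeigvec lam b k q1 q2 v"
proof -
  have p: "smult q1 (Tp k False False v S) - smult q2 (Tp k True True v S) = smult (v S) e" for S
  proof -
    have "poly (smult q1 (Tp k False False v S) - smult q2 (Tp k True True v S)) x = poly (smult (v S) e) x" for x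
      using fun_cong[OF assms(3)[of x], of S] by (simp add: PQ_def poly_Tp mult.commute)
    then show ?thesis by (simp add: poly_eq_poly_eq_iff[symmetric] fun_eq_iff)
  qed
  have t: "q1 \<star> Tc k False False m v - q2 \<star> Tc k True True m v = (if m \<le> k then coeff e (k - m) else 0) \<star> v" for m
  proof
    fix S
    show "(q1 \<star> Tc k False False m v - q2 \<star> Tc k True True m v) S = ((if m \<le> k then coeff e (k - m) else 0) \<star> v) S"
      using arg_cong[OF p[of S], of "\<lambda>p. coeff p (k - m)"] by (simp add: Tc_def mult.commute)
  qed
  have "\<exists>c. appM k (TQcoef lam b k q1 q2 n) v = c \<star> v" for n
    unfolding TQ_conv t sv.scale_scale sv.scale_sum_left[symmetric] by (rule exI, rule refl)
  then show ?thesis using assms(1,2) by (auto simp: TQeigvec_def scal_def zero_fun_def)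
qed

lemma TQdiag:
  assumes "W k = Vsp k"
  shows "TQdiag lam b k q1 q2"
  unfolding TQdiag_def
proof (intro exI[of _ Fs] conjI ballI allI impI)
  note F = Fs_basis[OF assms]
  show "finite Fs" by (rule F(1))
  show "TQeigvec lam b k q1 q2 u" if u: "u \<in> Fs" for u
  proof -
    obtain I where "\<And>x. PQ x u = poly (E I) x \<star> u" using PQ_Fs[OF u] by blast
    moreover have "u \<in> Vsp k" using u by (cases rule: FsE) auto
    moreover have "u \<noteq> 0" using F(2) u sv.dependent_zero by blast
    ultimately show ?thesis by (intro TQeigvecI)
  qed
  show "\<exists>a. v = (\<lambda>S. \<Sum>u\<in>Fs. a u * u S)" if v: "v \<in> Vsp k" for v
  proof -
    obtain c where "v = (\<Sum>u\<in>Fs. c u \<star> u)"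
      using v F(3) sv.span_finite[OF F(1)] by auto
    then show ?thesis by (intro exI[of _ c]) (simp add: fun_eq_iff)
  qed
  show "a u = 0" if "(\<lambda>S. \<Sum>u\<in>Fs. a u * u S) = (\<lambda>S. 0)" "u \<in> Fs" for a u
  proof -
    have "(\<Sum>u\<in>Fs. a u \<star> u) = 0" using fun_cong[OF that(1)] by (simp add: fun_eq_iff)
    then show ?thesis using sv.independentD[OF F(2) F(1) order_refl _ that(2)] by blast
  qed
qed

text \<open>The admissible order for \<open>bethe_str\<close> is the order of the root indices, and
  in that order the string is \<open>G\<close> itself.\<close>

lemma bethe_G:
  assumes "inj_on \<kappa> {..<l}" "\<kappa> ` {..<l} \<subseteq> {..<d}" "\<And>i. i < l \<Longrightarrow> t i = r (\<kappa> i)"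
  shows "\<exists>c. c \<noteq> 0 \<and> bethe lam b k l t = c \<star> G (\<kappa> ` {..<l})"
proof -
  let ?s = "sort_key \<kappa> [0..<l]"
  have d: "distinct (map \<kappa> ?s)" using assms(1) by (simp add: distinct_map atLeast0LessThan)
  have "sorted_list_of_set (\<kappa> ` {..<l}) = map \<kappa> ?s"
    by (rule sorted_list_of_set_unique[THEN iffD1])
       (use d in \<open>auto simp: strict_sorted_iff atLeast0LessThan card_image[OF assms(1)]\<close>)
  then have s: "map t ?s = map r (sorted_list_of_set (\<kappa> ` {..<l}))"
    using assms(3) by simp
  have "bethe lam b k l t = (1 / den (map t ?s)) \<star> str k (map t ?s)"
  proof (rule bethe_str[OF assms(1)])
    fix i j assume "i < l" "j < l" "\<kappa> i < \<kappa> j"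
    then show "t j - t i + 1 \<noteq> 0" using assms(2,3) root_gap[of "\<kappa> i" "\<kappa> j" 1] by auto
  qed
  then have "bethe lam b k l t = (1 / den (map r (sorted_list_of_set (\<kappa> ` {..<l})))) \<star> G (\<kappa> ` {..<l})"
    unfolding s G_def .
  then show ?thesis using den_roots[OF assms(2)]
    by (intro exI[of _ "1 / den (map r (sorted_list_of_set (\<kappa> ` {..<l})))"]) auto
qed

text \<open>The roots are simple, so a divisor with a repeated argument would force a double
  root.\<close>

lemma BAE_sol_index:
  assumes "BAE_sol lam b k q1 q2 l t"
  shows "\<exists>\<kappa>. inj_on \<kappa> {..<l} \<and> \<kappa> ` {..<l} \<subseteq> {..<d} \<and> (\<forall>i<l. t i = r (\<kappa> i))"
proof -
  let ?p = "smult lc (\<Prod>i<d. [:- r i, 1:])"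
  have dvd: "(\<Prod>i<l. [:- t i, 1:]) dvd ?p"
    using assms unfolding BAE_sol_def factorization .
  have "\<exists>j<d. t i = r j" if "i < l" for i
  proof -
    have "[:- t i, 1:] dvd ?p"
      using that by (intro dvd_trans[OF dvd_prodI dvd]) auto
    then have "poly ?p (t i) = 0" by (simp only: poly_eq_0_iff_dvd)
    then show ?thesis using lc by (auto simp: poly_prod)
  qed
  then obtain \<kappa> where \<kappa>: "\<And>i. i < l \<Longrightarrow> \<kappa> i < d \<and> t i = r (\<kappa> i)" by metis
  have "inj_on \<kappa> {..<l}"
  proof (rule inj_onI, rule ccontr)
    fix i j assume ij: "i \<in> {..<l}" "j \<in> {..<l}" "\<kappa> i = \<kappa> j" "i \<noteq> j"
    let ?m = "\<kappa> i"
    have "[:- t i, 1:] * [:- t j, 1:] dvd (\<Prod>i<l. [:- t i, 1:])"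
      using prod_dvd_prod_subset[of "{..<l}" "{i, j}" "\<lambda>i. [:- t i, 1:]"] ij by simp
    from dvd_trans[OF this dvd] have "[:- t i, 1:] * [:- t j, 1:] dvd ?p" .
    moreover have "t i = r ?m" "t j = r ?m" using \<kappa>[of i] \<kappa>[of j] ij by auto
    ultimately have "[:- r ?m, 1:] * [:- r ?m, 1:] dvd ?p" by (simp only:)
    also have "?p = [:- r ?m, 1:] * smult lc (\<Prod>i\<in>{..<d} - {?m}. [:- r i, 1:])"
      using \<kappa>[of i] ij by (subst prod.remove[of _ ?m]) auto
    finally have "[:- r ?m, 1:] dvd smult lc (\<Prod>i\<in>{..<d} - {?m}. [:- r i, 1:])"
      by (subst (asm) dvd_mult_cancel_left) auto
    then have "poly (smult lc (\<Prod>i\<in>{..<d} - {?m}. [:- r i, 1:])) (r ?m) = 0"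
      by (simp only: poly_eq_0_iff_dvd)
    then have "(\<Prod>j\<in>{..<d} - {?m}. r ?m - r j) = 0"
      using lc by (simp add: poly_prod)
    then obtain j where "j < d" "j \<noteq> ?m" "r ?m = r j" by auto
    moreover have "?m < d" using \<kappa>[of i] ij by simp
    ultimately show False using inj_onD[OF inj_r, of ?m j] by auto
  qed
  then show ?thesis using \<kappa> by (intro exI[of _ \<kappa>]) auto
qed

lemma G_bethe:
  assumes "I \<subseteq> {..<d}"
  shows "\<exists>l t c. BAE_sol lam b k q1 q2 l t \<and> c \<noteq> 0 \<and> bethe lam b k l t = c \<star> G I"
proof -
  have fin: "finite I" using assms finite_subset by auto
  obtain \<kappa> where \<kappa>: "bij_betw \<kappa> {..<card I} I"
    using ex_bij_betw_nat_finite[OF fin] by (auto simp: atLeast0LessThan)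
  let ?t = "\<lambda>i. r (\<kappa> i)"
  have "(\<Prod>i<card I. [:- ?t i, 1:]) = (\<Prod>i\<in>I. [:- r i, 1:])"
    by (rule prod.reindex_bij_betw[OF \<kappa>])
  also have "\<dots> dvd (\<Prod>i<d. [:- r i, 1:])"
    using assms by (intro prod_dvd_prod_subset) auto
  finally have "BAE_sol lam b k q1 q2 (card I) ?t"
    unfolding BAE_sol_def factorization by (rule dvd_smult)
  then show ?thesis
    using bethe_G[of \<kappa> "card I" ?t] \<kappa> assms unfolding bij_betw_def by metis
qed

lemma BA_complete:
  assumes "W k = Vsp k"
  shows "BA_complete lam b k q1 q2"
  unfolding BA_complete_def
proof (intro conjI allI impI)
  note F = Fs_basis[OF assms]
  have Fnz: "u \<noteq> 0" if "u \<in> Fs" for u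
    using F(2) that sv.dependent_zero by blast
  have GFs: "G I \<in> Fs" if "I \<subseteq> {..<d}" for I
    using that unfolding Fs_def by auto
  show "bethe lam b k l t \<noteq> (\<lambda>S. 0)" if bae: "BAE_sol lam b k q1 q2 l t" for l t
  proof -
    obtain \<kappa> where \<kappa>: "inj_on \<kappa> {..<l}" "\<kappa> ` {..<l} \<subseteq> {..<d}" "\<And>i. i < l \<Longrightarrow> t i = r (\<kappa> i)"
      using BAE_sol_index[OF bae] by blast
    obtain c where "c \<noteq> 0" "bethe lam b k l t = c \<star> G (\<kappa> ` {..<l})"
      using bethe_G[OF \<kappa>] by blast
    moreover have "G (\<kappa> ` {..<l}) \<noteq> 0" by (rule Fnz[OF GFs[OF \<kappa>(2)]])
    ultimately have "bethe lam b k l t \<noteq> 0" by simp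
    then show ?thesis by (simp add: zero_fun_def)
  qed
  fix v assume v: "TQeigvec lam b k q1 q2 v \<and> (q1 = q2 \<longrightarrow> singular lam b k v)"
  then have v': "v \<in> Vsp k" "v \<noteq> 0" by (auto simp: TQeigvec_def zero_fun_def)
  obtain e where "\<And>x. PQ x v = e x \<star> v" using TQeigvecD v by blast
  from eigenvector_form[OF assms v' this] obtain I where I: "I \<subseteq> {..<d}"
    "v \<in> sv.span ({G I} \<union> (if q1 = q2 then {Tinf k False True (G I)} else {}))" by blast
  have "\<exists>a. v = a \<star> G I"
  proof (cases "q1 = q2")
    case False
    then show ?thesis using I(2) by (auto simp: sv.span_singleton)
  next
    case True
    then have "v \<in> sv.span (insert (Tinf k False True (G I)) {G I})" using I(2) by (simp add: insert_commute)
    then obtain c where "v - c \<star> Tinf k False True (G I) \<in> sv.span {G I}"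
      using sv.span_breakdown_eq by blast
    then obtain a where "v - c \<star> Tinf k False True (G I) = a \<star> G I"
      by (auto simp: sv.span_singleton)
    then have eq: "v = a \<star> G I + c \<star> Tinf k False True (G I)" by (simp add: diff_eq_eq)
    have "Tinf k True False v = 0" using v True singular_iff by blast
    \<comment> \<open>Apply e12: it kills v_I and sends e21 v_I to a non-zero multiple of v_I, which
      removes the second component.\<close>
    then have "(c * (- lc / q1)) \<star> G I = 0"
      unfolding eq Tinf_add Tinf_scal using Cinf_G[OF True I(1)] Cinf_Binf_G[OF True I(1)] by simp
    then have "c = 0" using Fnz[OF GFs[OF I(1)]] lc q1 by simp
    then show ?thesis using eq by auto
  qed
  then obtain a where a: "v = a \<star> G I" by blast
  then have "a \<noteq> 0" using v'(2) by auto
  obtain l t c where l: "BAE_sol lam b k q1 q2 l t" "c \<noteq> 0" "bethe lam b k l t = c \<star> G I"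
    using G_bethe[OF I(1)] by blast
  have "v = (\<lambda>S. (a / c) * bethe lam b k l t S)"
    unfolding a l(3) using l(2) by auto
  then show "\<exists>l t c. BAE_sol lam b k q1 q2 l t \<and> c \<noteq> 0 \<and> v = (\<lambda>S. c * bethe lam b k l t S)"
    using l(1,2) \<open>a \<noteq> 0\<close> by (metis divide_eq_0_iff)
qed

end

section \<open>Degree of \<open>p\<close> and passage to its ordered roots\<close>

lemma coeff_prod_linear_top:
  fixes a :: "nat \<Rightarrow> complex"
  shows "coeff (\<Prod>s<k. [:a s, 1:]) k = 1"
    "coeff (\<Prod>s<Suc k. [:a s, 1:]) k = (\<Sum>s<Suc k. a s)"
    "degree (\<Prod>s<k. [:a s, 1:]) = k"
proof -
  show 1: "coeff (\<Prod>s<k. [:a s, 1:]) k = 1" for k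
    using coeff_prod_linear[of "{..<k}" "\<lambda>s. - a s"] by simp
  show "degree (\<Prod>s<k. [:a s, 1:]) = k"
    using degree_prod_linear[of "\<lambda>s. - a s" "{..<k}"] by simp
  show "coeff (\<Prod>s<Suc k. [:a s, 1:]) k = (\<Sum>s<Suc k. a s)"
  proof (induction k)
    case (Suc k)
    have "coeff (\<Prod>s<Suc (Suc k). [:a s, 1:]) (Suc k)
        = coeff ((\<Prod>s<Suc k. [:a s, 1:]) * [:a (Suc k), 1:]) (Suc k)"
      by (subst prod.lessThan_Suc) (rule refl)
    also have "\<dots> = a (Suc k) * coeff (\<Prod>s<Suc k. [:a s, 1:]) (Suc k) + coeff (\<Prod>s<Suc k. [:a s, 1:]) k"
      by (subst coeff_mult_linear) simp
    also have "\<dots> = (\<Sum>s<Suc (Suc k). a s)"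
      unfolding Suc 1 by simp
    finally show ?case .
  qed simp
qed

definition bae_poly :: "(nat \<Rightarrow> wt) \<Rightarrow> (nat \<Rightarrow> complex) \<Rightarrow> nat \<Rightarrow> complex \<Rightarrow> complex \<Rightarrow> complex poly" where
  "bae_poly lam b k q1 q2 = smult q1 (phi_poly lam b k) - smult q2 (psi_poly lam b k)"

text \<open>For q1 = q2 the terms x^k cancel; in the coefficient of x^(k-1) the points
  \<open>b\<close> cancel as well, leaving q1 times the sum of lambda_1 + lambda_2. Thus the degree
  does not depend on \<open>b\<close>, and the sum condition excludes k = 0.\<close>

lemma degree_bae_poly:
  assumes "q1 \<noteq> 0" "q1 = q2 \<longrightarrow> (\<Sum>s<k. fst (lam s) + snd (lam s)) \<noteq> 0"
  shows "degree (bae_poly lam b k q1 q2) = (if q1 = q2 then k - 1 else k)" "bae_poly lam b k q1 q2 \<noteq> 0"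
    "q1 = q2 \<Longrightarrow> 0 < k"
proof -
  let ?p = "bae_poly lam b k q1 q2"
  show k0: "0 < k" if "q1 = q2" using assms(2) that by (cases k) auto
  have ck: "coeff ?p k = q1 - q2"
    unfolding bae_poly_def phi_poly_def psi_poly_def coeff_diff coeff_smult coeff_prod_linear_top by simp
  have deg: "degree ?p \<le> k"
    unfolding bae_poly_def phi_poly_def psi_poly_def
    by (intro degree_diff_le order_trans[OF degree_smult_le] eq_refl[OF coeff_prod_linear_top(3)])
  have ck1: "coeff ?p (k - 1) = q1 * (\<Sum>s<k. fst (lam s) + snd (lam s))" if eq: "q1 = q2"
  proof -
    obtain k' where k': "k = Suc k'" using k0[OF eq] by (cases k) auto
    have "coeff ?p (k - 1) = q1 * (\<Sum>s<k. fst (lam s) - b s) - q1 * (\<Sum>s<k. - b s - snd (lam s))"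
      unfolding bae_poly_def phi_poly_def psi_poly_def k' eq
      by (simp only: coeff_diff coeff_smult diff_Suc_1 coeff_prod_linear_top)
    also have "\<dots> = q1 * (\<Sum>s<k. fst (lam s) + snd (lam s))"
      by (simp add: right_diff_distrib[symmetric] sum_subtractf[symmetric])
    finally show ?thesis .
  qed
  have deg_less: "degree ?p < k" if "coeff ?p k = 0" "0 < k"
    using that deg by (metis degree_0 le_neq_implies_less leading_coeff_0_iff)
  show "degree ?p = (if q1 = q2 then k - 1 else k)"
  proof (cases "q1 = q2")
    case True
    have "coeff ?p k = 0" using ck True by simp
    then have "degree ?p \<le> k - 1"
      using deg k0[OF True] deg_less by fastforce
    moreover have "k - 1 \<le> degree ?p" using ck1[OF True] assms True by (intro le_degree) simp
    ultimately show ?thesis using True by simp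
  next
    case False
    then have "k \<le> degree ?p" using ck by (intro le_degree) simp
    then show ?thesis using deg False by simp
  qed
  show "?p \<noteq> 0"
    using ck ck1 assms by (cases "q1 = q2") auto
qed

lemma (in chain) complete_if_cyclic:
  assumes q: "q1 \<noteq> 0" "q2 \<noteq> 0" "q1 = q2 \<longrightarrow> (\<Sum>s<k. fst (lam s) + snd (lam s)) \<noteq> 0"
    and rsq: "rsquarefree (bae_poly lam b k q1 q2)"
    and cyc: "W k = Vsp k"
  shows "TQdiag lam b k q1 q2 \<and> BA_complete lam b k q1 q2"
proof -
  let ?p = "bae_poly lam b k q1 q2"
  note deg = degree_bae_poly(1,2)[OF q(1,3), of b] and k0 = degree_bae_poly(3)[OF q(1,3)]
  let ?Z = "{z. poly ?p z = 0}"
  have "finite ?Z" using poly_roots_finite deg(2) by blast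
  then obtain xs where xs: "set xs = ?Z" "distinct xs" using finite_distinct_list by blast
  define rs where "rs = sort_key Re xs"
  have rs: "set rs = ?Z" "distinct rs" "sorted (map Re rs)"
    using xs by (auto simp: rs_def)
  have dec: "?p = smult (lead_coeff ?p) (\<Prod>i<length rs. [:- rs ! i, 1:])"
  proof -
    have "(\<Prod>i<length rs. [:- rs ! i, 1:]) = (\<Prod>z\<in>?Z. [:- z, 1:])"
      by (rule prod.reindex_bij_betw) (use bij_betw_nth[OF rs(2), of "{..<length rs}" ?Z] rs(1) in auto)
    then show ?thesis using complex_poly_decompose_rsquarefree[OF rsq] by simp
  qed
  have lc: "lead_coeff ?p \<noteq> 0" using deg(2) by simp
  have "degree ?p = length rs"
    using degree_prod_linear[of "(!) rs" "{..<length rs}"] lc by (subst dec) simp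
  then have len: "length rs = (if q1 = q2 then k - 1 else k)" using deg(1) by simp
  interpret bethe_roots lam b k "length rs" q1 q2 "lead_coeff ?p" "(!) rs"
  proof
    show "smult q1 (phi_poly lam b k) - smult q2 (psi_poly lam b k) = smult (lead_coeff ?p) (\<Prod>i<length rs. [:- rs ! i, 1:])"
      using dec unfolding bae_poly_def .
    show "inj_on ((!) rs) {..<length rs}" using rs(2) by (simp add: inj_on_nth)
    show "Re (rs ! i) \<le> Re (rs ! j)" if "i \<le> j" "j < length rs" for i j
      using sorted_nth_mono[OF rs(3), of i j] that by simp
  qed (use lc len k0 q in auto)
  show ?thesis using TQdiag[OF cyc] BA_complete[OF cyc] by blast
qed

section \<open>Cyclicity of the vacuum for generic evaluation points\<close>

text \<open>The inverse of the decomposition into \<open>low\<close> and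
  \<open>high\<close>.\<close>

definition glue :: "nat \<Rightarrow> svec \<Rightarrow> svec \<Rightarrow> svec" where
  "glue k u v = (\<lambda>S. if S \<subseteq> {..<Suc k} then (if k \<in> S then v (S - {k}) else u S) else 0)"

lemma glue_add: "glue k (u + u') (v + v') = glue k u v + glue k u' v'"
  and glue_scal: "glue k (c \<star> u) (c \<star> v) = c \<star> glue k u v"
  and glue_zero: "glue k 0 0 = 0"
  and glue_Vsp [simp]: "glue k u v \<in> Vsp (Suc k)"
  by (auto simp: glue_def fun_eq_iff Vsp_def)

lemma low_glue: "u \<in> Vsp k \<Longrightarrow> low k (glue k u v) = u"
  by (auto simp: low_def glue_def Vsp_def fun_eq_iff)

lemma high_glue: "v \<in> Vsp k \<Longrightarrow> high k (glue k u v) = v"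
proof
  fix S assume v: "v \<in> Vsp k"
  show "high k (glue k u v) S = v S"
  proof (cases "S \<subseteq> {..<k}")
    case True
    then have "insert k S - {k} = S" "insert k S \<subseteq> {..<Suc k}" by auto
    then show ?thesis using True by (simp add: high_def glue_def)
  qed (use v in \<open>simp add: high_def Vsp_def\<close>)
qed

lemma low_Vsp [simp]: "low k v \<in> Vsp k" and high_Vsp [simp]: "high k v \<in> Vsp k"
  by (auto simp: low_def high_def Vsp_def)

lemma glue_low_high: "v \<in> Vsp (Suc k) \<Longrightarrow> glue k (low k v) (high k v) = v"
  by (rule Vsp_Suc_eqI[of _ k]) (simp_all add: low_glue high_glue)

context chain begin

lemma B_glue:
  assumes "u \<in> Vsp k" "v \<in> Vsp k"
  shows "B (Suc k) x (glue k u v) =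
    glue k (al k x \<star> B k x u) ((al k x - 1) \<star> B k x v - D k x (par u))"
  by (rule Vsp_Suc_eqI[of _ k]) (simp_all add: block_simps low_glue high_glue assms)

text \<open>Finitely many exceptional points are allowed, so that scalars such as
  \<open>al k x\<close> may be divided out.\<close>

lemma W_le_if_B_invariant:
  assumes "sv.subspace U" "vac \<in> U" "finite X"
    and "\<And>u x. u \<in> U \<Longrightarrow> u \<in> Vsp k \<Longrightarrow> x \<notin> X \<Longrightarrow> B k x u \<in> U"
  shows "W k \<subseteq> U"
proof -
  have "str k ts \<in> U" for ts
  proof (induction ts)
    case Nil
    show "str k [] \<in> U" using assms(2) by simp
  next
    case (Cons t ts)
    have "polyfam (\<lambda>x. B k x (str k ts))" by (intro polyfam_T polyfam_const)
    then have "(\<lambda>x. B k x (str k ts)) t \<in> U"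
      by (rule polyfam_in_subspace[OF _ assms(1,3)]) (use assms(4) Cons in auto)
    then show "str k (t # ts) \<in> U" by simp
  qed
  then show ?thesis unfolding W_def by (intro sv.span_minimal assms(1)) auto
qed

text \<open>At the zero of \<open>al k\<close> the operator \<open>B\<close> moves the vacuum into the \<open>w\<close>-part of the last factor, with a
  non-zero coefficient by the genericity assumption; the \<open>w\<close>-part is \<open>B\<close>-invariant.\<close>

lemma cyclic_if_generic:
  assumes "\<And>r s. r < s \<Longrightarrow> s < k \<Longrightarrow> b s - fst (lam s) \<noteq> b r + snd (lam r)"
  shows "W k = Vsp k"
  using assms
proof (induction k)
  case 0
  have "Vsp 0 \<subseteq> W 0"
  proof
    fix v assume v: "v \<in> Vsp 0"
    then have "v = v {} \<star> vac" by (auto simp: Vsp_def vac_def fun_eq_iff)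
    moreover have "v {} \<star> vac \<in> W 0"
      using sv.subspace_scale[OF W_subspace str_W[of 0 "[]"]] by simp
    ultimately show "v \<in> W 0" by simp
  qed
  then show ?case using W_Vsp by blast
next
  case (Suc k)
  then have IH: "W k = Vsp k" by simp
  let ?W = "W (Suc k)"
  note sub = W_subspace[of "Suc k"]
  have bad: "finite {x. al k x = c}" for c
  proof -
    have "{x. al k x = c} = {c + b k - fst (lam k)}" by (auto simp: algebra_simps)
    then show ?thesis by simp
  qed
  \<comment> \<open>Used with (c1, c2) = (0, 1) and (1, 0), that is, for the vectors whose copy in
    the \<open>w\<close>-part or in the \<open>v\<close>-part lies in \<open>?W\<close>.\<close>
  have J: "sv.subspace {u. glue k (c1 \<star> u) (c2 \<star> u) \<in> ?W}" for c1 c2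
    unfolding sv.subspace_def
  proof (intro conjI ballI allI)
    show "0 \<in> {u. glue k (c1 \<star> u) (c2 \<star> u) \<in> ?W}" using sv.subspace_0[OF sub] by (simp add: glue_zero)
    show "u + v \<in> {u. glue k (c1 \<star> u) (c2 \<star> u) \<in> ?W}"
      if "u \<in> {u. glue k (c1 \<star> u) (c2 \<star> u) \<in> ?W}" "v \<in> {u. glue k (c1 \<star> u) (c2 \<star> u) \<in> ?W}" for u v
      using that sv.subspace_add[OF sub] by (simp add: sv.scale_right_distrib glue_add)
    show "c \<star> u \<in> {u. glue k (c1 \<star> u) (c2 \<star> u) \<in> ?W}"
      if "u \<in> {u. glue k (c1 \<star> u) (c2 \<star> u) \<in> ?W}" for c u
    proof -
      have "glue k (c1 \<star> c \<star> u) (c2 \<star> c \<star> u) = c \<star> glue k (c1 \<star> u) (c2 \<star> u)"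
        unfolding glue_scal[symmetric] by (simp add: mult.commute)
      then show ?thesis using that sv.subspace_scale[OF sub] by (simp del: sv.scale_scale)
    qed
  qed
  let ?x = "b k - fst (lam k)"
  have "glue k 0 vac \<in> ?W"
  proof -
    let ?c = "\<Prod>s<k. de s ?x"
    have jv: "vac = glue k vac 0"
      by (rule Vsp_Suc_eqI[of _ k]) (simp_all add: low_glue high_glue)
    have "B (Suc k) ?x vac = glue k 0 (- (?c \<star> vac))"
      by (subst jv, subst B_glue) (simp_all add: D_vac)
    then have "(- 1) \<star> B (Suc k) ?x vac = ?c \<star> glue k 0 vac"
      using glue_scal[of k "- 1" 0 "- (?c \<star> vac)"] glue_scal[of k ?c 0 vac] by simp
    moreover have "(- 1) \<star> B (Suc k) ?x vac \<in> ?W"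
      by (intro sv.subspace_scale[OF sub] B_in_W) (use str_W[of "Suc k" "[]"] in simp)
    \<comment> \<open>Each factor is b_k - lambda_1^(k) - b_s - lambda_2^(s), non-zero by the
      hypothesis for the pair s < k.\<close>
    moreover have "?c \<noteq> 0" using Suc.prems[of _ k] by (auto simp: algebra_simps)
    ultimately show ?thesis using subspace_unscale[OF sub] by metis
  qed
  then have "W k \<subseteq> {u. glue k (0 \<star> u) (1 \<star> u) \<in> ?W}"
  proof (intro W_le_if_B_invariant[OF J _ bad[of 1]])
    fix u x assume u: "u \<in> {u. glue k (0 \<star> u) (1 \<star> u) \<in> ?W}" "u \<in> Vsp k" "x \<notin> {x. al k x = 1}"
    have "B (Suc k) x (glue k 0 u) = glue k 0 ((al k x - 1) \<star> B k x u)"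
      using u(2) by (simp add: B_glue)
    also have "\<dots> = (al k x - 1) \<star> glue k 0 (B k x u)"
      using glue_scal[of k "al k x - 1" 0] by simp
    finally have "(al k x - 1) \<star> glue k 0 (B k x u) \<in> ?W"
      using u(1) B_in_W[of "glue k 0 u" "Suc k" x] by simp
    moreover have "al k x - 1 \<noteq> 0" using u(3) by simp
    ultimately have "glue k 0 (B k x u) \<in> ?W" by (rule subspace_unscale[OF sub, rotated])
    then show "B k x u \<in> {u. glue k (0 \<star> u) (1 \<star> u) \<in> ?W}" by simp
  qed simp
  then have high: "glue k 0 u \<in> ?W" if "u \<in> Vsp k" for u using that IH by auto
  have "W k \<subseteq> {u. glue k (1 \<star> u) (0 \<star> u) \<in> ?W}"
  proof (intro W_le_if_B_invariant[OF J _ bad[of 0]])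
    have "vac = glue k vac 0"
      by (rule Vsp_Suc_eqI[of _ k]) (simp_all add: low_glue high_glue)
    then show "vac \<in> {u. glue k (1 \<star> u) (0 \<star> u) \<in> ?W}" using str_W[of "Suc k" "[]"] by simp
    fix u x assume u: "u \<in> {u. glue k (1 \<star> u) (0 \<star> u) \<in> ?W}" "u \<in> Vsp k" "x \<notin> {x. al k x = 0}"
    have "B (Suc k) x (glue k u 0) = glue k (al k x \<star> B k x u) (- D k x (par u))"
      using u(2) by (simp add: B_glue)
    \<comment> \<open>\<open>B\<close> leaks from the \<open>v\<close>-part into the
      \<open>w\<close>-part, but the whole \<open>w\<close>-part is already known to lie in
      \<open>?W\<close>.\<close>
    also have "\<dots> = al k x \<star> glue k (B k x u) 0 + glue k 0 (- D k x (par u))"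
      using glue_scal[of k "al k x" "B k x u" 0] glue_add[of k "al k x \<star> B k x u" 0 0 "- D k x (par u)"] by simp
    finally have "al k x \<star> glue k (B k x u) 0 = B (Suc k) x (glue k u 0) - glue k 0 (- D k x (par u))"
      by simp
    also have "\<dots> \<in> ?W"
    proof (intro sv.subspace_diff[OF sub] B_in_W high)
      show "glue k u 0 \<in> ?W" using u(1) by simp
      show "- D k x (par u) \<in> Vsp k" using sv.subspace_neg[OF Vsp_subspace T_Vsp] .
    qed
    finally show "B k x u \<in> {u. glue k (1 \<star> u) (0 \<star> u) \<in> ?W}"
      using subspace_unscale[OF sub, of "al k x"] u(3) by simp
  qed
  then have low: "glue k u 0 \<in> ?W" if "u \<in> Vsp k" for u using that IH by auto
  have "v \<in> ?W" if "v \<in> Vsp (Suc k)" for v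
  proof -
    have "v = glue k (low k v) 0 + glue k 0 (high k v)"
      using glue_low_high[OF that] glue_add[of k "low k v" 0 0 "high k v"] by simp
    then show ?thesis using sv.subspace_add[OF sub low[OF low_Vsp] high[OF high_Vsp]] by metis
  qed
  then show ?case using W_Vsp by blast
qed

end

section \<open>Generic square-freeness\<close>

lemma polyfun_monom: "polyfun k (\<lambda>b. c * (\<Prod>s<k. b s ^ m s))"
  unfolding polyfun_def by (intro exI[of _ "{m}"] exI[of _ "\<lambda>_. c"]) simp

lemma polyfun_const: "polyfun k (\<lambda>b. c)"
  using polyfun_monom[of k c "\<lambda>_. 0"] by simp

lemma polyfun_coord: "s < k \<Longrightarrow> polyfun k (\<lambda>b. b s)"
proof -
  assume s: "s < k"
  have "(\<Prod>i<k. b i ^ (if i = s then 1 else 0)) = b s" for b :: "nat \<Rightarrow> complex"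
    using s by (simp add: if_distrib[of "\<lambda>n. b _ ^ n"] cong: if_cong)
  then show ?thesis using polyfun_monom[of k 1 "\<lambda>i. if i = s then 1 else 0"] by simp
qed

lemma polyfun_add:
  assumes "polyfun k f" "polyfun k g"
  shows "polyfun k (\<lambda>b. f b + g b)"
proof -
  obtain M c where f: "finite M" "\<And>b. f b = (\<Sum>m\<in>M. c m * (\<Prod>s<k. b s ^ m s))"
    using assms(1) unfolding polyfun_def by blast
  obtain N e where g: "finite N" "\<And>b. g b = (\<Sum>m\<in>N. e m * (\<Prod>s<k. b s ^ m s))"
    using assms(2) unfolding polyfun_def by blast
  have "f b + g b = (\<Sum>m\<in>M \<union> N. ((if m \<in> M then c m else 0) + (if m \<in> N then e m else 0)) * (\<Prod>s<k. b s ^ m s))" for b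
  proof -
    have "f b = (\<Sum>m\<in>M \<union> N. (if m \<in> M then c m else 0) * (\<Prod>s<k. b s ^ m s))"
      unfolding f(2) using f(1) g(1) by (intro sum.mono_neutral_cong_left) auto
    moreover have "g b = (\<Sum>m\<in>M \<union> N. (if m \<in> N then e m else 0) * (\<Prod>s<k. b s ^ m s))"
      unfolding g(2) using f(1) g(1) by (intro sum.mono_neutral_cong_left) auto
    ultimately show ?thesis by (simp add: sum.distrib distrib_right)
  qed
  then show ?thesis
    unfolding polyfun_def using f(1) g(1)
    by (intro exI[of _ "M \<union> N"] exI[of _ "\<lambda>m. (if m \<in> M then c m else 0) + (if m \<in> N then e m else 0)"]) simp
qed

lemma polyfun_if: "polyfun k f \<Longrightarrow> polyfun k g \<Longrightarrow> polyfun k (\<lambda>b. if P then f b else g b)"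
  by (cases P) simp_all

lemma polyfun_sum: "finite I \<Longrightarrow> (\<And>i. i \<in> I \<Longrightarrow> polyfun k (f i)) \<Longrightarrow> polyfun k (\<lambda>b. \<Sum>i\<in>I. f i b)"
  by (induction I rule: finite_induct) (auto intro: polyfun_const polyfun_add)

lemma polyfun_mult:
  assumes "polyfun k f" "polyfun k g"
  shows "polyfun k (\<lambda>b. f b * g b)"
proof -
  obtain M c where f: "finite M" "\<And>b. f b = (\<Sum>m\<in>M. c m * (\<Prod>s<k. b s ^ m s))"
    using assms(1) unfolding polyfun_def by blast
  obtain N e where g: "finite N" "\<And>b. g b = (\<Sum>m\<in>N. e m * (\<Prod>s<k. b s ^ m s))"
    using assms(2) unfolding polyfun_def by blast
  have "f b * g b = (\<Sum>m\<in>M. \<Sum>n\<in>N. (c m * e n) * (\<Prod>s<k. b s ^ (m s + n s)))" for b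
    unfolding f(2) g(2) sum_product by (simp add: power_add prod.distrib mult_ac)
  moreover have "polyfun k (\<lambda>b. \<Sum>m\<in>M. \<Sum>n\<in>N. (c m * e n) * (\<Prod>s<k. b s ^ (m s + n s)))"
    using f(1) g(1) by (intro polyfun_sum polyfun_monom[of k _ "\<lambda>s. _ s + _ s"])
  ultimately show ?thesis by simp
qed

lemma polyfun_prod: "(\<And>i. i \<in> I \<Longrightarrow> polyfun k (f i)) \<Longrightarrow> polyfun k (\<lambda>b. \<Prod>i\<in>I. f i b)"
  by (induction I rule: infinite_finite_induct) (auto intro: polyfun_const polyfun_mult)

lemma polyfun_diff: "polyfun k f \<Longrightarrow> polyfun k g \<Longrightarrow> polyfun k (\<lambda>b. f b - g b)"
  using polyfun_add[of k f "\<lambda>b. (- 1) * g b"] polyfun_mult[OF polyfun_const[of k "- 1"], of g] by simp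

lemma polyfun_coeff_prod:
  fixes n :: nat
  assumes "\<And>s. s < n \<Longrightarrow> polyfun k (a s)"
  shows "polyfun k (\<lambda>b. coeff (\<Prod>s<n. [:a s b, 1:]) j)"
  using assms
proof (induction n arbitrary: j)
  case 0
  show ?case by (simp add: polyfun_const)
next
  case (Suc n)
  have IH: "polyfun k (\<lambda>b. coeff (\<Prod>s<n. [:a s b, 1:]) j)" for j
    by (rule Suc.IH) (simp add: Suc.prems)
  have "polyfun k (\<lambda>b. a n b * coeff (\<Prod>s<n. [:a s b, 1:]) j + (if j = 0 then 0 else 1 * coeff (\<Prod>s<n. [:a s b, 1:]) (j - 1)))"
    using Suc.prems IH by (cases "j = 0") (auto intro!: polyfun_add polyfun_mult polyfun_const)
  then show ?case unfolding prod.lessThan_Suc coeff_mult_linear .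
qed

lemma polyfun_coeff_bae: "polyfun k (\<lambda>b. coeff (bae_poly lam b k q1 q2) j)"
proof -
  have "polyfun k (\<lambda>b. q1 * coeff (\<Prod>s<k. [:fst (lam s) - b s, 1:]) j - q2 * coeff (\<Prod>s<k. [:(0 - b s) - snd (lam s), 1:]) j)"
    by (intro polyfun_diff polyfun_mult polyfun_const polyfun_coeff_prod polyfun_coord)
  then show ?thesis
    by (simp add: bae_poly_def phi_poly_def psi_poly_def)
qed

lemma polyfun_det:
  assumes "\<And>b. M b \<in> carrier_mat n n" "\<And>i j. i < n \<Longrightarrow> j < n \<Longrightarrow> polyfun k (\<lambda>b. M b $$ (i, j))"
  shows "polyfun k (\<lambda>b. det (M b))"
proof -
  have "polyfun k (\<lambda>b. \<Sum>p | p permutes {0..<n}. signof p * (\<Prod>i = 0..<n. M b $$ (i, p i)))"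
    by (intro polyfun_sum polyfun_mult polyfun_const polyfun_prod assms(2))
      (auto simp: finite_permutations permutes_in_image)
  then show ?thesis using det_def'[OF assms(1)] by simp
qed

text \<open>The block sizes are fixed beforehand instead of being read off the degrees of
  \<open>p b\<close> and \<open>q b\<close>, so the matrix keeps one shape for all
  \<open>b\<close>.\<close>

lemma polyfun_sylvester:
  assumes "\<And>j. polyfun k (\<lambda>b. coeff (p b) j)" "\<And>j. polyfun k (\<lambda>b. coeff (q b) j)"
  shows "polyfun k (\<lambda>b. det (sylvester_mat_sub m n (p b) (q b)))"
proof (rule polyfun_det)
  show "sylvester_mat_sub m n (p b) (q b) \<in> carrier_mat (m + n) (m + n)" for b
    by (rule sylvester_mat_sub_carrier)
  show "polyfun k (\<lambda>b. sylvester_mat_sub m n (p b) (q b) $$ (i, j))" if "i < m + n" "j < m + n" for i j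
    unfolding sylvester_mat_sub_index[OF that] by (intro polyfun_if assms polyfun_const)
qed

section \<open>Discriminant and existence of a generic point\<close>

lemma rsquarefree_iff_resultant:
  fixes p :: "complex poly"
  assumes "p \<noteq> 0"
  shows "rsquarefree p \<longleftrightarrow> resultant p (pderiv p) \<noteq> 0"
proof -
  let ?g = "gcd p (pderiv p)"
  have g0: "?g \<noteq> 0" using assms by simp
  have "degree ?g \<noteq> 0 \<longleftrightarrow> (\<exists>a. poly p a = 0 \<and> poly (pderiv p) a = 0)"
  proof
    assume "degree ?g \<noteq> 0"
    then have "\<not> constant (poly ?g)" by (simp add: constant_degree)
    then obtain a where "poly ?g a = 0" using fundamental_theorem_of_algebra by blast
    then have "[:- a, 1:] dvd ?g" by (simp only: poly_eq_0_iff_dvd)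
    then have "[:- a, 1:] dvd p \<and> [:- a, 1:] dvd pderiv p" using dvd_trans gcd_dvd1 gcd_dvd2 by blast
    then show "\<exists>a. poly p a = 0 \<and> poly (pderiv p) a = 0" by (auto simp only: poly_eq_0_iff_dvd)
  next
    assume "\<exists>a. poly p a = 0 \<and> poly (pderiv p) a = 0"
    then obtain a where "[:- a, 1:] dvd p" "[:- a, 1:] dvd pderiv p" by (auto simp only: poly_eq_0_iff_dvd)
    then have "[:- a, 1:] dvd ?g" by (rule gcd_greatest)
    from dvd_imp_degree_le[OF this g0] show "degree ?g \<noteq> 0" by simp
  qed
  then show ?thesis unfolding rsquarefree_roots resultant_0_gcd by blast
qed

text \<open>At a double root \<open>x\<close>, eliminating \<open>a = x + h x / g x\<close> leaves an equation for \<open>x\<close> alone.\<close>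

lemma squarefree_last_factor:
  fixes g h :: "complex poly"
  assumes coprime: "\<And>x. poly g x = 0 \<Longrightarrow> poly h x \<noteq> 0"
    and nonconst: "\<And>a. degree ([:- a, 1:] * g + h) > 0"
  shows "finite {a. \<not> rsquarefree ([:- a, 1:] * g + h)}"
proof -
  \<comment> \<open>Multiply the equation for the derivative, g + (x - a) g' + h' = 0, by g and
    replace (x - a) g by -h.\<close>
  let ?G = "g * g + pderiv h * g - h * pderiv g"
  have G0: "?G \<noteq> 0"
  proof
    assume G: "?G = 0"
    \<comment> \<open>If \<open>?G\<close> is zero, g divides h g'. At a root of g of order n this
      is impossible: h does not vanish there and g' has order n - 1.\<close>
    have noroot: "poly g x \<noteq> 0" if g0: "g \<noteq> 0" for x
    proof
      assume x: "poly g x = 0"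
      let ?n = "order x g"
      have "h * pderiv g = g * (g + pderiv h)" using G by (simp add: algebra_simps)
      then have "[:- x, 1:] ^ ?n dvd h * pderiv g" using order_1[of x g] by (metis dvd_mult2)
      moreover have pd0: "pderiv g \<noteq> 0"
        using x g0 by (metis pderiv_eq_0_iff degree_eq_zeroE mult_zero_right pCons_0_0 poly_0 poly_pCons add.right_neutral)
      moreover have h0: "poly h x \<noteq> 0" using coprime[OF x] .
      ultimately have "?n \<le> order x (h * pderiv g)"
        by (metis mult_eq_0_iff order_max poly_0)
      also have "\<dots> = order x h + order x (pderiv g)"
        by (rule order_mult) (use pd0 h0 in auto)
      also have "order x h = 0" using h0 by (simp add: order_0I)
      finally show False using order_pderiv[OF g0 x] by simp
    qed
    \<comment> \<open>So g is zero or a non-zero constant. In the first case h would have no root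
      although it is not constant; in the second, \<open>?G = 0\<close> makes the derivative of the
      whole polynomial vanish.\<close>
    show False
    proof (cases "g = 0")
      case True
      have "\<not> constant (poly h)"
        using nonconst[of 0] True by (simp add: constant_degree)
      then obtain x where "poly h x = 0" using fundamental_theorem_of_algebra by blast
      then show False using coprime[of x] True by simp
    next
      case False
      then have "constant (poly g)" using noroot fundamental_theorem_of_algebra by blast
      then have "degree g = 0" by (simp add: constant_degree)
      then obtain c where c: "g = [:c:]" using degree_eq_zeroE by blast
      then have "[:c:] * ([:c:] + pderiv h) = 0" using G by (simp add: algebra_simps)
      then have "[:c:] + pderiv h = 0" using False c by simp
      then have "pderiv ([:- 0, 1:] * g + h) = 0" unfolding c by (simp add: pderiv_add pderiv_pCons pderiv_smult)
      then show False using nonconst[of 0] by (simp only: pderiv_eq_0_iff)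
    qed
  qed
  have "{a. \<not> rsquarefree ([:- a, 1:] * g + h)} \<subseteq> (\<lambda>x. x + poly h x / poly g x) ` {x. poly ?G x = 0}"
  proof
    fix a assume "a \<in> {a. \<not> rsquarefree ([:- a, 1:] * g + h)}"
    then obtain x where x: "poly ([:- a, 1:] * g + h) x = 0" "poly (pderiv ([:- a, 1:] * g + h)) x = 0"
      by (auto simp only: mem_Collect_eq rsquarefree_roots)
    have pd: "pderiv ([:- a, 1:] * g + h) = [:- a, 1:] * pderiv g + g + pderiv h"
      unfolding pderiv_add pderiv_mult by (simp add: pderiv_pCons)
    have 1: "(x - a) * poly g x + poly h x = 0"
      and 2: "poly g x + (x - a) * poly (pderiv g) x + poly (pderiv h) x = 0"
      using x(1) x(2)[unfolded pd] by (simp_all add: algebra_simps)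
    have g: "poly g x \<noteq> 0" using 1 coprime[of x] by auto
    have "poly ?G x = 0" using 1 2 unfolding poly_diff poly_add poly_mult by Groebner_Basis.algebra
    moreover have "a = x + poly h x / poly g x" using 1 g by (simp add: field_simps)
    ultimately show "a \<in> (\<lambda>x. x + poly h x / poly g x) ` {x. poly ?G x = 0}" by blast
  qed
  then show ?thesis using poly_roots_finite[OF G0] by (meson finite_imageI finite_subset)
qed

text \<open>With the other points far apart, \<open>p\<close> depends on the last point through (x -
  a) g + h with g and h without common root, so only finitely many positions of that point are
  bad.\<close>

lemma exists_generic_point:
  assumes nd: "\<forall>s<k. nondeg (lam s)" and q: "q1 \<noteq> 0" "q2 \<noteq> 0"
    and sum: "q1 = q2 \<longrightarrow> (\<Sum>s<k. fst (lam s) + snd (lam s)) \<noteq> 0"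
  shows "\<exists>b. (\<forall>s<k. \<forall>r<s. b s - fst (lam s) \<noteq> b r + snd (lam r)) \<and> rsquarefree (bae_poly lam b k q1 q2)"
proof -
  note deg = degree_bae_poly[OF q(1) sum]
  have const: "rsquarefree (bae_poly lam b k q1 q2)" if "degree (bae_poly lam b k q1 q2) = 0" for b
    using that deg(2)[of b] by (auto simp: rsquarefree_roots elim!: degree_eq_zeroE)
  show ?thesis
  proof (cases "\<exists>b. degree (bae_poly lam b k q1 q2) = 0")
    case True
    then have "degree (bae_poly lam b k q1 q2) = 0" for b using deg(1) by metis
    \<comment> \<open>The degree is the same for all \<open>b\<close>, so \<open>undefined\<close>
      stands for any choice. Degree 0 forces k \<le> 1, where no pair r < s < k exists.\<close>
    moreover from this[of undefined] have "k \<le> 1" using deg(1)[of undefined] by (auto split: if_splits)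
    ultimately show ?thesis using const by (intro exI[of _ undefined]) auto
  next
    case False
    then have k: "0 < k" using deg(1) by (auto split: if_splits intro!: gr0I)
    then obtain K where K: "k = Suc K" by (cases k) auto
    \<comment> \<open>\<open>N\<close> exceeds every norm of lambda_1^(s) + lambda_2^(r), so points
      at mutual distance at least \<open>N\<close> satisfy no relation b_s - b_r = lambda_1^(s) +
      lambda_2^(r). The case s = r is non-degeneracy.\<close>
    define N where "N = 1 + (\<Sum>s<k. \<Sum>r<k. norm (fst (lam s) + snd (lam r)))"
    have N: "norm (fst (lam s) + snd (lam r)) < N" if "s < k" "r < k" for s r
    proof -
      have "norm (fst (lam s) + snd (lam r)) \<le> (\<Sum>r<k. norm (fst (lam s) + snd (lam r)))"
        using that by (intro member_le_sum) auto
      also have "\<dots> \<le> (\<Sum>s<k. \<Sum>r<k. norm (fst (lam s) + snd (lam r)))"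
        using that by (intro member_le_sum[of s _ "\<lambda>s. \<Sum>r<k. norm (fst (lam s) + snd (lam r))"]) (auto intro: sum_nonneg)
      finally show ?thesis by (simp add: N_def)
    qed
    define b0 where "b0 s = complex_of_real (N * real s)" for s
    have sep: "b0 s - fst (lam s) \<noteq> b0 r + snd (lam r)" if "s < k" "r < k" for s r
    proof
      assume "b0 s - fst (lam s) = b0 r + snd (lam r)"
      then have eq: "fst (lam s) + snd (lam r) = b0 s - b0 r" by (simp add: algebra_simps)
      show False
      proof (cases "s = r")
        case True
        then show False using eq nd that by (auto simp: nondeg_def)
      next
        case False
        have N0: "0 < N" using N[OF that] norm_ge_zero le_less_trans by blast
        have "norm (b0 s - b0 r) = norm (complex_of_real (N * (real s - real r)))"
          by (simp add: b0_def algebra_simps)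
        also have "\<dots> = N * \<bar>real s - real r\<bar>" using N0 by (simp only: norm_of_real abs_mult abs_of_pos)
        also have "\<dots> \<ge> N * 1" using False N0 by (intro mult_left_mono) auto
        finally show False using N[OF that] eq by simp
      qed
    qed
    define g where "g = bae_poly lam b0 K q1 q2"
    define c where "c = fst (lam K) + snd (lam K)"
    define h where "h = smult (q2 * c) (psi_poly lam b0 K)"
    \<comment> \<open>The shift puts the root of the last factor of phi at \<open>a\<close> and that
      of psi at \<open>a + c\<close>; this yields the form (x - a) g + h with h = q2 c psi.\<close>
    define bb where "bb a = b0(K := a + fst (lam K))" for a
    have c0: "c \<noteq> 0" using nd K by (simp add: c_def nondeg_def)
    have p: "bae_poly lam (bb a) k q1 q2 = [:- a, 1:] * g + h" for a
    proof -
      have phi: "phi_poly lam (bb a) k = phi_poly lam b0 K * [:- a, 1:]"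
        unfolding phi_poly_def K prod.lessThan_Suc by (simp add: bb_def)
      have psi: "psi_poly lam (bb a) k = psi_poly lam b0 K * [:- a - c, 1:]"
        unfolding psi_poly_def K prod.lessThan_Suc by (simp add: bb_def c_def algebra_simps)
      show ?thesis
      proof (rule poly_eq_poly_eq_iff[THEN iffD1], rule ext)
        fix x
        show "poly (bae_poly lam (bb a) k q1 q2) x = poly ([:- a, 1:] * g + h) x"
          unfolding bae_poly_def g_def h_def phi psi by (simp add: algebra_simps)
      qed
    qed
    have "finite {a. \<not> rsquarefree ([:- a, 1:] * g + h)}"
    proof (rule squarefree_last_factor)
      show "0 < degree ([:- a, 1:] * g + h)" for a using False p[of a] by (metis gr0I)
      show "poly h x \<noteq> 0" if "poly g x = 0" for x
      proof
        assume "poly h x = 0"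
        then have psi: "poly (psi_poly lam b0 K) x = 0" using q(2) c0 by (simp add: h_def)
        then have phi: "poly (phi_poly lam b0 K) x = 0" using that q(1) by (simp add: g_def bae_poly_def)
        obtain r where "r < K" "x = b0 r + snd (lam r)"
          using psi by (auto simp: psi_poly_def poly_prod algebra_simps add_eq_0_iff)
        moreover obtain s where "s < K" "x = b0 s - fst (lam s)"
          using phi by (auto simp: phi_poly_def poly_prod algebra_simps add_eq_0_iff)
        ultimately show False using sep[of s r] K by auto
      qed
    qed
    moreover have "finite ((\<lambda>r. b0 r + snd (lam r)) ` {..<K})" by simp
    ultimately have "finite ({a. \<not> rsquarefree ([:- a, 1:] * g + h)} \<union> (\<lambda>r. b0 r + snd (lam r)) ` {..<K})" by simp
    then obtain a where a: "rsquarefree ([:- a, 1:] * g + h)" "a \<notin> (\<lambda>r. b0 r + snd (lam r)) ` {..<K}"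
      using ex_new_if_finite[OF infinite_UNIV_char_0] by blast
    show ?thesis
    proof (intro exI conjI allI impI)
      show "rsquarefree (bae_poly lam (bb a) k q1 q2)" using a(1) p by simp
      show "bb a s - fst (lam s) \<noteq> bb a r + snd (lam r)" if "s < k" "r < s" for s r
        using that a(2) sep[of s r] K by (cases "s = K") (auto simp: bb_def)
    qed
  qed
qed

theorem theorem2p9:
  fixes lam :: "nat \<Rightarrow> complex \<times> complex" and k :: nat and q1 q2 :: complex
  assumes "\<forall>s<k. nondeg (lam s)"
    and "q1 \<noteq> 0" and "q2 \<noteq> 0"
    and "q1 = q2 \<longrightarrow> (\<Sum>s<k. fst (lam s) + snd (lam s)) \<noteq> 0"
  shows "(\<forall>b. irreducible_mod lam b k \<and>
              rsquarefree (smult q1 (phi_poly lam b k) - smult q2 (psi_poly lam b k))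
            \<longrightarrow> TQdiag lam b k q1 q2 \<and> BA_complete lam b k q1 q2)
       \<and> (\<exists>f. polyfun k f \<and> (\<exists>b. f b \<noteq> 0) \<and>
            (\<forall>b. f b \<noteq> 0 \<longrightarrow> TQdiag lam b k q1 q2 \<and> BA_complete lam b k q1 q2))"
proof (intro conjI allI impI)
  fix b
  assume "irreducible_mod lam b k \<and> rsquarefree (smult q1 (phi_poly lam b k) - smult q2 (psi_poly lam b k))"
  then have "TQdiag lam b k q1 q2 \<and> BA_complete lam b k q1 q2"
    using chain.complete_if_cyclic[OF assms(2-4)] chain.irreducible_imp_cyclic
    unfolding bae_poly_def by blast
  then show "TQdiag lam b k q1 q2" "BA_complete lam b k q1 q2" by auto
next
  define d where "d = (if q1 = q2 then k - 1 else k)"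
  let ?p = "\<lambda>b. bae_poly lam b k q1 q2"
  \<comment> \<open>The linear factors express the hypothesis of \<open>cyclic_if_generic\<close>;
    the determinant is the resultant of \<open>p\<close> and its derivative. The sizes d and d - 1
    are their degrees for every \<open>b\<close>.\<close>
  define f where "f b = (\<Prod>s<k. \<Prod>r<s. b s - fst (lam s) - (b r + snd (lam r))) *
      det (sylvester_mat_sub d (d - 1) (?p b) (pderiv (?p b)))" for b
  note deg = degree_bae_poly[OF assms(2,4)]
  have res: "rsquarefree (?p b) \<longleftrightarrow> det (sylvester_mat_sub d (d - 1) (?p b) (pderiv (?p b))) \<noteq> 0" for b
    using rsquarefree_iff_resultant[OF deg(2)[of b]]
    unfolding resultant_def sylvester_mat_def by (simp add: degree_pderiv deg(1) d_def)
  have gen: "(\<Prod>s<k. \<Prod>r<s. b s - fst (lam s) - (b r + snd (lam r))) \<noteq> 0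
      \<longleftrightarrow> (\<forall>s<k. \<forall>r<s. b s - fst (lam s) \<noteq> b r + snd (lam r))" for b
    by auto
  have f: "f b \<noteq> 0 \<longleftrightarrow> (\<forall>s<k. \<forall>r<s. b s - fst (lam s) \<noteq> b r + snd (lam r)) \<and> rsquarefree (?p b)" for b
    unfolding f_def res gen[symmetric] by simp
  show "\<exists>f. polyfun k f \<and> (\<exists>b. f b \<noteq> 0) \<and>
            (\<forall>b. f b \<noteq> 0 \<longrightarrow> TQdiag lam b k q1 q2 \<and> BA_complete lam b k q1 q2)"
  proof (intro exI[of _ f] conjI allI impI)
    show "polyfun k f"
      unfolding f_def
    proof (intro polyfun_mult polyfun_prod polyfun_diff polyfun_add polyfun_const polyfun_coord polyfun_sylvester polyfun_coeff_bae)
      show "polyfun k (\<lambda>b. coeff (pderiv (?p b)) j)" for j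
        unfolding coeff_pderiv by (intro polyfun_mult polyfun_const polyfun_coeff_bae)
    qed auto
    show "\<exists>b. f b \<noteq> 0"
      unfolding f by (rule exists_generic_point[OF assms])
    fix b assume "f b \<noteq> 0"
    \<comment> \<open>Cyclicity of the vacuum comes directly from the position of the points,
      without passing through irreducibility.\<close>
    then have "rsquarefree (?p b)" "chain.W lam b k = Vsp k"
      unfolding f by (auto intro!: chain.cyclic_if_generic)
    then have "TQdiag lam b k q1 q2 \<and> BA_complete lam b k q1 q2"
      using chain.complete_if_cyclic[OF assms(2-4)] by blast
    then show "TQdiag lam b k q1 q2" "BA_complete lam b k q1 q2" by auto
  qed
qed

end
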